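(* Let $K$ be a field, $\mathcal{G}$ a locally compact Hausdorff ample groupoid and $c:\mathcal{G}\to\mathbb{Z}$ a continuous cocycle, and write $\mathcal{G}_n=c^{-1}(n)$. Suppose that $c$ is unperforated in the sense that if $n>0$ and $g\in\mathcal{G}_n$, then there exist $g_1,\dots,g_n\in\mathcal{G}_1$ such that $g=g_1\cdots g_n$. Then with $H_0:=\mathcal{G}_0$, $H_1:=\mathcal{G}_1$ and $H_{-1}:=\mathcal{G}_{-1}$ the following conditions are satisfied: (i) $H_0$ is closed under multiplication, $H_0H_1\cup H_1H_0\subseteq H_1$, $H_0H_{-1}\cup H_{-1}H_0\subseteq H_{-1}$, $H_{-1}H_1\subseteq H_0$, and $r(H_1)\cup s(H_{-1})\subseteq H_1H_{-1}$; (ii) for every compact open bisection $B\subseteq H_0$ with $s(B)\cap r(H_1)=\emptyset$ one has $s(B)\subseteq H_0$; (iii) every element of $\mathcal{G}$ can be written as a product of elements from $H_0$, $H_1$ and $H_{-1}$. Consequently, there is a graded algebra isomorphism from $A_K(\mathcal{G})$ to the Cuntz--Pimsner ring of the $A_K(\mathcal{G}_0)$-system $(A_K(\mathcal{G})_{-1},A_K(\mathcal{G})_1,\psi)$, where $\psi:A_K(\mathcal{G})_{-1}\otimes_{A_K(\mathcal{G}_0)}A_K(\mathcal{G})_1\to A_K(\mathcal{G}_0)$ is the bimodule homomorphism with $\psi(a\otimes b)=ab$.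
   Context: Groupoids and Steinberg algebras. For a groupoid $\mathcal{G}$ with range and source maps $r,s$, the product $\gamma\mu$ is defined when $s(\gamma)=r(\mu)$; for subsets $X,Y\subseteq\mathcal{G}$, $XY=\{xy:x\in X,y\in Y,s(x)=r(y)\}$. "$H_0$ is closed under multiplication" means $H_0H_0\subseteq H_0$. A product of elements means a finite composable product with at least one factor. An open bisection is an open set $B\subseteq\mathcal{G}$ on which $r$ and $s$ restrict to homeomorphisms onto open subsets of the unit space. An ample Hausdorff groupoid is a topological groupoid whose topology is Hausdorff and has a base of compact open bisections. A continuous cocycle is a continuous groupoid homomorphism $c:\mathcal{G}\to\mathbb{Z}$, with $\mathbb{Z}$ discrete. The Steinberg algebra $A_K(\mathcal{G})$ is the $K$-linear span of the characteristic functions $1_B:\mathcal{G}\to K$ of compact open bisections $B$, with pointwise addition and scalar multiplication, and convolution product, so that $1_B1_D=1_{BD}$. It is $\mathbb{Z}$-graded by $A_K(\mathcal{G})_n=\{f\in A_K(\mathcal{G}): f(\gamma)\ne0\Rightarrow c(\gamma)=n\}$. For a clopen $H\subseteq\mathcal{G}$, $A_K(H):=\{f\in A_K(\mathcal{G}): f(\gamma)=0\text{ for }\gamma\notin H\}$; thus $A_K(\mathcal{G}_n)=A_K(\mathcal{G})_n$. Cuntz--Pimsner rings (Carlsen--Ortega). Rings are associative and need not be unital. Let $R$ be a ring. An $R$-system is a triple $(P,Q,\psi)$ with $P,Q$ $R$-bimodules and $\psi:P\otimes_R Q\to R$ an $R$-bimodule homomorphism ($\otimes_R$ is the $R$-balanced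 tensor product). A covariant representation $(S,T,\sigma,B)$ of $(P,Q,\psi)$ consists of a ring $B$, additive maps $S:P\to B$, $T:Q\to B$, and a ring homomorphism $\sigma:R\to B$ such that $S(pr)=S(p)\sigma(r)$, $S(rp)=\sigma(r)S(p)$, $T(qr)=T(q)\sigma(r)$, $T(rq)=\sigma(r)T(q)$ and $\sigma(\psi(p\otimes_R q))=S(p)T(q)$ for all $r\in R,p\in P,q\in Q$. The Toeplitz ring $\mathcal{T}_{(P,Q,\psi)}$, with maps $\iota_P,\iota_Q,\iota_R$, is the universal covariant representation: it is generated as a ring by $\iota_R(R)\cup\iota_Q(Q)\cup\iota_P(P)$, and every covariant representation $(S,T,\sigma,B)$ factors uniquely through a ring homomorphism $\mathcal{T}_{(P,Q,\psi)}\to B$. It is $\mathbb{Z}$-graded with $\iota_R(R)$ in degree $0$, $\iota_Q(Q)$ in degree $1$ and $\iota_P(P)$ in degree $-1$. For $p\in P,q\in Q$ let $\theta_{q,p}:Q\to Q$, $\theta_{q,p}(x)=q\,\psi(p\otimes_R x)$, and $\theta_{p,q}:P\to P$, $\theta_{p,q}(y)=\psi(y\otimes_R q)\,p$. Let $\mathcal{F}_P(Q)$ be the additive span of the maps $\theta_{q,p}$ and $\mathcal{F}_Q(P)$ the additive span of the maps $\theta_{p,q}$. The system satisfies condition (FS) if for all finite sets $\{q_1,\dots,q_n\}\subseteq Q$ and $\{p_1,\dots,p_m\}\subseteq P$ there are $\Theta\in\mathcal{F}_P(Q)$ and $\Phi\in\mathcal{F}_Q(P)$ with $\Theta(q_i)=q_i$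 and $\Phi(p_j)=p_j$ for all $i,j$. Let $\Delta:R\to\operatorname{End}_R(Q_R)$ be $\Delta(r)(q)=rq$. Under (FS), for each covariant representation $(S,T,\sigma,B)$ there is a unique ring homomorphism $\pi_{T,S}:\mathcal{F}_P(Q)\to B$ with $\pi_{T,S}(\theta_{q,p})=T(q)S(p)$ (a known fact). A two-sided ideal $L$ of $R$ is $\psi$-compatible if $L\subseteq\Delta^{-1}(\mathcal{F}_P(Q))$, and a $\psi$-compatible $L$ is faithful if $L\cap\ker\Delta=\{0\}$. A faithful $\psi$-compatible two-sided ideal $L$ is uniquely maximal if it contains every faithful $\psi$-compatible two-sided ideal of $R$. If the system satisfies (FS) and a uniquely maximal faithful $\psi$-compatible two-sided ideal $L$ exists, the Cuntz--Pimsner ring is $\mathcal{O}_{(P,Q,\psi)}=\mathcal{T}_{(P,Q,\psi)}/\mathcal{T}(L)$, where $\mathcal{T}(L)$ is the two-sided ideal generated by $\{\iota_R(x)-\pi_{\iota_Q,\iota_P}(\Delta(x)):x\in L\}$; it inherits the $\mathbb{Z}$-grading of $\mathcal{T}_{(P,Q,\psi)}$. An assertion about the Cuntz--Pimsner ring of a system is understood to include that it is defined (i.e. (FS) holds and such an $L$ exists). "Graded algebra isomorphism" means an isomorphism of $\mathbb{Z}$-graded rings that is $K$-linear for the $K$-algebra structure on the Cuntz--Pimsner ring making the canonical maps from $R$, $Q$, $P$ into it $K$-linear. *)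

theory Defs
  imports "HOL-Analysis.Abstract_Topological_Spaces" "HOL-Algebra.Free_Abelian_Groups" "HOL-Algebra.QuotRing"
begin

section \<open>Topological groupoids and cocycles\<close>

text \<open>The arrows are the points of \<open>gtop\<close>; units are identified with their identity arrows,
  so \<open>rng\<close> and \<open>src\<close> take values in the arrows and the unit space is the image of \<open>rng\<close>.
  The composition \<open>gcomp\<close> is a total function that is only meaningful on composable pairs.\<close>

record 'g groupoid =
  gtop :: "'g topology"
  rng :: "'g \<Rightarrow> 'g"
  src :: "'g \<Rightarrow> 'g"
  gcomp :: "'g \<Rightarrow> 'g \<Rightarrow> 'g"
  ginv :: "'g \<Rightarrow> 'g"

abbreviation arrows :: "'g groupoid \<Rightarrow> 'g set" where
  "arrows G \<equiv> topspace (gtop G)"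

definition composable :: "'g groupoid \<Rightarrow> ('g \<times> 'g) set" where
  "composable G = {(x, y). x \<in> arrows G \<and> y \<in> arrows G \<and> src G x = rng G y}"

locale groupoid =
  fixes G :: "'g groupoid"
  assumes rng_closed: "x \<in> arrows G \<Longrightarrow> rng G x \<in> arrows G"
    and src_closed: "x \<in> arrows G \<Longrightarrow> src G x \<in> arrows G"
    and rng_rng: "x \<in> arrows G \<Longrightarrow> rng G (rng G x) = rng G x"
    and src_rng: "x \<in> arrows G \<Longrightarrow> src G (rng G x) = rng G x"
    and rng_src: "x \<in> arrows G \<Longrightarrow> rng G (src G x) = src G x"
    and src_src: "x \<in> arrows G \<Longrightarrow> src G (src G x) = src G x"
    and gcomp_closed: "(x, y) \<in> composable G \<Longrightarrow> gcomp G x y \<in> arrows G"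
    and rng_gcomp: "(x, y) \<in> composable G \<Longrightarrow> rng G (gcomp G x y) = rng G x"
    and src_gcomp: "(x, y) \<in> composable G \<Longrightarrow> src G (gcomp G x y) = src G y"
    and gcomp_assoc: "(x, y) \<in> composable G \<Longrightarrow> (y, z) \<in> composable G \<Longrightarrow>
          gcomp G (gcomp G x y) z = gcomp G x (gcomp G y z)"
    and rng_gcomp_left: "x \<in> arrows G \<Longrightarrow> gcomp G (rng G x) x = x"
    and src_gcomp_right: "x \<in> arrows G \<Longrightarrow> gcomp G x (src G x) = x"
    and ginv_closed: "x \<in> arrows G \<Longrightarrow> ginv G x \<in> arrows G"
    and rng_ginv: "x \<in> arrows G \<Longrightarrow> rng G (ginv G x) = src G x"
    and src_ginv: "x \<in> arrows G \<Longrightarrow> src G (ginv G x) = rng G x"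
    and gcomp_ginv_right: "x \<in> arrows G \<Longrightarrow> gcomp G x (ginv G x) = rng G x"
    and gcomp_ginv_left: "x \<in> arrows G \<Longrightarrow> gcomp G (ginv G x) x = src G x"

locale topological_groupoid = groupoid G for G :: "'g groupoid" +
  assumes continuous_gcomp:
      "continuous_map (subtopology (prod_topology (gtop G) (gtop G)) (composable G)) (gtop G)
         (\<lambda>(x, y). gcomp G x y)"
    and continuous_ginv: "continuous_map (gtop G) (gtop G) (ginv G)"

definition unit_space :: "'g groupoid \<Rightarrow> 'g topology" where
  "unit_space G = subtopology (gtop G) (rng G ` arrows G)"

definition open_bisection :: "'g groupoid \<Rightarrow> 'g set \<Rightarrow> bool" where
  "open_bisection G B \<longleftrightarrow> openin (gtop G) B \<and>
     (\<forall>f \<in> {rng G, src G}. openin (unit_space G) (f ` B) \<and>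
        homeomorphic_map (subtopology (gtop G) B) (subtopology (unit_space G) (f ` B)) f)"

definition compact_open_bisection :: "'g groupoid \<Rightarrow> 'g set \<Rightarrow> bool" where
  "compact_open_bisection G B \<longleftrightarrow> open_bisection G B \<and> compactin (gtop G) B"

locale ample_hausdorff_groupoid = topological_groupoid G for G :: "'g groupoid" +
  assumes hausdorff: "Hausdorff_space (gtop G)"
    and compact_open_bisection_base: "openin (gtop G) U \<Longrightarrow> x \<in> U \<Longrightarrow>
          \<exists>B. compact_open_bisection G B \<and> x \<in> B \<and> B \<subseteq> U"

definition continuous_cocycle :: "'g groupoid \<Rightarrow> ('g \<Rightarrow> int) \<Rightarrow> bool" where
  "continuous_cocycle G c \<longleftrightarrow> continuous_map (gtop G) (discrete_topology UNIV) c \<and>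
     (\<forall>(x, y) \<in> composable G. c (gcomp G x y) = c x + c y)"

definition level :: "'g groupoid \<Rightarrow> ('g \<Rightarrow> int) \<Rightarrow> int \<Rightarrow> 'g set" where
  "level G c n = {x \<in> arrows G. c x = n}"

definition set_comp :: "'g groupoid \<Rightarrow> 'g set \<Rightarrow> 'g set \<Rightarrow> 'g set" where
  "set_comp G X Y = {gcomp G x y | x y. x \<in> X \<and> y \<in> Y \<and> src G x = rng G y}"

text \<open>\<open>is_product G gs g\<close>: the nonempty list \<open>gs\<close> is composable and its product is \<open>g\<close>.\<close>

fun gprod :: "'g groupoid \<Rightarrow> 'g list \<Rightarrow> 'g" where
  "gprod G [] = undefined"
| "gprod G [x] = x"
| "gprod G (x # y # ys) = gcomp G x (gprod G (y # ys))"

definition is_product :: "'g groupoid \<Rightarrow> 'g list \<Rightarrow> 'g \<Rightarrow> bool" where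
  "is_product G gs g \<longleftrightarrow> gs \<noteq> [] \<and> successively (\<lambda>x y. src G x = rng G y) gs \<and> g = gprod G gs"

definition unperforated :: "'g groupoid \<Rightarrow> ('g \<Rightarrow> int) \<Rightarrow> bool" where
  "unperforated G c \<longleftrightarrow> (\<forall>n::nat. \<forall>g \<in> level G c (int n). n > 0 \<longrightarrow>
     (\<exists>gs. length gs = n \<and> set gs \<subseteq> level G c 1 \<and> is_product G gs g))"


section \<open>Rings without unit, bimodules and balanced tensor products\<close>

text \<open>Non-unital rings are stored in the records of HOL-Algebra; the field \<open>one\<close> carries no
  meaning. The same applies to \<open>mult\<close> and \<open>one\<close> in bimodules.\<close>

locale nu_ring = abelian_group R for R :: "('a, 'm) ring_scheme" (structure) +
  assumes nu_m_closed: "x \<in> carrier R \<Longrightarrow> y \<in> carrier R \<Longrightarrow> x \<otimes> y \<in> carrier R"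
    and nu_m_assoc: "x \<in> carrier R \<Longrightarrow> y \<in> carrier R \<Longrightarrow> z \<in> carrier R \<Longrightarrow>
          (x \<otimes> y) \<otimes> z = x \<otimes> (y \<otimes> z)"
    and nu_l_distr: "x \<in> carrier R \<Longrightarrow> y \<in> carrier R \<Longrightarrow> z \<in> carrier R \<Longrightarrow>
          (x \<oplus> y) \<otimes> z = x \<otimes> z \<oplus> y \<otimes> z"
    and nu_r_distr: "x \<in> carrier R \<Longrightarrow> y \<in> carrier R \<Longrightarrow> z \<in> carrier R \<Longrightarrow>
          z \<otimes> (x \<oplus> y) = z \<otimes> x \<oplus> z \<otimes> y"

definition add_hom :: "('a, 'm) ring_scheme \<Rightarrow> ('b, 'n) ring_scheme \<Rightarrow> ('a \<Rightarrow> 'b) set" where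
  "add_hom A B = {h \<in> carrier A \<rightarrow> carrier B.
     \<forall>x \<in> carrier A. \<forall>y \<in> carrier A. h (x \<oplus>\<^bsub>A\<^esub> y) = h x \<oplus>\<^bsub>B\<^esub> h y}"

definition nu_ring_hom :: "('a, 'm) ring_scheme \<Rightarrow> ('b, 'n) ring_scheme \<Rightarrow> ('a \<Rightarrow> 'b) set" where
  "nu_ring_hom A B = {h \<in> add_hom A B.
     \<forall>x \<in> carrier A. \<forall>y \<in> carrier A. h (x \<otimes>\<^bsub>A\<^esub> y) = h x \<otimes>\<^bsub>B\<^esub> h y}"

definition nu_ideal :: "'a set \<Rightarrow> ('a, 'm) ring_scheme \<Rightarrow> bool" where
  "nu_ideal I R \<longleftrightarrow> additive_subgroup I R \<and>
     (\<forall>a \<in> I. \<forall>x \<in> carrier R. x \<otimes>\<^bsub>R\<^esub> a \<in> I \<and> a \<otimes>\<^bsub>R\<^esub> x \<in> I)"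

definition nu_genideal :: "('a, 'm) ring_scheme \<Rightarrow> 'a set \<Rightarrow> 'a set" where
  "nu_genideal R X = \<Inter>{I. nu_ideal I R \<and> X \<subseteq> I}"

record ('a, 'b) bimodule = "'b ring" +
  lact :: "'a \<Rightarrow> 'b \<Rightarrow> 'b" (infixr \<open>\<triangleright>\<index>\<close> 70)
  ract :: "'b \<Rightarrow> 'a \<Rightarrow> 'b" (infixl \<open>\<triangleleft>\<index>\<close> 70)

locale bimodule = nu_ring R + M: abelian_group M
  for R :: "('a, 'm) ring_scheme" (structure) and M :: "('a, 'b, 'n) bimodule_scheme" +
  assumes lact_closed: "r \<in> carrier R \<Longrightarrow> x \<in> carrier M \<Longrightarrow> r \<triangleright>\<^bsub>M\<^esub> x \<in> carrier M"
    and ract_closed: "r \<in> carrier R \<Longrightarrow> x \<in> carrier M \<Longrightarrow> x \<triangleleft>\<^bsub>M\<^esub> r \<in> carrier M"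
    and lact_add_left: "r \<in> carrier R \<Longrightarrow> r' \<in> carrier R \<Longrightarrow> x \<in> carrier M \<Longrightarrow>
          (r \<oplus> r') \<triangleright>\<^bsub>M\<^esub> x = (r \<triangleright>\<^bsub>M\<^esub> x) \<oplus>\<^bsub>M\<^esub> (r' \<triangleright>\<^bsub>M\<^esub> x)"
    and lact_add_right: "r \<in> carrier R \<Longrightarrow> x \<in> carrier M \<Longrightarrow> y \<in> carrier M \<Longrightarrow>
          r \<triangleright>\<^bsub>M\<^esub> (x \<oplus>\<^bsub>M\<^esub> y) = (r \<triangleright>\<^bsub>M\<^esub> x) \<oplus>\<^bsub>M\<^esub> (r \<triangleright>\<^bsub>M\<^esub> y)"
    and ract_add_right: "r \<in> carrier R \<Longrightarrow> r' \<in> carrier R \<Longrightarrow> x \<in> carrier M \<Longrightarrow>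
          x \<triangleleft>\<^bsub>M\<^esub> (r \<oplus> r') = (x \<triangleleft>\<^bsub>M\<^esub> r) \<oplus>\<^bsub>M\<^esub> (x \<triangleleft>\<^bsub>M\<^esub> r')"
    and ract_add_left: "r \<in> carrier R \<Longrightarrow> x \<in> carrier M \<Longrightarrow> y \<in> carrier M \<Longrightarrow>
          (x \<oplus>\<^bsub>M\<^esub> y) \<triangleleft>\<^bsub>M\<^esub> r = (x \<triangleleft>\<^bsub>M\<^esub> r) \<oplus>\<^bsub>M\<^esub> (y \<triangleleft>\<^bsub>M\<^esub> r)"
    and lact_mult: "r \<in> carrier R \<Longrightarrow> r' \<in> carrier R \<Longrightarrow> x \<in> carrier M \<Longrightarrow>
          (r \<otimes> r') \<triangleright>\<^bsub>M\<^esub> x = r \<triangleright>\<^bsub>M\<^esub> (r' \<triangleright>\<^bsub>M\<^esub> x)"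
    and ract_mult: "r \<in> carrier R \<Longrightarrow> r' \<in> carrier R \<Longrightarrow> x \<in> carrier M \<Longrightarrow>
          x \<triangleleft>\<^bsub>M\<^esub> (r \<otimes> r') = (x \<triangleleft>\<^bsub>M\<^esub> r) \<triangleleft>\<^bsub>M\<^esub> r'"
    and lact_ract: "r \<in> carrier R \<Longrightarrow> r' \<in> carrier R \<Longrightarrow> x \<in> carrier M \<Longrightarrow>
          (r \<triangleright>\<^bsub>M\<^esub> x) \<triangleleft>\<^bsub>M\<^esub> r' = r \<triangleright>\<^bsub>M\<^esub> (x \<triangleleft>\<^bsub>M\<^esub> r')"

definition self_bimodule :: "'a ring \<Rightarrow> ('a, 'a) bimodule" where
  "self_bimodule R = ring.extend R
     \<lparr>lact = (\<lambda>r x. r \<otimes>\<^bsub>R\<^esub> x), ract = (\<lambda>x r. x \<otimes>\<^bsub>R\<^esub> r)\<rparr>"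

definition bimodule_hom ::
  "'a ring \<Rightarrow> ('a, 'b) bimodule \<Rightarrow> ('a, 'c) bimodule \<Rightarrow> ('b \<Rightarrow> 'c) set" where
  "bimodule_hom R M N = {h \<in> add_hom M N. \<forall>r \<in> carrier R. \<forall>x \<in> carrier M.
     h (r \<triangleright>\<^bsub>M\<^esub> x) = r \<triangleright>\<^bsub>N\<^esub> h x \<and> h (x \<triangleleft>\<^bsub>M\<^esub> r) = h x \<triangleleft>\<^bsub>N\<^esub> r}"

text \<open>The balanced tensor product is the free abelian group on \<open>P \<times> Q\<close> modulo the subgroup
  generated by the usual relators; its elements are cosets of that subgroup. The actions are
  those induced by \<open>(p, q) \<mapsto> (r p, q)\<close> and \<open>(p, q) \<mapsto> (p, q r)\<close>.\<close>

type_synonym ('p, 'q) tens = "(('p \<times> 'q) \<Rightarrow>\<^sub>0 int) set"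

definition tensor_free ::
  "('r, 'p) bimodule \<Rightarrow> ('r, 'q) bimodule \<Rightarrow> (('p \<times> 'q) \<Rightarrow>\<^sub>0 int) monoid" where
  "tensor_free P Q = free_Abelian_group (carrier P \<times> carrier Q)"

definition tensor_relators ::
  "'r ring \<Rightarrow> ('r, 'p) bimodule \<Rightarrow> ('r, 'q) bimodule \<Rightarrow> ('p, 'q) tens" where
  "tensor_relators R P Q =
     {frag_of (p \<oplus>\<^bsub>P\<^esub> p', q) - frag_of (p, q) - frag_of (p', q) | p p' q.
        p \<in> carrier P \<and> p' \<in> carrier P \<and> q \<in> carrier Q} \<union>
     {frag_of (p, q \<oplus>\<^bsub>Q\<^esub> q') - frag_of (p, q) - frag_of (p, q') | p q q'.
        p \<in> carrier P \<and> q \<in> carrier Q \<and> q' \<in> carrier Q} \<union>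
     {frag_of (p \<triangleleft>\<^bsub>P\<^esub> r, q) - frag_of (p, r \<triangleright>\<^bsub>Q\<^esub> q) | p q r.
        p \<in> carrier P \<and> q \<in> carrier Q \<and> r \<in> carrier R}"

definition tensor_subgroup ::
  "'r ring \<Rightarrow> ('r, 'p) bimodule \<Rightarrow> ('r, 'q) bimodule \<Rightarrow> ('p, 'q) tens" where
  "tensor_subgroup R P Q = generate (tensor_free P Q) (tensor_relators R P Q)"

definition tensor_coset ::
  "'r ring \<Rightarrow> ('r, 'p) bimodule \<Rightarrow> ('r, 'q) bimodule \<Rightarrow> (('p \<times> 'q) \<Rightarrow>\<^sub>0 int) \<Rightarrow> ('p, 'q) tens" where
  "tensor_coset R P Q c = tensor_subgroup R P Q #>\<^bsub>tensor_free P Q\<^esub> c"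

definition tensor ::
  "'r ring \<Rightarrow> ('r, 'p) bimodule \<Rightarrow> ('r, 'q) bimodule \<Rightarrow> ('r, ('p, 'q) tens) bimodule" where
  "tensor R P Q =
     (let T = tensor_free P Q Mod tensor_subgroup R P Q in
      \<lparr>carrier = carrier T, mult = undefined, one = undefined,
       zero = \<one>\<^bsub>T\<^esub>, add = (\<lambda>X Y. X \<otimes>\<^bsub>T\<^esub> Y),
       lact = (\<lambda>r X. \<Union>c\<in>X. tensor_coset R P Q
                 (frag_extend (\<lambda>(p, q). frag_of (r \<triangleright>\<^bsub>P\<^esub> p, q)) c)),
       ract = (\<lambda>X r. \<Union>c\<in>X. tensor_coset R P Q
                 (frag_extend (\<lambda>(p, q). frag_of (p, q \<triangleleft>\<^bsub>Q\<^esub> r)) c))\<rparr>)"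

definition pure_tensor ::
  "'r ring \<Rightarrow> ('r, 'p) bimodule \<Rightarrow> ('r, 'q) bimodule \<Rightarrow> 'p \<Rightarrow> 'q \<Rightarrow> ('p, 'q) tens" where
  "pure_tensor R P Q p q = tensor_coset R P Q (frag_of (p, q))"


section \<open>Systems, covariant representations and the Toeplitz ring\<close>

locale r_system = P: bimodule R P + Q: bimodule R Q
  for R :: "'r ring" and P :: "('r, 'p) bimodule" and Q :: "('r, 'q) bimodule"
    and \<psi> :: "('p, 'q) tens \<Rightarrow> 'r" +
  assumes psi_hom: "\<psi> \<in> bimodule_hom R (tensor R P Q) (self_bimodule R)"

definition covariant_rep ::
  "'r ring \<Rightarrow> ('r, 'p) bimodule \<Rightarrow> ('r, 'q) bimodule \<Rightarrow> (('p, 'q) tens \<Rightarrow> 'r) \<Rightarrow>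
   ('p \<Rightarrow> 'b) \<Rightarrow> ('q \<Rightarrow> 'b) \<Rightarrow> ('r \<Rightarrow> 'b) \<Rightarrow> 'b ring \<Rightarrow> bool" where
  "covariant_rep R P Q \<psi> S T \<sigma> B \<longleftrightarrow>
     nu_ring B \<and> S \<in> add_hom P B \<and> T \<in> add_hom Q B \<and> \<sigma> \<in> nu_ring_hom R B \<and>
     (\<forall>r \<in> carrier R. \<forall>p \<in> carrier P.
        S (p \<triangleleft>\<^bsub>P\<^esub> r) = S p \<otimes>\<^bsub>B\<^esub> \<sigma> r \<and> S (r \<triangleright>\<^bsub>P\<^esub> p) = \<sigma> r \<otimes>\<^bsub>B\<^esub> S p) \<and>
     (\<forall>r \<in> carrier R. \<forall>q \<in> carrier Q.
        T (q \<triangleleft>\<^bsub>Q\<^esub> r) = T q \<otimes>\<^bsub>B\<^esub> \<sigma> r \<and> T (r \<triangleright>\<^bsub>Q\<^esub> q) = \<sigma> r \<otimes>\<^bsub>B\<^esub> T q) \<and>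
     (\<forall>p \<in> carrier P. \<forall>q \<in> carrier Q.
        \<sigma> (\<psi> (pure_tensor R P Q p q)) = S p \<otimes>\<^bsub>B\<^esub> T q)"

text \<open>The universal property of the Toeplitz ring quantifies over rings of all types, so the
  ring is constructed: it is presented by generators \<open>R\<close>, \<open>Q\<close>, \<open>P\<close> and the relations of a
  covariant representation, as formal ring expressions modulo the congruence generated by the
  axioms of (non-unital) rings and these relations. The universal property is proved below.\<close>

datatype ('r, 'p, 'q) toep_term =
    GenR 'r | GenP 'p | GenQ 'q | TZero
  | TNeg "('r, 'p, 'q) toep_term"
  | TAdd "('r, 'p, 'q) toep_term" "('r, 'p, 'q) toep_term"
  | TMul "('r, 'p, 'q) toep_term" "('r, 'p, 'q) toep_term"

inductive_set toep_terms ::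
  "'r ring \<Rightarrow> ('r, 'p) bimodule \<Rightarrow> ('r, 'q) bimodule \<Rightarrow> ('r, 'p, 'q) toep_term set"
  for R P Q where
  "r \<in> carrier R \<Longrightarrow> GenR r \<in> toep_terms R P Q"
| "p \<in> carrier P \<Longrightarrow> GenP p \<in> toep_terms R P Q"
| "q \<in> carrier Q \<Longrightarrow> GenQ q \<in> toep_terms R P Q"
| "TZero \<in> toep_terms R P Q"
| "t \<in> toep_terms R P Q \<Longrightarrow> TNeg t \<in> toep_terms R P Q"
| "t \<in> toep_terms R P Q \<Longrightarrow> u \<in> toep_terms R P Q \<Longrightarrow> TAdd t u \<in> toep_terms R P Q"
| "t \<in> toep_terms R P Q \<Longrightarrow> u \<in> toep_terms R P Q \<Longrightarrow> TMul t u \<in> toep_terms R P Q"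

inductive toep_eq ::
  "'r ring \<Rightarrow> ('r, 'p) bimodule \<Rightarrow> ('r, 'q) bimodule \<Rightarrow> (('p, 'q) tens \<Rightarrow> 'r) \<Rightarrow>
   ('r, 'p, 'q) toep_term \<Rightarrow> ('r, 'p, 'q) toep_term \<Rightarrow> bool"
  for R P Q \<psi> where
  te_refl: "toep_eq R P Q \<psi> t t"
| te_sym: "toep_eq R P Q \<psi> t u \<Longrightarrow> toep_eq R P Q \<psi> u t"
| te_trans: "toep_eq R P Q \<psi> t u \<Longrightarrow> toep_eq R P Q \<psi> u v \<Longrightarrow> toep_eq R P Q \<psi> t v"
| te_neg: "toep_eq R P Q \<psi> t t' \<Longrightarrow> toep_eq R P Q \<psi> (TNeg t) (TNeg t')"
| te_add: "toep_eq R P Q \<psi> t t' \<Longrightarrow> toep_eq R P Q \<psi> u u' \<Longrightarrow>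
    toep_eq R P Q \<psi> (TAdd t u) (TAdd t' u')"
| te_mul: "toep_eq R P Q \<psi> t t' \<Longrightarrow> toep_eq R P Q \<psi> u u' \<Longrightarrow>
    toep_eq R P Q \<psi> (TMul t u) (TMul t' u')"
| te_add_assoc: "toep_eq R P Q \<psi> (TAdd (TAdd t u) v) (TAdd t (TAdd u v))"
| te_add_comm: "toep_eq R P Q \<psi> (TAdd t u) (TAdd u t)"
| te_add_zero: "toep_eq R P Q \<psi> (TAdd TZero t) t"
| te_add_neg: "toep_eq R P Q \<psi> (TAdd (TNeg t) t) TZero"
| te_mul_assoc: "toep_eq R P Q \<psi> (TMul (TMul t u) v) (TMul t (TMul u v))"
| te_l_distr: "toep_eq R P Q \<psi> (TMul (TAdd t u) v) (TAdd (TMul t v) (TMul u v))"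
| te_r_distr: "toep_eq R P Q \<psi> (TMul v (TAdd t u)) (TAdd (TMul v t) (TMul v u))"
| te_R_add: "r \<in> carrier R \<Longrightarrow> r' \<in> carrier R \<Longrightarrow>
    toep_eq R P Q \<psi> (GenR (r \<oplus>\<^bsub>R\<^esub> r')) (TAdd (GenR r) (GenR r'))"
| te_R_mult: "r \<in> carrier R \<Longrightarrow> r' \<in> carrier R \<Longrightarrow>
    toep_eq R P Q \<psi> (GenR (r \<otimes>\<^bsub>R\<^esub> r')) (TMul (GenR r) (GenR r'))"
| te_P_add: "p \<in> carrier P \<Longrightarrow> p' \<in> carrier P \<Longrightarrow>
    toep_eq R P Q \<psi> (GenP (p \<oplus>\<^bsub>P\<^esub> p')) (TAdd (GenP p) (GenP p'))"
| te_Q_add: "q \<in> carrier Q \<Longrightarrow> q' \<in> carrier Q \<Longrightarrow>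
    toep_eq R P Q \<psi> (GenQ (q \<oplus>\<^bsub>Q\<^esub> q')) (TAdd (GenQ q) (GenQ q'))"
| te_P_ract: "p \<in> carrier P \<Longrightarrow> r \<in> carrier R \<Longrightarrow>
    toep_eq R P Q \<psi> (GenP (p \<triangleleft>\<^bsub>P\<^esub> r)) (TMul (GenP p) (GenR r))"
| te_P_lact: "p \<in> carrier P \<Longrightarrow> r \<in> carrier R \<Longrightarrow>
    toep_eq R P Q \<psi> (GenP (r \<triangleright>\<^bsub>P\<^esub> p)) (TMul (GenR r) (GenP p))"
| te_Q_ract: "q \<in> carrier Q \<Longrightarrow> r \<in> carrier R \<Longrightarrow>
    toep_eq R P Q \<psi> (GenQ (q \<triangleleft>\<^bsub>Q\<^esub> r)) (TMul (GenQ q) (GenR r))"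
| te_Q_lact: "q \<in> carrier Q \<Longrightarrow> r \<in> carrier R \<Longrightarrow>
    toep_eq R P Q \<psi> (GenQ (r \<triangleright>\<^bsub>Q\<^esub> q)) (TMul (GenR r) (GenQ q))"
| te_psi: "p \<in> carrier P \<Longrightarrow> q \<in> carrier Q \<Longrightarrow>
    toep_eq R P Q \<psi> (GenR (\<psi> (pure_tensor R P Q p q))) (TMul (GenP p) (GenQ q))"

type_synonym ('r, 'p, 'q) toep = "('r, 'p, 'q) toep_term set"

definition toep_class ::
  "'r ring \<Rightarrow> ('r, 'p) bimodule \<Rightarrow> ('r, 'q) bimodule \<Rightarrow> (('p, 'q) tens \<Rightarrow> 'r) \<Rightarrow>
   ('r, 'p, 'q) toep_term \<Rightarrow> ('r, 'p, 'q) toep" where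
  "toep_class R P Q \<psi> t = {u \<in> toep_terms R P Q. toep_eq R P Q \<psi> t u}"

definition toeplitz_ring ::
  "'r ring \<Rightarrow> ('r, 'p) bimodule \<Rightarrow> ('r, 'q) bimodule \<Rightarrow> (('p, 'q) tens \<Rightarrow> 'r) \<Rightarrow>
   ('r, 'p, 'q) toep ring" where
  "toeplitz_ring R P Q \<psi> =
     \<lparr>carrier = toep_class R P Q \<psi> ` toep_terms R P Q,
      mult = (\<lambda>X Y. \<Union>t\<in>X. \<Union>u\<in>Y. toep_class R P Q \<psi> (TMul t u)),
      one = undefined,
      zero = toep_class R P Q \<psi> TZero,
      add = (\<lambda>X Y. \<Union>t\<in>X. \<Union>u\<in>Y. toep_class R P Q \<psi> (TAdd t u))\<rparr>"

definition toep_R where "toep_R R P Q \<psi> r = toep_class R P Q \<psi> (GenR r)"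
definition toep_P where "toep_P R P Q \<psi> p = toep_class R P Q \<psi> (GenP p)"
definition toep_Q where "toep_Q R P Q \<psi> q = toep_class R P Q \<psi> (GenQ q)"

lemma toep_class_cong: "toep_eq R P Q \<psi> t u \<Longrightarrow> toep_class R P Q \<psi> t = toep_class R P Q \<psi> u"
  unfolding toep_class_def by (blast intro: te_sym te_trans)

lemma toep_class_self: "t \<in> toep_terms R P Q \<Longrightarrow> t \<in> toep_class R P Q \<psi> t"
  unfolding toep_class_def by (simp add: te_refl)

lemma toep_classD:
  "u \<in> toep_class R P Q \<psi> t \<Longrightarrow> u \<in> toep_terms R P Q \<and> toep_eq R P Q \<psi> t u"
  unfolding toep_class_def by simp

lemma toeplitz_add_class:
  assumes "t \<in> toep_terms R P Q" "u \<in> toep_terms R P Q"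
  shows "toep_class R P Q \<psi> t \<oplus>\<^bsub>toeplitz_ring R P Q \<psi>\<^esub> toep_class R P Q \<psi> u
           = toep_class R P Q \<psi> (TAdd t u)"
proof -
  have "toep_class R P Q \<psi> (TAdd t' u') = toep_class R P Q \<psi> (TAdd t u)"
    if "t' \<in> toep_class R P Q \<psi> t" "u' \<in> toep_class R P Q \<psi> u" for t' u'
    by (rule toep_class_cong[OF te_sym[OF te_add]]) (use that in \<open>auto dest: toep_classD\<close>)
  then have "(\<Union>t'\<in>toep_class R P Q \<psi> t. \<Union>u'\<in>toep_class R P Q \<psi> u. toep_class R P Q \<psi> (TAdd t' u'))
      = (\<Union>t'\<in>toep_class R P Q \<psi> t. \<Union>u'\<in>toep_class R P Q \<psi> u. toep_class R P Q \<psi> (TAdd t u))"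
    by (intro SUP_cong refl)
  with assms[THEN toep_class_self, of \<psi>] show ?thesis
    unfolding toeplitz_ring_def by auto
qed

lemma toeplitz_mult_class:
  assumes "t \<in> toep_terms R P Q" "u \<in> toep_terms R P Q"
  shows "toep_class R P Q \<psi> t \<otimes>\<^bsub>toeplitz_ring R P Q \<psi>\<^esub> toep_class R P Q \<psi> u
           = toep_class R P Q \<psi> (TMul t u)"
proof -
  have "toep_class R P Q \<psi> (TMul t' u') = toep_class R P Q \<psi> (TMul t u)"
    if "t' \<in> toep_class R P Q \<psi> t" "u' \<in> toep_class R P Q \<psi> u" for t' u'
    by (rule toep_class_cong[OF te_sym[OF te_mul]]) (use that in \<open>auto dest: toep_classD\<close>)
  then have "(\<Union>t'\<in>toep_class R P Q \<psi> t. \<Union>u'\<in>toep_class R P Q \<psi> u. toep_class R P Q \<psi> (TMul t' u'))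
      = (\<Union>t'\<in>toep_class R P Q \<psi> t. \<Union>u'\<in>toep_class R P Q \<psi> u. toep_class R P Q \<psi> (TMul t u))"
    by (intro SUP_cong refl)
  with assms[THEN toep_class_self, of \<psi>] show ?thesis
    unfolding toeplitz_ring_def by auto
qed

lemma toeplitz_carrier: "carrier (toeplitz_ring R P Q \<psi>) = toep_class R P Q \<psi> ` toep_terms R P Q"
  by (simp add: toeplitz_ring_def)

lemma toeplitz_zero: "\<zero>\<^bsub>toeplitz_ring R P Q \<psi>\<^esub> = toep_class R P Q \<psi> TZero"
  by (simp add: toeplitz_ring_def)

lemma toeplitz_neg_class:
  assumes "t \<in> toep_terms R P Q"
  shows "toep_class R P Q \<psi> (TNeg t) \<oplus>\<^bsub>toeplitz_ring R P Q \<psi>\<^esub> toep_class R P Q \<psi> t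
           = \<zero>\<^bsub>toeplitz_ring R P Q \<psi>\<^esub>"
  using assms
  by (simp add: toeplitz_add_class toeplitz_zero toep_terms.intros toep_class_cong[OF te_add_neg])

lemma toeplitz_nu_ring: "nu_ring (toeplitz_ring R P Q \<psi>)"
proof -
  have "abelian_group (toeplitz_ring R P Q \<psi>)"
  proof (rule abelian_groupI)
    fix x assume "x \<in> carrier (toeplitz_ring R P Q \<psi>)"
    then obtain t where t: "t \<in> toep_terms R P Q" "x = toep_class R P Q \<psi> t"
      by (auto simp: toeplitz_carrier)
    show "\<exists>y\<in>carrier (toeplitz_ring R P Q \<psi>).
        y \<oplus>\<^bsub>toeplitz_ring R P Q \<psi>\<^esub> x = \<zero>\<^bsub>toeplitz_ring R P Q \<psi>\<^esub>"
      by (rule bexI[of _ "toep_class R P Q \<psi> (TNeg t)"])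
        (use t in \<open>auto simp: toeplitz_carrier toeplitz_neg_class intro: toep_terms.intros\<close>)
  qed (auto simp: toeplitz_carrier toeplitz_zero toeplitz_add_class toep_terms.intros
      toep_class_cong[OF te_add_assoc] toep_class_cong[OF te_add_zero]
      intro: imageI toep_terms.intros toep_class_cong[OF te_add_comm, THEN equalityD1, THEN subsetD])
  then show ?thesis
    by (rule nu_ring.intro, unfold_locales)
      (auto simp: toeplitz_carrier toeplitz_add_class toeplitz_mult_class toep_terms.intros
        toep_class_cong[OF te_mul_assoc] toep_class_cong[OF te_l_distr]
        toep_class_cong[OF te_r_distr] intro: imageI toep_terms.intros)
qed

lemma toeplitz_generated:
  assumes gens: "toep_R R P Q \<psi> ` carrier R \<subseteq> X" "toep_P R P Q \<psi> ` carrier P \<subseteq> X"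
      "toep_Q R P Q \<psi> ` carrier Q \<subseteq> X"
    and sub: "additive_subgroup X (toeplitz_ring R P Q \<psi>)"
    and mult: "\<And>x y. x \<in> X \<Longrightarrow> y \<in> X \<Longrightarrow> x \<otimes>\<^bsub>toeplitz_ring R P Q \<psi>\<^esub> y \<in> X"
  shows "carrier (toeplitz_ring R P Q \<psi>) \<subseteq> X"
proof -
  let ?T = "toeplitz_ring R P Q \<psi>"
  interpret T: nu_ring ?T by (rule toeplitz_nu_ring)
  interpret X: additive_subgroup X ?T by (rule sub)
  have "toep_class R P Q \<psi> t \<in> X" if "t \<in> toep_terms R P Q" for t
    using that
  proof induction
    case (5 t)
    have "toep_class R P Q \<psi> (TNeg t) = \<ominus>\<^bsub>?T\<^esub> toep_class R P Q \<psi> t"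
      by (rule T.minus_equality[symmetric])
        (use 5 in \<open>auto simp: toeplitz_carrier toeplitz_neg_class intro: toep_terms.intros\<close>)
    with 5 X.a_inv_closed show ?case by metis
  next
    case (6 t u)
    then show ?case using X.a_closed by (metis toeplitz_add_class)
  next
    case (7 t u)
    then show ?case using mult by (metis toeplitz_mult_class)
  next
    case 4
    show ?case using X.zero_closed by (simp add: toeplitz_zero)
  qed (use gens in \<open>auto simp: toep_R_def toep_P_def toep_Q_def\<close>)
  then show ?thesis by (auto simp: toeplitz_carrier)
qed

lemma pure_tensor_closed:
  assumes "p \<in> carrier P" "q \<in> carrier Q"
  shows "pure_tensor R P Q p q \<in> carrier (tensor R P Q)"
  using assms
  by (auto simp: pure_tensor_def tensor_def tensor_coset_def tensor_free_def Let_def carrier_FactGroup)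

lemma (in r_system) psi_pure_closed:
  assumes "p \<in> carrier P" "q \<in> carrier Q"
  shows "\<psi> (pure_tensor R P Q p q) \<in> carrier R"
  using psi_hom pure_tensor_closed[OF assms, of R]
  by (auto simp: bimodule_hom_def add_hom_def self_bimodule_def ring.defs)

lemma (in r_system) toeplitz_covariant:
  "covariant_rep R P Q \<psi> (toep_P R P Q \<psi>) (toep_Q R P Q \<psi>) (toep_R R P Q \<psi>) (toeplitz_ring R P Q \<psi>)"
  unfolding covariant_rep_def nu_ring_hom_def add_hom_def toep_R_def toep_P_def toep_Q_def
  by (auto simp: toeplitz_nu_ring toeplitz_carrier toeplitz_add_class toeplitz_mult_class
      toep_terms.intros psi_pure_closed intro!: toep_class_cong toep_eq.intros(14-22))

primrec toep_eval :: "('r \<Rightarrow> 'b) \<Rightarrow> ('p \<Rightarrow> 'b) \<Rightarrow> ('q \<Rightarrow> 'b) \<Rightarrow> 'b ring \<Rightarrow> ('r, 'p, 'q) toep_term \<Rightarrow> 'b"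
  where
  "toep_eval \<sigma> S T B (GenR r) = \<sigma> r"
| "toep_eval \<sigma> S T B (GenP p) = S p"
| "toep_eval \<sigma> S T B (GenQ q) = T q"
| "toep_eval \<sigma> S T B TZero = \<zero>\<^bsub>B\<^esub>"
| "toep_eval \<sigma> S T B (TNeg t) = \<ominus>\<^bsub>B\<^esub> toep_eval \<sigma> S T B t"
| "toep_eval \<sigma> S T B (TAdd t u) = toep_eval \<sigma> S T B t \<oplus>\<^bsub>B\<^esub> toep_eval \<sigma> S T B u"
| "toep_eval \<sigma> S T B (TMul t u) = toep_eval \<sigma> S T B t \<otimes>\<^bsub>B\<^esub> toep_eval \<sigma> S T B u"

theorem (in r_system) toeplitz_universal:
  fixes B :: "'b ring"
  assumes cov: "covariant_rep R P Q \<psi> S T \<sigma> B"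
  shows "\<exists>!h. h \<in> extensional (carrier (toeplitz_ring R P Q \<psi>)) \<and>
           h \<in> nu_ring_hom (toeplitz_ring R P Q \<psi>) B \<and>
           (\<forall>r \<in> carrier R. h (toep_R R P Q \<psi> r) = \<sigma> r) \<and>
           (\<forall>p \<in> carrier P. h (toep_P R P Q \<psi> p) = S p) \<and>
           (\<forall>q \<in> carrier Q. h (toep_Q R P Q \<psi> q) = T q)"
proof -
  let ?T = "toeplitz_ring R P Q \<psi>"
  let ?cl = "toep_class R P Q \<psi>"
  interpret B: nu_ring B using cov by (simp add: covariant_rep_def)
  interpret T: nu_ring ?T by (rule toeplitz_nu_ring)
  define \<sigma>' where "\<sigma>' = (\<lambda>r. if r \<in> carrier R then \<sigma> r else \<zero>\<^bsub>B\<^esub>)"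
  define S' where "S' = (\<lambda>p. if p \<in> carrier P then S p else \<zero>\<^bsub>B\<^esub>)"
  define T' where "T' = (\<lambda>q. if q \<in> carrier Q then T q else \<zero>\<^bsub>B\<^esub>)"
  note defs = \<sigma>'_def S'_def T'_def
  let ?e = "toep_eval \<sigma>' S' T' B"
  have closed: "?e t \<in> carrier B" for t
    by (induction t) (use cov in \<open>auto simp: defs covariant_rep_def nu_ring_hom_def add_hom_def
        intro: B.nu_m_closed\<close>)
  have eq: "?e t = ?e u" if "toep_eq R P Q \<psi> t u" for t u
    using that
  proof induction
    case (te_add_assoc t u v) then show ?case by (simp add: closed B.a_assoc)
  next
    case (te_add_comm t u) then show ?case by (simp add: closed B.a_comm)
  next
    case (te_add_neg t) then show ?case by (simp add: closed B.l_neg)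
  next
    case (te_mul_assoc t u v) then show ?case by (simp add: closed B.nu_m_assoc)
  next
    case (te_l_distr t u v) then show ?case by (simp add: closed B.nu_l_distr)
  next
    case (te_r_distr v t u) then show ?case by (simp add: closed B.nu_r_distr)
  next
    case (te_add_zero t) then show ?case by (simp add: closed)
  qed (use cov in \<open>simp_all add: defs covariant_rep_def nu_ring_hom_def add_hom_def psi_pure_closed
        P.lact_closed P.ract_closed Q.lact_closed Q.ract_closed P.nu_m_closed\<close>)
  define h where "h = (\<lambda>X\<in>carrier ?T. ?e (SOME t. t \<in> X))"
  have h: "h (?cl t) = ?e t" if "t \<in> toep_terms R P Q" for t
  proof -
    have "(SOME u. u \<in> ?cl t) \<in> ?cl t"
      using toep_class_self[OF that] by (rule someI)
    then have "?e t = ?e (SOME u. u \<in> ?cl t)" by (blast dest: toep_classD intro: eq)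
    with that show ?thesis by (simp add: h_def toeplitz_carrier)
  qed
  have P: "h \<in> extensional (carrier ?T) \<and> h \<in> nu_ring_hom ?T B \<and>
      (\<forall>r \<in> carrier R. h (toep_R R P Q \<psi> r) = \<sigma> r) \<and>
      (\<forall>p \<in> carrier P. h (toep_P R P Q \<psi> p) = S p) \<and>
      (\<forall>q \<in> carrier Q. h (toep_Q R P Q \<psi> q) = T q)"
    by (auto simp: nu_ring_hom_def add_hom_def toeplitz_carrier h closed toeplitz_add_class
        toeplitz_mult_class toep_terms.intros toep_R_def toep_P_def toep_Q_def)
      (simp_all add: h_def toeplitz_carrier defs)
  show ?thesis
  proof (rule ex1I[of _ h], rule P)
    fix g
    assume g: "g \<in> extensional (carrier ?T) \<and> g \<in> nu_ring_hom ?T B \<and>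
      (\<forall>r \<in> carrier R. g (toep_R R P Q \<psi> r) = \<sigma> r) \<and>
      (\<forall>p \<in> carrier P. g (toep_P R P Q \<psi> p) = S p) \<and>
      (\<forall>q \<in> carrier Q. g (toep_Q R P Q \<psi> q) = T q)"
    have hom: "f \<in> hom (add_monoid ?T) (add_monoid B)" if "f \<in> nu_ring_hom ?T B" for f
      using that by (auto simp: hom_def nu_ring_hom_def add_hom_def)
    let ?X = "{x \<in> carrier ?T. g x = h x}"
    have "carrier ?T \<subseteq> ?X"
    proof (rule toeplitz_generated)
      interpret g: group_hom "add_monoid ?T" "add_monoid B" g
        using g hom T.a_group B.a_group by (auto simp: group_hom_def group_hom_axioms_def)
      interpret h: group_hom "add_monoid ?T" "add_monoid B" h
        using P hom T.a_group B.a_group by (auto simp: group_hom_def group_hom_axioms_def)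
      have inv: "g (\<ominus>\<^bsub>?T\<^esub> a) = \<ominus>\<^bsub>B\<^esub> g a" "h (\<ominus>\<^bsub>?T\<^esub> a) = \<ominus>\<^bsub>B\<^esub> h a"
        if "a \<in> carrier ?T" for a
        using that g.hom_inv[of a] h.hom_inv[of a] by (simp_all add: a_inv_def)
      show "additive_subgroup ?X ?T"
        by (rule additive_subgroup.intro, rule T.add.subgroupI)
          (auto simp: a_inv_def[symmetric] g.hom_one[simplified] h.hom_one[simplified]
            g.hom_mult[simplified] h.hom_mult[simplified]
            inv
            intro!: exI[of _ "\<zero>\<^bsub>?T\<^esub>"])
      show "x \<otimes>\<^bsub>?T\<^esub> y \<in> ?X" if "x \<in> ?X" "y \<in> ?X" for x y
        using that g P by (auto simp: nu_ring_hom_def T.nu_m_closed)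
    qed (use g P toeplitz_covariant in \<open>auto simp: covariant_rep_def nu_ring_hom_def add_hom_def\<close>)
    then show "g = h"
      using g P by (auto intro: extensionalityI)
  qed
qed

text \<open>The component of degree \<open>n\<close> consists of the sums of products of generators of total degree
  \<open>n\<close>. As the generators generate the Toeplitz ring, this is the only grading in which they have
  the prescribed degrees.\<close>

inductive toep_homogeneous ::
  "'r ring \<Rightarrow> ('r, 'p) bimodule \<Rightarrow> ('r, 'q) bimodule \<Rightarrow> (('p, 'q) tens \<Rightarrow> 'r) \<Rightarrow>
   int \<Rightarrow> ('r, 'p, 'q) toep \<Rightarrow> bool"
  for R P Q \<psi> where
  "r \<in> carrier R \<Longrightarrow> toep_homogeneous R P Q \<psi> 0 (toep_R R P Q \<psi> r)"
| "q \<in> carrier Q \<Longrightarrow> toep_homogeneous R P Q \<psi> 1 (toep_Q R P Q \<psi> q)"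
| "p \<in> carrier P \<Longrightarrow> toep_homogeneous R P Q \<psi> (- 1) (toep_P R P Q \<psi> p)"
| "toep_homogeneous R P Q \<psi> n \<zero>\<^bsub>toeplitz_ring R P Q \<psi>\<^esub>"
| "toep_homogeneous R P Q \<psi> n x \<Longrightarrow>
     toep_homogeneous R P Q \<psi> n (\<ominus>\<^bsub>toeplitz_ring R P Q \<psi>\<^esub> x)"
| "toep_homogeneous R P Q \<psi> n x \<Longrightarrow> toep_homogeneous R P Q \<psi> n y \<Longrightarrow>
     toep_homogeneous R P Q \<psi> n (x \<oplus>\<^bsub>toeplitz_ring R P Q \<psi>\<^esub> y)"
| "toep_homogeneous R P Q \<psi> m x \<Longrightarrow> toep_homogeneous R P Q \<psi> n y \<Longrightarrow>
     toep_homogeneous R P Q \<psi> (m + n) (x \<otimes>\<^bsub>toeplitz_ring R P Q \<psi>\<^esub> y)"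

definition toeplitz_component where
  "toeplitz_component R P Q \<psi> n = {x. toep_homogeneous R P Q \<psi> n x}"


section \<open>Cuntz--Pimsner rings\<close>

text \<open>Endomorphisms are restricted to the carrier (extensional), so that equality of
  endomorphisms is equality of functions.\<close>

definition add_end :: "('b, 'm) ring_scheme \<Rightarrow> ('b \<Rightarrow> 'b) ring" where
  "add_end M =
     \<lparr>carrier = add_hom M M \<inter> extensional (carrier M),
      mult = compose (carrier M),
      one = (\<lambda>x\<in>carrier M. x),
      zero = (\<lambda>x\<in>carrier M. \<zero>\<^bsub>M\<^esub>),
      add = (\<lambda>f g. \<lambda>x\<in>carrier M. f x \<oplus>\<^bsub>M\<^esub> g x)\<rparr>"

definition theta_Q where
  "theta_Q R P Q \<psi> q p = (\<lambda>x\<in>carrier Q. q \<triangleleft>\<^bsub>Q\<^esub> \<psi> (pure_tensor R P Q p x))"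

definition theta_P where
  "theta_P R P Q \<psi> p q = (\<lambda>y\<in>carrier P. \<psi> (pure_tensor R P Q y q) \<triangleright>\<^bsub>P\<^esub> p)"

definition F_PQ :: "'r ring \<Rightarrow> ('r, 'p) bimodule \<Rightarrow> ('r, 'q) bimodule \<Rightarrow>
    (('p, 'q) tens \<Rightarrow> 'r) \<Rightarrow> ('q \<Rightarrow> 'q) set" where
  "F_PQ R P Q \<psi> = generate (add_monoid (add_end Q))
     {theta_Q R P Q \<psi> q p | q p. q \<in> carrier Q \<and> p \<in> carrier P}"

definition F_QP :: "'r ring \<Rightarrow> ('r, 'p) bimodule \<Rightarrow> ('r, 'q) bimodule \<Rightarrow>
    (('p, 'q) tens \<Rightarrow> 'r) \<Rightarrow> ('p \<Rightarrow> 'p) set" where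
  "F_QP R P Q \<psi> = generate (add_monoid (add_end P))
     {theta_P R P Q \<psi> p q | p q. p \<in> carrier P \<and> q \<in> carrier Q}"

definition condition_FS where
  "condition_FS R P Q \<psi> \<longleftrightarrow>
     (\<forall>A B. finite A \<and> A \<subseteq> carrier Q \<and> finite B \<and> B \<subseteq> carrier P \<longrightarrow>
        (\<exists>\<Theta> \<in> F_PQ R P Q \<psi>. \<exists>\<Phi> \<in> F_QP R P Q \<psi>. (\<forall>q \<in> A. \<Theta> q = q) \<and> (\<forall>p \<in> B. \<Phi> p = p)))"

definition cp_pi :: "'r ring \<Rightarrow> ('r, 'p) bimodule \<Rightarrow> ('r, 'q) bimodule \<Rightarrow>
    (('p, 'q) tens \<Rightarrow> 'r) \<Rightarrow> ('q \<Rightarrow> 'b) \<Rightarrow> ('p \<Rightarrow> 'b) \<Rightarrow> 'b ring \<Rightarrow> ('q \<Rightarrow> 'q) \<Rightarrow> 'b" where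
  "cp_pi R P Q \<psi> T S B = (THE \<pi>. \<pi> \<in> extensional (F_PQ R P Q \<psi>) \<and>
     \<pi> \<in> nu_ring_hom (add_end Q\<lparr>carrier := F_PQ R P Q \<psi>\<rparr>) B \<and>
     (\<forall>q \<in> carrier Q. \<forall>p \<in> carrier P. \<pi> (theta_Q R P Q \<psi> q p) = T q \<otimes>\<^bsub>B\<^esub> S p))"

definition Delta :: "('r, 'q) bimodule \<Rightarrow> 'r \<Rightarrow> 'q \<Rightarrow> 'q" where
  "Delta Q r = (\<lambda>q\<in>carrier Q. r \<triangleright>\<^bsub>Q\<^esub> q)"

definition psi_compatible where
  "psi_compatible R P Q \<psi> L \<longleftrightarrow> nu_ideal L R \<and> (\<forall>r \<in> L. Delta Q r \<in> F_PQ R P Q \<psi>)"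

definition ker_Delta :: "'r ring \<Rightarrow> ('r, 'q) bimodule \<Rightarrow> 'r set" where
  "ker_Delta R Q = {r \<in> carrier R. Delta Q r = \<zero>\<^bsub>add_end Q\<^esub>}"

definition faithful_psi_compatible where
  "faithful_psi_compatible R P Q \<psi> L \<longleftrightarrow>
     psi_compatible R P Q \<psi> L \<and> L \<inter> ker_Delta R Q = {\<zero>\<^bsub>R\<^esub>}"

definition uniquely_maximal where
  "uniquely_maximal R P Q \<psi> L \<longleftrightarrow> faithful_psi_compatible R P Q \<psi> L \<and>
     (\<forall>L'. faithful_psi_compatible R P Q \<psi> L' \<longrightarrow> L' \<subseteq> L)"

definition cuntz_pimsner_defined where
  "cuntz_pimsner_defined R P Q \<psi> \<longleftrightarrow>
     r_system R P Q \<psi> \<and> condition_FS R P Q \<psi> \<and> (\<exists>L. uniquely_maximal R P Q \<psi> L)"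

definition toeplitz_ideal where
  "toeplitz_ideal R P Q \<psi> L = nu_genideal (toeplitz_ring R P Q \<psi>)
     {toep_R R P Q \<psi> x \<ominus>\<^bsub>toeplitz_ring R P Q \<psi>\<^esub>
        cp_pi R P Q \<psi> (toep_Q R P Q \<psi>) (toep_P R P Q \<psi>) (toeplitz_ring R P Q \<psi>) (Delta Q x)
      | x. x \<in> L}"

definition cp_ideal where
  "cp_ideal R P Q \<psi> = toeplitz_ideal R P Q \<psi> (THE L. uniquely_maximal R P Q \<psi> L)"

text \<open>Meaningful only under \<open>cuntz_pimsner_defined\<close>.\<close>

definition cuntz_pimsner_ring ::
  "'r ring \<Rightarrow> ('r, 'p) bimodule \<Rightarrow> ('r, 'q) bimodule \<Rightarrow> (('p, 'q) tens \<Rightarrow> 'r) \<Rightarrow>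
   ('r, 'p, 'q) toep set ring" where
  "cuntz_pimsner_ring R P Q \<psi> = toeplitz_ring R P Q \<psi> Quot cp_ideal R P Q \<psi>"

definition cp_quotient_map where
  "cp_quotient_map R P Q \<psi> x = cp_ideal R P Q \<psi> +>\<^bsub>toeplitz_ring R P Q \<psi>\<^esub> x"

definition cp_component where
  "cp_component R P Q \<psi> n = cp_quotient_map R P Q \<psi> ` toeplitz_component R P Q \<psi> n"


section \<open>Graded algebras over a field\<close>

definition k_algebra :: "('k::field \<Rightarrow> 'a \<Rightarrow> 'a) \<Rightarrow> ('a, 'm) ring_scheme \<Rightarrow> bool" where
  "k_algebra s A \<longleftrightarrow> nu_ring A \<and>
     (\<forall>k. \<forall>x \<in> carrier A. s k x \<in> carrier A) \<and>
     (\<forall>x \<in> carrier A. s 1 x = x) \<and>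
     (\<forall>k l. \<forall>x \<in> carrier A. s (k * l) x = s k (s l x) \<and> s (k + l) x = s k x \<oplus>\<^bsub>A\<^esub> s l x) \<and>
     (\<forall>k. \<forall>x \<in> carrier A. \<forall>y \<in> carrier A. s k (x \<oplus>\<^bsub>A\<^esub> y) = s k x \<oplus>\<^bsub>A\<^esub> s k y \<and>
        s k (x \<otimes>\<^bsub>A\<^esub> y) = s k x \<otimes>\<^bsub>A\<^esub> y \<and> s k (x \<otimes>\<^bsub>A\<^esub> y) = x \<otimes>\<^bsub>A\<^esub> s k y)"

definition k_linear_on :: "'a set \<Rightarrow> ('k \<Rightarrow> 'a \<Rightarrow> 'a) \<Rightarrow> ('k \<Rightarrow> 'b \<Rightarrow> 'b) \<Rightarrow> ('a \<Rightarrow> 'b) \<Rightarrow> bool" where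
  "k_linear_on X s s' h \<longleftrightarrow> (\<forall>k. \<forall>x \<in> X. h (s k x) = s' k (h x))"

text \<open>The algebra structure for which the canonical maps are linear. It is unique on the carrier,
  since the images of these maps generate the Cuntz--Pimsner ring.\<close>

definition cp_algebra_structure where
  "cp_algebra_structure sR sP sQ R P Q \<psi> s \<longleftrightarrow>
     k_algebra s (cuntz_pimsner_ring R P Q \<psi>) \<and>
     k_linear_on (carrier R) sR s (\<lambda>x. cp_quotient_map R P Q \<psi> (toep_R R P Q \<psi> x)) \<and>
     k_linear_on (carrier P) sP s (\<lambda>x. cp_quotient_map R P Q \<psi> (toep_P R P Q \<psi> x)) \<and>
     k_linear_on (carrier Q) sQ s (\<lambda>x. cp_quotient_map R P Q \<psi> (toep_Q R P Q \<psi> x))"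

definition graded_algebra_iso ::
  "('k \<Rightarrow> 'a \<Rightarrow> 'a) \<Rightarrow> 'a ring \<Rightarrow> (int \<Rightarrow> 'a set) \<Rightarrow>
   ('k \<Rightarrow> 'b \<Rightarrow> 'b) \<Rightarrow> 'b ring \<Rightarrow> (int \<Rightarrow> 'b set) \<Rightarrow> ('a \<Rightarrow> 'b) \<Rightarrow> bool" where
  "graded_algebra_iso s A An s' B Bn h \<longleftrightarrow>
     h \<in> nu_ring_hom A B \<and> bij_betw h (carrier A) (carrier B) \<and>
     k_linear_on (carrier A) s s' h \<and> (\<forall>n. h ` An n = Bn n)"


section \<open>Steinberg algebras\<close>

definition steinberg_functions :: "'g groupoid \<Rightarrow> ('g \<Rightarrow> 'k::field) set" where
  "steinberg_functions G =
     {\<lambda>x. \<Sum>B\<in>F. a B * indicator B x | F a. finite F \<and> (\<forall>B \<in> F. compact_open_bisection G B)}"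

text \<open>For functions in the Steinberg algebra of a Hausdorff groupoid the index set of the sum is
  finite.\<close>

definition convolution ::
  "'g groupoid \<Rightarrow> ('g \<Rightarrow> 'k::field) \<Rightarrow> ('g \<Rightarrow> 'k) \<Rightarrow> 'g \<Rightarrow> 'k" where
  "convolution G f g = (\<lambda>z. \<Sum>(x, y) \<in> {(x, y) \<in> composable G.
     gcomp G x y = z \<and> f x \<noteq> 0 \<and> g y \<noteq> 0}. f x * g y)"

definition steinberg_supported :: "'g groupoid \<Rightarrow> 'g set \<Rightarrow> ('g \<Rightarrow> 'k::field) set" where
  "steinberg_supported G H = {f \<in> steinberg_functions G. \<forall>x. x \<notin> H \<longrightarrow> f x = 0}"

text \<open>The ring \<open>A\<^sub>K(H)\<close> for a clopen subgroupoid \<open>H\<close>.\<close>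

definition steinberg_ring :: "'g groupoid \<Rightarrow> 'g set \<Rightarrow> ('g \<Rightarrow> 'k::field) ring" where
  "steinberg_ring G H =
     \<lparr>carrier = steinberg_supported G H, mult = convolution G, one = undefined,
      zero = (\<lambda>x. 0), add = (\<lambda>f g x. f x + g x)\<rparr>"

definition steinberg_bimodule ::
  "'g groupoid \<Rightarrow> 'g set \<Rightarrow> ('g \<Rightarrow> 'k::field, 'g \<Rightarrow> 'k) bimodule" where
  "steinberg_bimodule G H = ring.extend (steinberg_ring G H)
     \<lparr>lact = convolution G, ract = convolution G\<rparr>"

definition scale_fun :: "'k::field \<Rightarrow> ('g \<Rightarrow> 'k) \<Rightarrow> 'g \<Rightarrow> 'k" where
  "scale_fun k f = (\<lambda>x. k * f x)"

end

(*
  Write A_n for the degree n part of the Steinberg algebra, R = A_0, Q = A_1, P = A_(-1), and let L be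
  the span of Q P.  Local units, that is characteristic functions of compact open sets of units, are
  sums of products 1_X 1_Y with Y the inverse of the bisection X, which gives (FS).  The map Delta
  sends q p to the operator theta_(q,p) and is injective on L, because the elements of L have local
  units in L; hence F_P(Q) = Delta(L), and L is the uniquely maximal faithful psi-compatible ideal.
  So the Cuntz-Pimsner ring O is obtained from the Toeplitz ring by imposing i_Q(q) i_P(p) = i_R(q p)
  for all q and p.  In O every element is a sum of images of elements of R and of products of elements
  of Q only, or of P only.  The inclusions of R, Q and P induce a graded homomorphism from O to the
  Steinberg algebra.  It is injective: if x of degree n > 0 is in the kernel, then so is x i_P(p),
  which vanishes by induction on n, and a local unit in P Q recovers x from these products; n < 0 is
  symmetric.  It is surjective since unperforation provides local units in P Q (n > 0) or Q P (n < 0)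
  for every element a of degree n, and a p (respectively a q) has degree closer to 0.
*)

theory Submission
  imports Defs
begin

section \<open>Non-unital rings\<close>

text \<open>Maps out of the Cuntz-Pimsner ring O come from universality, maps into it do not; so the
  isomorphism is obtained as the inverse of the homomorphism from O to the Steinberg algebra, and O
  receives its scalars by transport along it. No direct sum decomposition of O is established
  beforehand: an element of O is a sum of words of various degrees, and if it maps to zero,
  independence of the degrees in the Steinberg algebra makes the image of each word zero, so
  injectivity is a question in one degree at a time. The argument about O is ring theory; the
  groupoid enters through three kinds of local units. Two of them come from covering ranges or
  sources of supports by bisections. The third is what maximality of L rests on: a function h of
  degree 0 with h Q = 0 has its sources outside r(G_1), and the characteristic function of these
  sources fixes h from the right while P, and with it L, is annihilated by it. The map from F_P(Q)
  to the Toeplitz ring is given by a definite description, so its existence and uniqueness under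
  (FS) are derived as well.\<close>

context nu_ring
begin

lemma nu_l_null [simp]:
  assumes "x \<in> carrier R" shows "\<zero> \<otimes> x = \<zero>"
proof -
  have "\<zero> \<otimes> x \<oplus> \<zero> \<otimes> x = \<zero> \<otimes> x \<oplus> \<zero>"
    using assms by (simp add: nu_l_distr[symmetric] nu_m_closed)
  then show ?thesis using assms by (simp add: nu_m_closed)
qed

lemma nu_r_null [simp]:
  assumes "x \<in> carrier R" shows "x \<otimes> \<zero> = \<zero>"
proof -
  have "x \<otimes> \<zero> \<oplus> x \<otimes> \<zero> = x \<otimes> \<zero> \<oplus> \<zero>"
    using assms by (simp add: nu_r_distr[symmetric] nu_m_closed)
  then show ?thesis using assms by (simp add: nu_m_closed)
qed

lemma nu_l_minus:
  assumes "x \<in> carrier R" "y \<in> carrier R" shows "\<ominus> x \<otimes> y = \<ominus> (x \<otimes> y)"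
  by (rule minus_equality[symmetric])
    (use assms in \<open>simp_all add: nu_l_distr[symmetric] nu_m_closed l_neg\<close>)

lemma nu_r_minus:
  assumes "x \<in> carrier R" "y \<in> carrier R" shows "x \<otimes> \<ominus> y = \<ominus> (x \<otimes> y)"
  by (rule minus_equality[symmetric])
    (use assms in \<open>simp_all add: nu_r_distr[symmetric] nu_m_closed l_neg\<close>)

end

lemma (in abelian_group) additive_subgroupI:
  assumes "H \<subseteq> carrier G" "\<zero> \<in> H" "\<And>x. x \<in> H \<Longrightarrow> \<ominus> x \<in> H"
    "\<And>x y. x \<in> H \<Longrightarrow> y \<in> H \<Longrightarrow> x \<oplus> y \<in> H"
  shows "additive_subgroup H G"
  by (rule additive_subgroup.intro, rule add.subgroupI)
    (use assms in \<open>auto simp: a_inv_def\<close>)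

lemma add_hom_group_hom:
  assumes "abelian_group A" "abelian_group B" "h \<in> add_hom A B"
  shows "group_hom (add_monoid A) (add_monoid B) h"
  using assms by (auto simp: group_hom_def group_hom_axioms_def add_hom_def hom_def
      intro: abelian_group.a_group)

lemma add_hom_zero:
  assumes "abelian_group A" "abelian_group B" "h \<in> add_hom A B"
  shows "h \<zero>\<^bsub>A\<^esub> = \<zero>\<^bsub>B\<^esub>"
  using group_hom.hom_one[OF add_hom_group_hom[OF assms]] by simp

lemma add_hom_minus:
  assumes "abelian_group A" "abelian_group B" "h \<in> add_hom A B" "x \<in> carrier A"
  shows "h (\<ominus>\<^bsub>A\<^esub> x) = \<ominus>\<^bsub>B\<^esub> h x"
  using group_hom.hom_inv[OF add_hom_group_hom[OF assms(1-3)]] assms(4) by (simp add: a_inv_def)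

lemma add_homD:
  assumes "h \<in> add_hom A B" "x \<in> carrier A"
  shows add_hom_closed: "h x \<in> carrier B"
    and add_hom_add: "y \<in> carrier A \<Longrightarrow> h (x \<oplus>\<^bsub>A\<^esub> y) = h x \<oplus>\<^bsub>B\<^esub> h y"
  using assms by (auto simp: add_hom_def)

lemma nu_ring_hom_add_hom: "h \<in> nu_ring_hom A B \<Longrightarrow> h \<in> add_hom A B"
  by (simp add: nu_ring_hom_def)

lemma nu_ring_hom_mult:
  "h \<in> nu_ring_hom A B \<Longrightarrow> x \<in> carrier A \<Longrightarrow> y \<in> carrier A \<Longrightarrow> h (x \<otimes>\<^bsub>A\<^esub> y) = h x \<otimes>\<^bsub>B\<^esub> h y"
  by (simp add: nu_ring_hom_def)

lemma nu_ring_homI: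
  assumes "\<And>x. x \<in> carrier A \<Longrightarrow> h x \<in> carrier B"
    "\<And>x y. x \<in> carrier A \<Longrightarrow> y \<in> carrier A \<Longrightarrow> h (x \<oplus>\<^bsub>A\<^esub> y) = h x \<oplus>\<^bsub>B\<^esub> h y"
    "\<And>x y. x \<in> carrier A \<Longrightarrow> y \<in> carrier A \<Longrightarrow> h (x \<otimes>\<^bsub>A\<^esub> y) = h x \<otimes>\<^bsub>B\<^esub> h y"
  shows "h \<in> nu_ring_hom A B"
  using assms by (auto simp: nu_ring_hom_def add_hom_def)

text \<open>Each ring axiom is an identity that \<open>h\<close> carries over from preimages, so no
  laws of \<open>S\<close> are presupposed. For quotients this leaves only well-definedness of the
  multiplication of cosets.\<close>

lemma nu_ring_surj_image:
  assumes R: "nu_ring R" and h: "h \<in> nu_ring_hom R S" and surj: "h ` carrier R = carrier S"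
    and zero: "h \<zero>\<^bsub>R\<^esub> = \<zero>\<^bsub>S\<^esub>"
  shows "nu_ring S"
proof -
  interpret R: nu_ring R by (rule R)
  note [simp] = add_hom_add[OF nu_ring_hom_add_hom[OF h], symmetric] nu_ring_hom_mult[OF h, symmetric]
    R.nu_m_closed zero[symmetric]
  have "abelian_group S"
  proof (rule abelian_groupI)
    fix x assume "x \<in> carrier S"
    then obtain t where "t \<in> carrier R" "x = h t" using surj by auto
    then show "\<exists>y\<in>carrier S. y \<oplus>\<^bsub>S\<^esub> x = \<zero>\<^bsub>S\<^esub>"
      by (intro bexI[of _ "h (\<ominus>\<^bsub>R\<^esub> t)"]) (auto simp: R.l_neg surj[symmetric])
  qed (auto simp: surj[symmetric] R.a_assoc R.a_comm R.a_lcomm)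
  then show ?thesis
    by (rule nu_ring.intro, unfold_locales)
      (auto simp: surj[symmetric] R.nu_m_assoc R.nu_l_distr R.nu_r_distr)
qed

text \<open>As \<open>\<eta>\<close> is constant on the fibres of \<open>\<kappa>\<close>, any
  preimage chosen by \<open>inv_into\<close> gives the right value.\<close>

lemma nu_ring_hom_factor:
  assumes T: "nu_ring T" and \<kappa>: "\<kappa> \<in> nu_ring_hom T O'" and surj: "\<kappa> ` carrier T = carrier O'"
    and \<eta>: "\<eta> \<in> nu_ring_hom T A"
    and ker: "\<And>t u. t \<in> carrier T \<Longrightarrow> u \<in> carrier T \<Longrightarrow> \<kappa> t = \<kappa> u \<Longrightarrow> \<eta> t = \<eta> u"
  obtains h where "h \<in> nu_ring_hom O' A" "\<And>t. t \<in> carrier T \<Longrightarrow> h (\<kappa> t) = \<eta> t"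
proof -
  interpret T: nu_ring T by (rule T)
  define h where "h x = \<eta> (inv_into (carrier T) \<kappa> x)" for x
  have h: "h (\<kappa> t) = \<eta> t" if "t \<in> carrier T" for t
    unfolding h_def using that by (intro ker) (auto simp: inv_into_into f_inv_into_f)
  have "h \<in> nu_ring_hom O' A"
    by (rule nu_ring_homI)
      (auto simp: surj[symmetric] h T.nu_m_closed add_homD[OF nu_ring_hom_add_hom[OF \<eta>]]
        nu_ring_hom_mult[OF \<eta>] add_homD(2)[OF nu_ring_hom_add_hom[OF \<kappa>], symmetric]
        nu_ring_hom_mult[OF \<kappa>, symmetric])
  with h that show thesis by blast
qed

lemma nu_ring_hom_inv_into:
  assumes A: "nu_ring A" and h: "h \<in> nu_ring_hom A B" and bij: "bij_betw h (carrier A) (carrier B)"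
  shows "inv_into (carrier A) h \<in> nu_ring_hom B A"
proof -
  interpret A: nu_ring A by (rule A)
  have B: "carrier B = h ` carrier A" using bij by (simp add: bij_betw_def)
  have inj: "inj_on h (carrier A)" using bij by (simp add: bij_betw_def)
  show ?thesis
    by (rule nu_ring_homI)
      (auto simp: B inv_into_f_f[OF inj] A.nu_m_closed nu_ring_hom_mult[OF h, symmetric]
        add_homD(2)[OF nu_ring_hom_add_hom[OF h], symmetric])
qed

text \<open>Meant for the Cuntz-Pimsner ring: scalars act there through the isomorphism with the
  Steinberg algebra, so none have to be constructed on the Toeplitz ring.\<close>

lemma k_algebra_transport:
  fixes s :: "'k::field \<Rightarrow> 'a \<Rightarrow> 'a"
  assumes A: "k_algebra s A" and B: "nu_ring B"
    and h: "h \<in> nu_ring_hom A B" and bij: "bij_betw h (carrier A) (carrier B)"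
  shows "k_algebra (\<lambda>k x. h (s k (inv_into (carrier A) h x))) B"
proof -
  interpret A: nu_ring A using A by (simp add: k_algebra_def)
  have Bc: "carrier B = h ` carrier A" using bij by (simp add: bij_betw_def)
  have inj: "inj_on h (carrier A)" using bij by (simp add: bij_betw_def)
  have sc: "s k x \<in> carrier A" if "x \<in> carrier A" for k x
    using that A by (simp add: k_algebra_def)
  have s1: "s 1 x = x" if "x \<in> carrier A" for x
    using that A by (simp add: k_algebra_def)
  have s2: "s (k * l) x = s k (s l x)" "s (k + l) x = s k x \<oplus>\<^bsub>A\<^esub> s l x" if "x \<in> carrier A" for k l x
    using that A by (simp_all add: k_algebra_def)
  have s3: "s k (x \<oplus>\<^bsub>A\<^esub> y) = s k x \<oplus>\<^bsub>A\<^esub> s k y" "s k x \<otimes>\<^bsub>A\<^esub> y = s k (x \<otimes>\<^bsub>A\<^esub> y)"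
    "x \<otimes>\<^bsub>A\<^esub> s k y = s k (x \<otimes>\<^bsub>A\<^esub> y)"
    if "x \<in> carrier A" "y \<in> carrier A" for k x y
    using that A unfolding k_algebra_def by metis+
  show ?thesis
    unfolding k_algebra_def
    by (auto simp: Bc inv_into_f_f[OF inj] sc s1 s2 s3 B A.nu_m_closed nu_ring_hom_mult[OF h, symmetric]
        add_homD(2)[OF nu_ring_hom_add_hom[OF h], symmetric])
qed

section \<open>Ideals, quotients and additive spans\<close>

lemma nu_genideal_ideal:
  assumes R: "nu_ring R" and X: "X \<subseteq> carrier R"
  shows "nu_ideal (nu_genideal R X) R"
proof -
  interpret R: nu_ring R by (rule R)
  have sub: "additive_subgroup I R" if "nu_ideal I R" for I
    using that by (simp add: nu_ideal_def)
  \<comment> \<open>Without this ideal the intersected family could be empty and its intersection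
    the whole type.\<close>
  have top: "nu_ideal (carrier R) R"
    by (auto simp: nu_ideal_def R.nu_m_closed intro!: R.additive_subgroupI)
  have "additive_subgroup (nu_genideal R X) R"
  proof (rule R.additive_subgroupI)
    show "nu_genideal R X \<subseteq> carrier R"
      using top X by (auto simp: nu_genideal_def)
  next
    fix x assume "x \<in> nu_genideal R X"
    then show "\<ominus>\<^bsub>R\<^esub> x \<in> nu_genideal R X"
      by (auto simp: nu_genideal_def intro: additive_subgroup.a_inv_closed[OF sub] R.abelian_group_axioms)
  next
    fix x y assume "x \<in> nu_genideal R X" "y \<in> nu_genideal R X"
    then show "x \<oplus>\<^bsub>R\<^esub> y \<in> nu_genideal R X"
      by (auto simp: nu_genideal_def intro: additive_subgroup.a_closed[OF sub])
  qed (auto simp: nu_genideal_def intro: additive_subgroup.zero_closed[OF sub])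
  then show ?thesis
    by (auto simp: nu_ideal_def) (auto simp: nu_genideal_def nu_ideal_def)
qed

lemma nu_genideal_incl: "X \<subseteq> nu_genideal R X"
  by (auto simp: nu_genideal_def)

lemma nu_genideal_minimal: "nu_ideal I R \<Longrightarrow> X \<subseteq> I \<Longrightarrow> nu_genideal R X \<subseteq> I"
  by (auto simp: nu_genideal_def)

lemma nu_ideal_kernel:
  assumes R: "nu_ring R" and S: "nu_ring S" and h: "h \<in> nu_ring_hom R S"
  shows "nu_ideal {x \<in> carrier R. h x = \<zero>\<^bsub>S\<^esub>} R"
proof -
  interpret R: nu_ring R by (rule R)
  interpret S: nu_ring S by (rule S)
  note h' = nu_ring_hom_add_hom[OF h]
  have "additive_subgroup {x \<in> carrier R. h x = \<zero>\<^bsub>S\<^esub>} R"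
    by (rule R.additive_subgroupI)
      (auto simp: add_hom_zero[OF R.abelian_group_axioms S.abelian_group_axioms h']
        add_hom_minus[OF R.abelian_group_axioms S.abelian_group_axioms h'] add_homD[OF h'])
  then show ?thesis
    by (auto simp: nu_ideal_def R.nu_m_closed nu_ring_hom_mult[OF h] add_homD[OF h'])
qed

lemma
  assumes R: "nu_ring R" and I: "nu_ideal I R"
  shows nu_quotient_ring: "nu_ring (R Quot I)"
    and nu_quotient_hom: "(+>\<^bsub>R\<^esub>) I \<in> nu_ring_hom R (R Quot I)"
    and nu_quotient_surj: "(+>\<^bsub>R\<^esub>) I ` carrier R = carrier (R Quot I)"
    and nu_quotient_eq_iff: "\<And>x y. x \<in> carrier R \<Longrightarrow> y \<in> carrier R \<Longrightarrow>
      I +>\<^bsub>R\<^esub> x = I +>\<^bsub>R\<^esub> y \<longleftrightarrow> x \<ominus>\<^bsub>R\<^esub> y \<in> I"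
proof -
  interpret R: nu_ring R by (rule R)
  interpret I: abelian_subgroup I R
    using I by (auto simp: nu_ideal_def intro: abelian_subgroupI3 R.abelian_group_axioms)
  have abs: "a \<otimes>\<^bsub>R\<^esub> x \<in> I" "x \<otimes>\<^bsub>R\<^esub> a \<in> I" if "a \<in> I" "x \<in> carrier R" for a x
    using I that by (auto simp: nu_ideal_def)
  show eq: "I +>\<^bsub>R\<^esub> x = I +>\<^bsub>R\<^esub> y \<longleftrightarrow> x \<ominus>\<^bsub>R\<^esub> y \<in> I"
    if "x \<in> carrier R" "y \<in> carrier R" for x y
  proof -
    have "I +>\<^bsub>R\<^esub> x = I +>\<^bsub>R\<^esub> y \<longleftrightarrow> x \<in> I +>\<^bsub>R\<^esub> y"
      using that I.a_rcos_self[of x] I.a_repr_independence'[of x y] by auto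
    then show ?thesis using that by (simp add: I.a_rcos_module R.minus_eq)
  qed
  \<comment> \<open>\<open>rcoset_mult\<close> is a union over all pairs of representatives, so the
    claim is that (i + x)(j + y) lies in the coset of x y; the surplus terms contain
    \<open>i\<close> or \<open>j\<close> and belong to \<open>I\<close>.\<close>
  have mult: "rcoset_mult R I (I +>\<^bsub>R\<^esub> x) (I +>\<^bsub>R\<^esub> y) = I +>\<^bsub>R\<^esub> (x \<otimes>\<^bsub>R\<^esub> y)"
    if x: "x \<in> carrier R" and y: "y \<in> carrier R" for x y
  proof -
    have "I +>\<^bsub>R\<^esub> (a \<otimes>\<^bsub>R\<^esub> b) = I +>\<^bsub>R\<^esub> (x \<otimes>\<^bsub>R\<^esub> y)"
      if "a \<in> I +>\<^bsub>R\<^esub> x" "b \<in> I +>\<^bsub>R\<^esub> y" for a b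
    proof -
      obtain i j where i: "i \<in> I" "a = i \<oplus>\<^bsub>R\<^esub> x" and j: "j \<in> I" "b = j \<oplus>\<^bsub>R\<^esub> y"
        using \<open>a \<in> I +>\<^bsub>R\<^esub> x\<close> \<open>b \<in> I +>\<^bsub>R\<^esub> y\<close> by (auto simp: a_r_coset_def')
      have ij: "i \<in> carrier R" "j \<in> carrier R" using i j I.a_subset by auto
      have "a \<otimes>\<^bsub>R\<^esub> b = (i \<otimes>\<^bsub>R\<^esub> (j \<oplus>\<^bsub>R\<^esub> y) \<oplus>\<^bsub>R\<^esub> x \<otimes>\<^bsub>R\<^esub> j) \<oplus>\<^bsub>R\<^esub> x \<otimes>\<^bsub>R\<^esub> y"
        using i j ij x y by (simp add: R.nu_l_distr R.nu_r_distr R.nu_m_closed R.a_assoc R.a_lcomm)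
      then have "a \<otimes>\<^bsub>R\<^esub> b \<ominus>\<^bsub>R\<^esub> x \<otimes>\<^bsub>R\<^esub> y = i \<otimes>\<^bsub>R\<^esub> (j \<oplus>\<^bsub>R\<^esub> y) \<oplus>\<^bsub>R\<^esub> x \<otimes>\<^bsub>R\<^esub> j"
        using ij x y by (simp add: R.minus_eq R.nu_m_closed R.a_assoc R.r_neg)
      moreover have "\<dots> \<in> I" using ij i j x y by (intro I.a_closed abs) auto
      ultimately show ?thesis using i j ij x y by (simp add: eq R.nu_m_closed)
    qed
    moreover have "x \<in> I +>\<^bsub>R\<^esub> x" "y \<in> I +>\<^bsub>R\<^esub> y" using x y by (simp_all add: I.a_rcos_self)
    ultimately show ?thesis unfolding rcoset_mult_def by blast
  qed
  show hom: "(+>\<^bsub>R\<^esub>) I \<in> nu_ring_hom R (R Quot I)"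
    by (rule nu_ring_homI)
      (auto simp: FactRing_simps mult I.a_rcos_sum)
  show surj: "(+>\<^bsub>R\<^esub>) I ` carrier R = carrier (R Quot I)"
    by (auto simp: FactRing_simps)
  show "nu_ring (R Quot I)"
    by (rule nu_ring_surj_image[OF R hom surj]) (simp add: FactRing_def a_r_coset_def' R.zero_closed)
qed

lemma (in abelian_group) additive_span_subgroup:
  "X \<subseteq> carrier G \<Longrightarrow> additive_subgroup (generate (add_monoid G) X) G"
  by (rule additive_subgroup.intro, rule add.generate_is_subgroup) simp

lemma (in abelian_group) additive_span_minimal:
  "X \<subseteq> H \<Longrightarrow> additive_subgroup H G \<Longrightarrow> generate (add_monoid G) X \<subseteq> H"
  by (rule add.generate_subgroup_incl) (auto simp: additive_subgroup.a_subgroup)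

lemma (in abelian_group)
  assumes H: "additive_subgroup H G"
  shows additive_subgroup_group: "abelian_group (G\<lparr>carrier := H\<rparr>)"
    and additive_subgroup_minus: "\<And>x. x \<in> H \<Longrightarrow> \<ominus>\<^bsub>G\<lparr>carrier := H\<rparr>\<^esub> x = \<ominus> x"
proof -
  interpret H: additive_subgroup H G by (rule H)
  have [simp]: "x \<in> carrier G" if "x \<in> H" for x using that H.a_subset by auto
  have inv: "\<ominus> x \<in> H" if "x \<in> H" for x
    using that by (rule H.a_inv_closed)
  show ag: "abelian_group (G\<lparr>carrier := H\<rparr>)"
  proof (rule abelian_groupI)
    fix x assume "x \<in> carrier (G\<lparr>carrier := H\<rparr>)"
    then show "\<exists>y\<in>carrier (G\<lparr>carrier := H\<rparr>).
        y \<oplus>\<^bsub>G\<lparr>carrier := H\<rparr>\<^esub> x = \<zero>\<^bsub>G\<lparr>carrier := H\<rparr>\<^esub>"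
      by (intro bexI[of _ "\<ominus> x"]) (auto simp: l_neg inv)
  qed (auto simp: a_ac)
  then show "\<ominus>\<^bsub>G\<lparr>carrier := H\<rparr>\<^esub> x = \<ominus> x" if "x \<in> H" for x
    using that inv[OF that] by (intro abelian_group.minus_equality) (auto simp: l_neg)
qed

text \<open>For components of opposite degrees this is a subgroup of the degree \<open>0\<close>
  part, and the local units of \<open>left_unit\<close> and \<open>right_unit\<close> are taken from
  it.\<close>

definition product_span :: "('a, 'm) ring_scheme \<Rightarrow> 'a set \<Rightarrow> 'a set \<Rightarrow> 'a set" where
  "product_span A X Y = generate (add_monoid A) {x \<otimes>\<^bsub>A\<^esub> y | x y. x \<in> X \<and> y \<in> Y}"

lemma (in nu_ring) product_span_subgroup:
  "X \<subseteq> carrier R \<Longrightarrow> Y \<subseteq> carrier R \<Longrightarrow> additive_subgroup (product_span R X Y) R"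
  unfolding product_span_def by (rule additive_span_subgroup) (auto intro!: nu_m_closed)

lemma product_span_incl: "x \<in> X \<Longrightarrow> y \<in> Y \<Longrightarrow> x \<otimes>\<^bsub>A\<^esub> y \<in> product_span A X Y"
  unfolding product_span_def by (rule generate.incl) blast

lemma (in nu_ring) product_span_minimal:
  "additive_subgroup H R \<Longrightarrow> (\<And>x y. x \<in> X \<Longrightarrow> y \<in> Y \<Longrightarrow> x \<otimes> y \<in> H) \<Longrightarrow> product_span R X Y \<subseteq> H"
  unfolding product_span_def by (rule additive_span_minimal) auto

text \<open>An element of the span involves only finitely many right-hand factors, and a right unit
  of these is a right unit of the element. This lifts local units for finite subsets of
  \<open>Y\<close> to the span.\<close>

lemma (in nu_ring) product_span_fixed:
  assumes X: "X \<subseteq> carrier R" and Y: "Y \<subseteq> carrier R" and x: "x \<in> product_span R X Y"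
  shows "\<exists>F. finite F \<and> F \<subseteq> Y \<and> (\<forall>e\<in>carrier R. (\<forall>y\<in>F. y \<otimes> e = y) \<longrightarrow> x \<otimes> e = x)"
proof -
  let ?H = "{x \<in> carrier R. \<exists>F. finite F \<and> F \<subseteq> Y \<and>
    (\<forall>e\<in>carrier R. (\<forall>y\<in>F. y \<otimes> e = y) \<longrightarrow> x \<otimes> e = x)}"
  have "additive_subgroup ?H R"
  proof (rule additive_subgroupI)
    show "\<zero> \<in> ?H" by (auto intro!: exI[of _ "{}"])
    show "\<ominus> x \<in> ?H" if "x \<in> ?H" for x using that by (auto simp: nu_l_minus)
    fix x y assume "x \<in> ?H" "y \<in> ?H"
    then obtain F F' where "x \<in> carrier R" "y \<in> carrier R" "finite F" "F \<subseteq> Y" "finite F'" "F' \<subseteq> Y"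
      "\<forall>e\<in>carrier R. (\<forall>y\<in>F. y \<otimes> e = y) \<longrightarrow> x \<otimes> e = x"
      "\<forall>e\<in>carrier R. (\<forall>y\<in>F'. y \<otimes> e = y) \<longrightarrow> y \<otimes> e = y" by auto
    then show "x \<oplus> y \<in> ?H"
      by (auto simp: nu_l_distr intro!: exI[of _ "F \<union> F'"])
  qed (rule Collect_restrict)
  moreover have "x \<otimes> y \<in> ?H" if "x \<in> X" "y \<in> Y" for x y
    using that X Y by (auto simp: nu_m_assoc nu_m_closed subset_iff intro!: exI[of _ "{y}"])
  ultimately show ?thesis using product_span_minimal[of ?H X Y] x by auto
qed

lemma (in abelian_group) eq_if_diff_zero:
  assumes "x \<in> carrier G" "y \<in> carrier G" "x \<ominus> y = \<zero>"
  shows "x = y"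
proof -
  have "x = (x \<ominus> y) \<oplus> y" using assms(1,2) by (simp add: minus_eq a_assoc l_neg)
  with assms show ?thesis by simp
qed

section \<open>Balanced maps and the tensor product\<close>

locale bimodule_pair = P: bimodule R P + Q: bimodule R Q
  for R :: "'r ring" and P :: "('r, 'p) bimodule" and Q :: "('r, 'q) bimodule"
begin

abbreviation "F \<equiv> tensor_free P Q"
abbreviation "N \<equiv> tensor_subgroup R P Q"
abbreviation "coset \<equiv> tensor_coset R P Q"

sublocale F: comm_group F
  unfolding tensor_free_def by (rule abelian_free_Abelian_group)

lemma F_carrier: "x \<in> carrier F \<longleftrightarrow> Poly_Mapping.keys x \<subseteq> carrier P \<times> carrier Q"
  by (simp add: tensor_free_def)

lemma F_of: "p \<in> carrier P \<Longrightarrow> q \<in> carrier Q \<Longrightarrow> frag_of (p, q) \<in> carrier F"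
  by (simp add: tensor_free_def)

lemma F_diff: "x \<in> carrier F \<Longrightarrow> y \<in> carrier F \<Longrightarrow> x - y \<in> carrier F"
  using keys_diff[of x y] by (auto simp: F_carrier)

lemma F_mult: "x \<otimes>\<^bsub>F\<^esub> y = x + y"
  by (simp add: tensor_free_def)

lemma relators_closed: "tensor_relators R P Q \<subseteq> carrier F"
  by (auto simp: tensor_relators_def intro!: F_diff F_of P.lact_closed P.ract_closed Q.lact_closed)

lemma relatorI:
  shows "p \<in> carrier P \<Longrightarrow> p' \<in> carrier P \<Longrightarrow> q \<in> carrier Q \<Longrightarrow>
      frag_of (p \<oplus>\<^bsub>P\<^esub> p', q) - frag_of (p, q) - frag_of (p', q) \<in> tensor_relators R P Q"
    "p \<in> carrier P \<Longrightarrow> q \<in> carrier Q \<Longrightarrow> q' \<in> carrier Q \<Longrightarrow>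
      frag_of (p, q \<oplus>\<^bsub>Q\<^esub> q') - frag_of (p, q) - frag_of (p, q') \<in> tensor_relators R P Q"
    "p \<in> carrier P \<Longrightarrow> q \<in> carrier Q \<Longrightarrow> s \<in> carrier R \<Longrightarrow>
      frag_of (p \<triangleleft>\<^bsub>P\<^esub> s, q) - frag_of (p, s \<triangleright>\<^bsub>Q\<^esub> q) \<in> tensor_relators R P Q"
  unfolding tensor_relators_def by blast+

lemma relatorE:
  assumes "c \<in> tensor_relators R P Q"
  obtains (add_left) p p' q where "p \<in> carrier P" "p' \<in> carrier P" "q \<in> carrier Q"
      "c = frag_of (p \<oplus>\<^bsub>P\<^esub> p', q) - frag_of (p, q) - frag_of (p', q)"
    | (add_right) p q q' where "p \<in> carrier P" "q \<in> carrier Q" "q' \<in> carrier Q"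
      "c = frag_of (p, q \<oplus>\<^bsub>Q\<^esub> q') - frag_of (p, q) - frag_of (p, q')"
    | (balanced) p q s where "p \<in> carrier P" "q \<in> carrier Q" "s \<in> carrier R"
      "c = frag_of (p \<triangleleft>\<^bsub>P\<^esub> s, q) - frag_of (p, s \<triangleright>\<^bsub>Q\<^esub> q)"
  using assms unfolding tensor_relators_def by (elim UnE CollectE exE conjE) (auto intro: that)

lemma relators_subgroup: "subgroup N F"
  unfolding tensor_subgroup_def by (rule F.generate_is_subgroup[OF relators_closed])

lemma relators_normal: "N \<lhd> F"
  by (rule F.subgroup_imp_normal[OF relators_subgroup])

lemma relators_incl: "tensor_relators R P Q \<subseteq> N"
  unfolding tensor_subgroup_def by (auto intro: generate.incl)

lemma tensor_carrier: "carrier (tensor R P Q) = coset ` carrier F"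
  by (auto simp: tensor_def Let_def carrier_FactGroup tensor_coset_def)

lemma coset_self: "x \<in> carrier F \<Longrightarrow> x \<in> coset x"
  unfolding tensor_coset_def by (rule F.rcos_self[OF _ relators_subgroup])

lemma coset_eqI: "x \<in> coset y \<Longrightarrow> y \<in> carrier F \<Longrightarrow> coset x = coset y"
  unfolding tensor_coset_def using F.repr_independence[OF _ _ relators_subgroup, of x y] by simp

lemma coset_add:
  assumes "x \<in> carrier F" "y \<in> carrier F"
  shows "coset x \<oplus>\<^bsub>tensor R P Q\<^esub> coset y = coset (x + y)"
  using normal.rcos_sum[OF relators_normal assms]
  by (simp add: tensor_def Let_def tensor_coset_def F_mult)

lemma coset_diff_eqI:
  assumes "x - y \<in> tensor_relators R P Q" "y \<in> carrier F"
  shows "coset x = coset y"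
  by (rule coset_eqI[OF _ assms(2)])
    (use assms relators_incl in \<open>force simp: tensor_coset_def r_coset_def F_mult intro!: bexI[of _ "x - y"]\<close>)

text \<open>An action on the tensor product is a union over all representatives \<open>c\<close> of
  a coset. Its members coincide as soon as the linear extension of \<open>g\<close> maps relators
  into \<open>N\<close>; both actions are instances.\<close>

lemma tensor_action:
  assumes g: "\<And>x. x \<in> carrier P \<times> carrier Q \<Longrightarrow> g x \<in> carrier F"
    and gN: "frag_extend g ` tensor_relators R P Q \<subseteq> N" and x: "x \<in> carrier F"
  shows "(\<Union>c\<in>coset x. coset (frag_extend g c)) = coset (frag_extend g x)"
    and "frag_extend g x \<in> carrier F"
proof -
  have gF: "frag_extend g c \<in> carrier F" if "c \<in> carrier F" for c
    using that g keys_frag_extend[of g c] unfolding F_carrier by (meson UN_least order_trans subsetD)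
  have ghom: "frag_extend g \<in> hom F F"
    by (auto simp: hom_def gF F_mult frag_extend_add)
  interpret g: group_hom F F "frag_extend g"
    by unfold_locales (rule ghom)
  \<comment> \<open>The preimage of a subgroup is a subgroup, so it suffices that it contains the
    relators, which generate \<open>N\<close>.\<close>
  have "N \<subseteq> {c \<in> carrier F. frag_extend g c \<in> N}"
  proof -
    have "subgroup {c \<in> carrier F. frag_extend g c \<in> N} F"
      by (rule F.subgroupI)
        (auto simp: subgroup.one_closed[OF relators_subgroup] subgroup.m_inv_closed[OF relators_subgroup] g.hom_inv
          subgroup.m_closed[OF relators_subgroup] intro!: exI[of _ "\<one>\<^bsub>F\<^esub>"])
    then show ?thesis
      unfolding tensor_subgroup_def
      by (rule F.generate_subgroup_incl[rotated])
        (use relators_closed gN in \<open>auto simp: tensor_subgroup_def\<close>)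
  qed
  then have "coset (frag_extend g c) = coset (frag_extend g x)" if "c \<in> coset x" for c
  proof -
    obtain n where n: "n \<in> N" "c = n + x"
      using \<open>c \<in> coset x\<close> by (auto simp: tensor_coset_def r_coset_def F_mult)
    with \<open>N \<subseteq> _\<close> have "frag_extend g n \<in> N" by auto
    then show ?thesis
      using n by (intro coset_eqI gF x) (auto simp: tensor_coset_def r_coset_def F_mult frag_extend_add)
  qed
  with coset_self[OF x] show "(\<Union>c\<in>coset x. coset (frag_extend g c)) = coset (frag_extend g x)"
    by blast
  show "frag_extend g x \<in> carrier F" by (rule gF[OF x])
qed

lemma tensor_lact:
  assumes r: "r \<in> carrier R" and x: "x \<in> carrier F"
  shows "r \<triangleright>\<^bsub>tensor R P Q\<^esub> coset x = coset (frag_extend (\<lambda>(p, q). frag_of (r \<triangleright>\<^bsub>P\<^esub> p, q)) x)"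
    and "frag_extend (\<lambda>(p, q). frag_of (r \<triangleright>\<^bsub>P\<^esub> p, q)) x \<in> carrier F"
proof -
  let ?g = "\<lambda>(p, q). frag_of (r \<triangleright>\<^bsub>P\<^esub> p, q)"
  \<comment> \<open>Relators are mapped to relators of the same kind; the balanced ones use (r p) s
    = r (p s).\<close>
  have "frag_extend ?g c \<in> tensor_relators R P Q" if "c \<in> tensor_relators R P Q" for c
    using that by (cases rule: relatorE) (simp_all add: frag_extend_diff P.lact_add_right P.lact_ract[symmetric] r P.lact_closed relatorI)
  then have gN: "frag_extend ?g ` tensor_relators R P Q \<subseteq> N" using relators_incl by blast
  have g: "?g y \<in> carrier F" if "y \<in> carrier P \<times> carrier Q" for y
    using that r by (auto simp: F_of P.lact_closed)
  show "r \<triangleright>\<^bsub>tensor R P Q\<^esub> coset x = coset (frag_extend ?g x)"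
    using tensor_action(1)[OF g gN x] by (simp add: tensor_def Let_def)
  show "frag_extend ?g x \<in> carrier F" by (rule tensor_action(2)[OF g gN x])
qed

lemma tensor_ract:
  assumes r: "r \<in> carrier R" and x: "x \<in> carrier F"
  shows "coset x \<triangleleft>\<^bsub>tensor R P Q\<^esub> r = coset (frag_extend (\<lambda>(p, q). frag_of (p, q \<triangleleft>\<^bsub>Q\<^esub> r)) x)"
    and "frag_extend (\<lambda>(p, q). frag_of (p, q \<triangleleft>\<^bsub>Q\<^esub> r)) x \<in> carrier F"
proof -
  let ?g = "\<lambda>(p, q). frag_of (p, q \<triangleleft>\<^bsub>Q\<^esub> r)"
  have "frag_extend ?g c \<in> tensor_relators R P Q" if "c \<in> tensor_relators R P Q" for c
    using that by (cases rule: relatorE) (simp_all add: frag_extend_diff Q.ract_add_left Q.lact_ract r Q.ract_closed relatorI)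
  then have gN: "frag_extend ?g ` tensor_relators R P Q \<subseteq> N" using relators_incl by blast
  have g: "?g y \<in> carrier F" if "y \<in> carrier P \<times> carrier Q" for y
    using that r by (auto simp: F_of Q.ract_closed)
  show "coset x \<triangleleft>\<^bsub>tensor R P Q\<^esub> r = coset (frag_extend ?g x)"
    using tensor_action(1)[OF g gN x] by (simp add: tensor_def Let_def)
  show "frag_extend ?g x \<in> carrier F" by (rule tensor_action(2)[OF g gN x])
qed

lemma pure_tensor_simps:
  assumes "p \<in> carrier P" "q \<in> carrier Q"
  shows "p' \<in> carrier P \<Longrightarrow> pure_tensor R P Q (p \<oplus>\<^bsub>P\<^esub> p') q =
      pure_tensor R P Q p q \<oplus>\<^bsub>tensor R P Q\<^esub> pure_tensor R P Q p' q"
    and "q' \<in> carrier Q \<Longrightarrow> pure_tensor R P Q p (q \<oplus>\<^bsub>Q\<^esub> q') =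
      pure_tensor R P Q p q \<oplus>\<^bsub>tensor R P Q\<^esub> pure_tensor R P Q p q'"
    and "r \<in> carrier R \<Longrightarrow> pure_tensor R P Q p (q \<triangleleft>\<^bsub>Q\<^esub> r) = pure_tensor R P Q p q \<triangleleft>\<^bsub>tensor R P Q\<^esub> r"
proof -
  have add: "x + y \<in> carrier F" if "x \<in> carrier F" "y \<in> carrier F" for x y
    using F.m_closed[OF that] by (simp add: F_mult)
  show "p' \<in> carrier P \<Longrightarrow> pure_tensor R P Q (p \<oplus>\<^bsub>P\<^esub> p') q =
      pure_tensor R P Q p q \<oplus>\<^bsub>tensor R P Q\<^esub> pure_tensor R P Q p' q"
    using assms relatorI(1)[of p p' q] unfolding pure_tensor_def
    by (simp add: coset_add F_of) (rule coset_diff_eqI, auto simp: diff_diff_eq intro: add F_of)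
  show "q' \<in> carrier Q \<Longrightarrow> pure_tensor R P Q p (q \<oplus>\<^bsub>Q\<^esub> q') =
      pure_tensor R P Q p q \<oplus>\<^bsub>tensor R P Q\<^esub> pure_tensor R P Q p q'"
    using assms relatorI(2)[of p q q'] unfolding pure_tensor_def
    by (simp add: coset_add F_of) (rule coset_diff_eqI, auto simp: diff_diff_eq intro: add F_of)
  show "r \<in> carrier R \<Longrightarrow> pure_tensor R P Q p (q \<triangleleft>\<^bsub>Q\<^esub> r) = pure_tensor R P Q p q \<triangleleft>\<^bsub>tensor R P Q\<^esub> r"
    using assms by (simp add: pure_tensor_def tensor_ract F_of)
qed

text \<open>The additive part is the universal property of the free abelian group followed by
  factoring through \<open>N\<close>, which lies in the kernel because the additive extension of
  \<open>f\<close> kills each relator. Compatibility with the actions is then an induction over the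
  free group, whose elements arise from generators by differences.\<close>

lemma tensor_lift:
  assumes closed: "\<And>p q. p \<in> carrier P \<Longrightarrow> q \<in> carrier Q \<Longrightarrow> f p q \<in> carrier R"
    and add_left: "\<And>p p' q. p \<in> carrier P \<Longrightarrow> p' \<in> carrier P \<Longrightarrow> q \<in> carrier Q \<Longrightarrow>
      f (p \<oplus>\<^bsub>P\<^esub> p') q = f p q \<oplus>\<^bsub>R\<^esub> f p' q"
    and add_right: "\<And>p q q'. p \<in> carrier P \<Longrightarrow> q \<in> carrier Q \<Longrightarrow> q' \<in> carrier Q \<Longrightarrow>
      f p (q \<oplus>\<^bsub>Q\<^esub> q') = f p q \<oplus>\<^bsub>R\<^esub> f p q'"
    and balanced: "\<And>p q r. p \<in> carrier P \<Longrightarrow> q \<in> carrier Q \<Longrightarrow> r \<in> carrier R \<Longrightarrow>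
      f (p \<triangleleft>\<^bsub>P\<^esub> r) q = f p (r \<triangleright>\<^bsub>Q\<^esub> q)"
    and lact: "\<And>p q r. p \<in> carrier P \<Longrightarrow> q \<in> carrier Q \<Longrightarrow> r \<in> carrier R \<Longrightarrow>
      f (r \<triangleright>\<^bsub>P\<^esub> p) q = r \<otimes>\<^bsub>R\<^esub> f p q"
    and ract: "\<And>p q r. p \<in> carrier P \<Longrightarrow> q \<in> carrier Q \<Longrightarrow> r \<in> carrier R \<Longrightarrow>
      f p (q \<triangleleft>\<^bsub>Q\<^esub> r) = f p q \<otimes>\<^bsub>R\<^esub> r"
  obtains \<psi> where "\<psi> \<in> bimodule_hom R (tensor R P Q) (self_bimodule R)"
    "\<And>p q. p \<in> carrier P \<Longrightarrow> q \<in> carrier Q \<Longrightarrow> \<psi> (pure_tensor R P Q p q) = f p q"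
proof -
  let ?S = "carrier P \<times> carrier Q"
  obtain h where h: "h \<in> hom F (add_monoid R)" and h_of: "\<And>x. x \<in> ?S \<Longrightarrow> h (frag_of x) = case_prod f x"
  proof (rule comm_group.free_Abelian_group_universal[OF P.a_comm_group])
    show "case_prod f ` ?S \<subseteq> carrier (add_monoid R)" using closed by auto
  qed (simp add: tensor_free_def)
  interpret h: group_hom F "add_monoid R" h
    using h by unfold_locales
  have h_of': "h (frag_of (p, q)) = f p q" if "p \<in> carrier P" "q \<in> carrier Q" for p q
    using h_of[of "(p, q)"] that by simp
  have h_cl: "h x \<in> carrier R" if "x \<in> carrier F" for x using h.hom_closed[OF that] by simp
  have h_add: "h (x + y) = h x \<oplus>\<^bsub>R\<^esub> h y" if "x \<in> carrier F" "y \<in> carrier F" for x y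
    using h.hom_mult[OF that] by (simp add: F_mult)
  have h_diff: "h (x - y) = h x \<ominus>\<^bsub>R\<^esub> h y" if "x \<in> carrier F" "y \<in> carrier F" for x y
  proof -
    have "h x = h (x - y) \<oplus>\<^bsub>R\<^esub> h y"
      using h_add[OF F_diff[OF that] that(2)] by simp
    then show ?thesis
      using h_cl that F_diff[OF that] by (simp add: P.minus_eq P.a_assoc P.r_neg)
  qed
  have canc: "x \<oplus>\<^bsub>R\<^esub> y \<ominus>\<^bsub>R\<^esub> x \<ominus>\<^bsub>R\<^esub> y = \<zero>\<^bsub>R\<^esub>" "y \<ominus>\<^bsub>R\<^esub> y = \<zero>\<^bsub>R\<^esub>"
    if "x \<in> carrier R" "y \<in> carrier R" for x y
    using that P.a_comm[of x y] by (simp_all add: P.minus_eq P.a_assoc P.r_neg)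
  have h0: "h x = \<zero>\<^bsub>R\<^esub>" if "x \<in> N" for x
  proof -
    have "N \<subseteq> kernel F (add_monoid R) h"
      unfolding tensor_subgroup_def
      by (rule F.generate_subgroup_incl[OF _ h.subgroup_kernel])
        (use relators_closed in \<open>auto simp: kernel_def\<close>,
          auto simp: tensor_relators_def h_diff h_of' F_of F_diff P.lact_closed P.ract_closed Q.lact_closed
            add_left add_right balanced closed canc(1) canc(2)[OF P.zero_closed])
    then show ?thesis using that by (auto simp: kernel_def)
  qed
  have h_coset: "h x = h y" if "x \<in> N #>\<^bsub>F\<^esub> y" "y \<in> carrier F" for x y
    using that subgroup.mem_carrier[OF relators_subgroup] by (auto simp: r_coset_def F_mult h_add h0 h_cl)
  obtain \<psi> where \<psi>: "\<psi> \<in> hom (F Mod N) (add_monoid R)"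
    and \<psi>h: "\<And>x. x \<in> carrier F \<Longrightarrow> \<psi> (coset x) = h x"
  proof (rule FactGroup_universal[OF h relators_normal])
    fix x y assume "x \<in> carrier F" "y \<in> carrier F" "N #>\<^bsub>F\<^esub> x = N #>\<^bsub>F\<^esub> y"
    then show "h x = h y" using h_coset F.rcos_self[OF _ relators_subgroup] by metis
  qed (auto simp: tensor_coset_def)
  have hl: "h (frag_extend (\<lambda>(p, q). frag_of (r \<triangleright>\<^bsub>P\<^esub> p, q)) x) = r \<otimes>\<^bsub>R\<^esub> h x"
    if r: "r \<in> carrier R" and x: "x \<in> carrier F" for r x
    using x[unfolded F_carrier]
  proof (induction rule: free_Abelian_group_induct[consumes 1, case_names zero diff single])
    case (diff x y)
    have "x \<in> carrier F" "y \<in> carrier F" using diff by (simp_all add: F_carrier)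
    then show ?case
      using diff(3,4) r tensor_lact[OF r] by (simp add: frag_extend_diff h_diff h_cl P.minus_eq P.nu_r_distr P.nu_r_minus)
  next
    case (single a)
    then show ?case using r by (auto simp: h_of' P.lact_closed lact)
  qed (use r h0[OF subgroup.one_closed[OF relators_subgroup]] in \<open>simp add: tensor_free_def\<close>)
  have hr: "h (frag_extend (\<lambda>(p, q). frag_of (p, q \<triangleleft>\<^bsub>Q\<^esub> r)) x) = h x \<otimes>\<^bsub>R\<^esub> r"
    if r: "r \<in> carrier R" and x: "x \<in> carrier F" for r x
    using x[unfolded F_carrier]
  proof (induction rule: free_Abelian_group_induct[consumes 1, case_names zero diff single])
    case (diff x y)
    have "x \<in> carrier F" "y \<in> carrier F" using diff by (simp_all add: F_carrier)
    then show ?case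
      using diff(3,4) r tensor_ract[OF r] by (simp add: frag_extend_diff h_diff h_cl P.minus_eq P.nu_l_distr P.nu_l_minus)
  next
    case (single a)
    then show ?case using r by (auto simp: h_of' Q.ract_closed ract)
  qed (use r h0[OF subgroup.one_closed[OF relators_subgroup]] in \<open>simp add: tensor_free_def\<close>)
  have "\<psi> \<in> bimodule_hom R (tensor R P Q) (self_bimodule R)"
    unfolding bimodule_hom_def
  proof (intro CollectI conjI ballI)
    show "\<psi> \<in> add_hom (tensor R P Q) (self_bimodule R)"
      using \<psi> by (auto simp: add_hom_def hom_def tensor_def Let_def self_bimodule_def ring.defs)
    fix r x assume r: "r \<in> carrier R" and "x \<in> carrier (tensor R P Q)"
    then obtain y where y: "y \<in> carrier F" "x = coset y" by (auto simp: tensor_carrier)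
    show "\<psi> (r \<triangleright>\<^bsub>tensor R P Q\<^esub> x) = r \<triangleright>\<^bsub>self_bimodule R\<^esub> \<psi> x"
      using tensor_lact[OF r y(1)] y r by (simp add: \<psi>h hl self_bimodule_def ring.defs)
    show "\<psi> (x \<triangleleft>\<^bsub>tensor R P Q\<^esub> r) = \<psi> x \<triangleleft>\<^bsub>self_bimodule R\<^esub> r"
      using tensor_ract[OF r y(1)] y r by (simp add: \<psi>h hr self_bimodule_def ring.defs)
  qed
  moreover have "\<psi> (pure_tensor R P Q p q) = f p q" if "p \<in> carrier P" "q \<in> carrier Q" for p q
    using that by (simp add: pure_tensor_def \<psi>h F_of h_of')
  ultimately show thesis using that by blast
qed

end

section \<open>Finite rank endomorphisms\<close>

lemma add_end_simps:
  "\<zero>\<^bsub>add_end M\<^esub> = (\<lambda>x\<in>carrier M. \<zero>\<^bsub>M\<^esub>)"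
  "f \<oplus>\<^bsub>add_end M\<^esub> g = (\<lambda>x\<in>carrier M. f x \<oplus>\<^bsub>M\<^esub> g x)"
  "f \<otimes>\<^bsub>add_end M\<^esub> g = compose (carrier M) f g"
  "f \<in> carrier (add_end M) \<longleftrightarrow> f \<in> add_hom M M \<and> f \<in> extensional (carrier M)"
  by (auto simp: add_end_def)

lemma add_end_neg:
  assumes "abelian_group M" "f \<in> carrier (add_end M)"
  shows "(\<lambda>x\<in>carrier M. \<ominus>\<^bsub>M\<^esub> f x) \<in> carrier (add_end M)"
    "(\<lambda>x\<in>carrier M. \<ominus>\<^bsub>M\<^esub> f x) \<oplus>\<^bsub>add_end M\<^esub> f = \<zero>\<^bsub>add_end M\<^esub>"
proof -
  interpret abelian_group M by (rule assms)
  show "(\<lambda>x\<in>carrier M. \<ominus>\<^bsub>M\<^esub> f x) \<in> carrier (add_end M)"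
    using assms(2) by (auto simp: add_end_simps add_hom_def minus_add Pi_def)
  show "(\<lambda>x\<in>carrier M. \<ominus>\<^bsub>M\<^esub> f x) \<oplus>\<^bsub>add_end M\<^esub> f = \<zero>\<^bsub>add_end M\<^esub>"
    using assms(2) by (auto simp: add_end_simps add_hom_def l_neg Pi_def)
qed

lemma add_end_nu_ring:
  assumes "abelian_group M"
  shows "nu_ring (add_end M)"
proof -
  interpret M: abelian_group M by (rule assms)
  have ag: "abelian_group (add_end M)"
  proof (rule abelian_groupI)
    fix f assume "f \<in> carrier (add_end M)"
    then show "\<exists>g\<in>carrier (add_end M). g \<oplus>\<^bsub>add_end M\<^esub> f = \<zero>\<^bsub>add_end M\<^esub>"
      using add_end_neg[OF assms] by blast
  qed (auto simp: add_end_simps add_hom_def M.a_ac Pi_def restrict_def extensional_def)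
  then show ?thesis
    by (rule nu_ring.intro, unfold_locales)
      (auto simp: add_end_simps add_hom_def Pi_def compose_def restrict_def extensional_def)
qed

lemma add_end_minus:
  assumes "abelian_group M" "f \<in> carrier (add_end M)" "x \<in> carrier M"
  shows "(\<ominus>\<^bsub>add_end M\<^esub> f) x = \<ominus>\<^bsub>M\<^esub> f x"
proof -
  interpret E: nu_ring "add_end M" by (rule add_end_nu_ring) (rule assms)
  show ?thesis
    using E.minus_equality[OF add_end_neg(2)[OF assms(1,2)] assms(2) add_end_neg(1)[OF assms(1,2)]] assms(3)
    by simp
qed

sublocale r_system \<subseteq> bimodule_pair ..

context r_system
begin

abbreviation "tp \<equiv> pure_tensor R P Q"

lemma psi_simps:
  assumes "p \<in> carrier P" "q \<in> carrier Q"
  shows "p' \<in> carrier P \<Longrightarrow> \<psi> (tp (p \<oplus>\<^bsub>P\<^esub> p') q) = \<psi> (tp p q) \<oplus>\<^bsub>R\<^esub> \<psi> (tp p' q)"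
    and "q' \<in> carrier Q \<Longrightarrow> \<psi> (tp p (q \<oplus>\<^bsub>Q\<^esub> q')) = \<psi> (tp p q) \<oplus>\<^bsub>R\<^esub> \<psi> (tp p q')"
    and "r \<in> carrier R \<Longrightarrow> \<psi> (tp p (q \<triangleleft>\<^bsub>Q\<^esub> r)) = \<psi> (tp p q) \<otimes>\<^bsub>R\<^esub> r"
  using psi_hom assms pure_tensor_closed[OF assms, of R] pure_tensor_closed[OF _ assms(2), of p' P R]
    pure_tensor_closed[OF assms(1), of q' Q R]
  by (auto simp: pure_tensor_simps bimodule_hom_def add_hom_def self_bimodule_def ring.defs)

lemma theta_Q_closed:
  assumes "q \<in> carrier Q" "p \<in> carrier P"
  shows "theta_Q R P Q \<psi> q p \<in> carrier (add_end Q)"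
  using assms by (auto simp: theta_Q_def add_end_simps add_hom_def psi_pure_closed psi_simps
      Q.ract_closed Q.ract_add_right)

lemma theta_P_closed:
  assumes "p \<in> carrier P" "q \<in> carrier Q"
  shows "theta_P R P Q \<psi> p q \<in> carrier (add_end P)"
  using assms by (auto simp: theta_P_def add_end_simps add_hom_def psi_pure_closed psi_simps
      P.lact_closed P.lact_add_left)

text \<open>Right linearity of \<psi> is the reason. Composition thus preserves operators of rank
  one, and the right-hand side is the pattern that T(q) S(p) T(q') S(p') follows in a covariant
  representation.\<close>

lemma theta_Q_mult:
  assumes "q \<in> carrier Q" "p \<in> carrier P" "q' \<in> carrier Q" "p' \<in> carrier P"
  shows "theta_Q R P Q \<psi> q p \<otimes>\<^bsub>add_end Q\<^esub> theta_Q R P Q \<psi> q' p' =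
    theta_Q R P Q \<psi> (q \<triangleleft>\<^bsub>Q\<^esub> \<psi> (tp p q')) p'"
  using assms
  by (auto simp: theta_Q_def add_end_simps compose_def psi_pure_closed psi_simps Q.ract_closed
      Q.ract_mult intro!: restrict_ext)

lemma F_PQ_subgroup: "additive_subgroup (F_PQ R P Q \<psi>) (add_end Q)"
proof -
  interpret E: nu_ring "add_end Q" by (rule add_end_nu_ring) unfold_locales
  show ?thesis
    unfolding F_PQ_def by (rule E.additive_span_subgroup) (auto simp: theta_Q_closed)
qed

lemma F_QP_subgroup: "additive_subgroup (F_QP R P Q \<psi>) (add_end P)"
proof -
  interpret E: nu_ring "add_end P" by (rule add_end_nu_ring) unfold_locales
  show ?thesis
    unfolding F_QP_def by (rule E.additive_span_subgroup) (auto simp: theta_P_closed)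
qed

end

text \<open>Under (FS) this relation is single-valued, so that it is the graph of \<open>cp_pi\<close>.\<close>

inductive pi_graph ::
  "'r ring \<Rightarrow> ('r, 'p) bimodule \<Rightarrow> ('r, 'q) bimodule \<Rightarrow> (('p, 'q) tens \<Rightarrow> 'r) \<Rightarrow>
   ('q \<Rightarrow> 'b) \<Rightarrow> ('p \<Rightarrow> 'b) \<Rightarrow> 'b ring \<Rightarrow> ('q \<Rightarrow> 'q) \<Rightarrow> 'b \<Rightarrow> bool"
  for R P Q \<psi> T S B where
  theta: "q \<in> carrier Q \<Longrightarrow> p \<in> carrier P \<Longrightarrow> pi_graph R P Q \<psi> T S B (theta_Q R P Q \<psi> q p) (T q \<otimes>\<^bsub>B\<^esub> S p)"
| zero: "pi_graph R P Q \<psi> T S B \<zero>\<^bsub>add_end Q\<^esub> \<zero>\<^bsub>B\<^esub>"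
| neg: "pi_graph R P Q \<psi> T S B \<Theta> b \<Longrightarrow> pi_graph R P Q \<psi> T S B (\<ominus>\<^bsub>add_end Q\<^esub> \<Theta>) (\<ominus>\<^bsub>B\<^esub> b)"
| add: "pi_graph R P Q \<psi> T S B \<Theta> b \<Longrightarrow> pi_graph R P Q \<psi> T S B \<Theta>' b' \<Longrightarrow>
    pi_graph R P Q \<psi> T S B (\<Theta> \<oplus>\<^bsub>add_end Q\<^esub> \<Theta>') (b \<oplus>\<^bsub>B\<^esub> b')"

section \<open>Covariant representations and the homomorphism \<open>cp_pi\<close>\<close>

locale covariant_representation = r_system R P Q \<psi> + B: nu_ring B
  for R :: "'r ring" and P :: "('r, 'p) bimodule" and Q :: "('r, 'q) bimodule"
    and \<psi> :: "('p, 'q) tens \<Rightarrow> 'r"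
    and S :: "'p \<Rightarrow> 'b" and T :: "'q \<Rightarrow> 'b" and \<sigma> :: "'r \<Rightarrow> 'b" and B :: "'b ring" +
  assumes covariant: "covariant_rep R P Q \<psi> S T \<sigma> B"
begin

lemma S_hom: "S \<in> add_hom P B" and T_hom: "T \<in> add_hom Q B" and \<sigma>_hom: "\<sigma> \<in> nu_ring_hom R B"
  using covariant by (auto simp: covariant_rep_def)

lemma S_closed: "p \<in> carrier P \<Longrightarrow> S p \<in> carrier B"
  and T_closed: "q \<in> carrier Q \<Longrightarrow> T q \<in> carrier B"
  and \<sigma>_closed: "r \<in> carrier R \<Longrightarrow> \<sigma> r \<in> carrier B"
  using S_hom T_hom \<sigma>_hom by (auto simp: add_hom_def nu_ring_hom_def)

lemmas ST_closed = S_closed T_closed \<sigma>_closed B.nu_m_closed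

lemma S_act: "p \<in> carrier P \<Longrightarrow> r \<in> carrier R \<Longrightarrow> S (p \<triangleleft>\<^bsub>P\<^esub> r) = S p \<otimes>\<^bsub>B\<^esub> \<sigma> r"
    "p \<in> carrier P \<Longrightarrow> r \<in> carrier R \<Longrightarrow> S (r \<triangleright>\<^bsub>P\<^esub> p) = \<sigma> r \<otimes>\<^bsub>B\<^esub> S p"
  and T_act: "q \<in> carrier Q \<Longrightarrow> r \<in> carrier R \<Longrightarrow> T (q \<triangleleft>\<^bsub>Q\<^esub> r) = T q \<otimes>\<^bsub>B\<^esub> \<sigma> r"
    "q \<in> carrier Q \<Longrightarrow> r \<in> carrier R \<Longrightarrow> T (r \<triangleright>\<^bsub>Q\<^esub> q) = \<sigma> r \<otimes>\<^bsub>B\<^esub> T q"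
  and \<sigma>_psi: "p \<in> carrier P \<Longrightarrow> q \<in> carrier Q \<Longrightarrow> \<sigma> (\<psi> (tp p q)) = S p \<otimes>\<^bsub>B\<^esub> T q"
  using covariant by (auto simp: covariant_rep_def)

lemma S_zero: "S \<zero>\<^bsub>P\<^esub> = \<zero>\<^bsub>B\<^esub>" and T_zero: "T \<zero>\<^bsub>Q\<^esub> = \<zero>\<^bsub>B\<^esub>"
  by (rule add_hom_zero, unfold_locales, rule S_hom, rule add_hom_zero, unfold_locales, rule T_hom)

lemma S_minus: "p \<in> carrier P \<Longrightarrow> S (\<ominus>\<^bsub>P\<^esub> p) = \<ominus>\<^bsub>B\<^esub> S p"
  by (rule add_hom_minus, unfold_locales, rule S_hom)

lemma T_minus: "q \<in> carrier Q \<Longrightarrow> T (\<ominus>\<^bsub>Q\<^esub> q) = \<ominus>\<^bsub>B\<^esub> T q"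
  by (rule add_hom_minus, unfold_locales, rule T_hom)

abbreviation "graph \<equiv> pi_graph R P Q \<psi> T S B"

lemma add_end_Q_ring: "nu_ring (add_end Q)" and add_end_P_ring: "nu_ring (add_end P)"
  by (rule add_end_nu_ring, rule Q.M.abelian_group_axioms, rule add_end_nu_ring, rule P.M.abelian_group_axioms)

lemma graph_closed:
  assumes "graph \<Theta> b"
  shows "\<Theta> \<in> F_PQ R P Q \<psi> \<and> b \<in> carrier B"
proof -
  interpret E: nu_ring "add_end Q" by (rule add_end_Q_ring)
  interpret FP: additive_subgroup "F_PQ R P Q \<psi>" "add_end Q" by (rule F_PQ_subgroup)
  show ?thesis
    using assms
  proof induction
    case (theta q p)
    then show ?case by (auto simp: F_PQ_def ST_closed intro: generate.incl)
  next
    case (neg \<Theta> b)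
    then show ?case using FP.a_inv_closed[of \<Theta>] E.abelian_group_axioms by blast
  qed auto
qed

lemma F_PQ_closed: "\<Theta> \<in> F_PQ R P Q \<psi> \<Longrightarrow> \<Theta> \<in> carrier (add_end Q)"
  using additive_subgroup.a_subset[OF F_PQ_subgroup] by auto

text \<open>The relation has a clause for each way of generating \<open>F_PQ\<close>, which makes it
  total; inverses of generators become negatives.\<close>

lemma F_PQ_graph:
  assumes "\<Theta> \<in> F_PQ R P Q \<psi>"
  shows "\<exists>b. graph \<Theta> b"
  using assms unfolding F_PQ_def
proof induction
  case one
  show ?case using pi_graph.zero[of R P Q \<psi> T S B] by auto
next
  case (incl h)
  then show ?case by (auto intro: pi_graph.theta)
next
  case (inv h)
  then obtain b where "graph h b" by (auto intro: pi_graph.theta)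
  then show ?case using pi_graph.neg[of R P Q \<psi> T S B h b] by (auto simp: a_inv_def)
next
  case (eng h1 h2)
  then show ?case using pi_graph.add[of R P Q \<psi> T S B] by fastforce
qed

text \<open>Left multiplication by \<open>b\<close> implements \<open>\<Theta>\<close> on the image
  of \<open>Q\<close>. Hence two values related to one \<open>\<Theta>\<close> differ by an element
  that annihilates the image of \<open>T\<close> from the left, and only such elements can spoil
  uniqueness.\<close>

lemma graph_act:
  assumes "graph \<Theta> b" "x \<in> carrier Q"
  shows "T (\<Theta> x) = b \<otimes>\<^bsub>B\<^esub> T x"
  using assms(1)
proof induction
  case (theta q p)
  then show ?case
    using assms(2) by (simp add: theta_Q_def T_act psi_pure_closed \<sigma>_psi ST_closed B.nu_m_assoc)
next
  case zero
  then show ?case using assms(2) by (simp add: add_end_simps T_zero ST_closed)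
next
  case (neg \<Theta> b)
  from graph_closed[OF neg(1)] have "\<Theta> \<in> carrier (add_end Q)" "b \<in> carrier B"
    by (auto dest: F_PQ_closed)
  moreover from this have "\<Theta> x \<in> carrier Q" using assms(2) by (auto simp: add_end_simps add_hom_def)
  ultimately show ?case
    using neg assms(2) by (simp add: add_end_minus Q.M.abelian_group_axioms T_minus B.nu_l_minus ST_closed)
next
  case (add \<Theta> b \<Theta>' b')
  from graph_closed[OF add(1)] graph_closed[OF add(2)]
  have *: "\<Theta> \<in> carrier (add_end Q)" "b \<in> carrier B" "\<Theta>' \<in> carrier (add_end Q)" "b' \<in> carrier B"
    by (auto dest: F_PQ_closed)
  moreover from this have "\<Theta> x \<in> carrier Q" "\<Theta>' x \<in> carrier Q"
    using assms(2) by (auto simp: add_end_simps add_hom_def)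
  ultimately show ?case
    using add assms(2) by (simp add: add_end_simps(2) add_homD[OF T_hom] B.nu_l_distr ST_closed)
qed

text \<open>Induction on one argument at a time reduces the claim to two operators of rank one,
  where \<open>theta_Q_mult\<close> mirrors the covariance relations.\<close>

lemma graph_mult:
  assumes "graph \<Theta> b" "graph \<Theta>' b'"
  shows "graph (\<Theta> \<otimes>\<^bsub>add_end Q\<^esub> \<Theta>') (b \<otimes>\<^bsub>B\<^esub> b')"
proof -
  interpret E: nu_ring "add_end Q" by (rule add_end_Q_ring)
  have cl: "\<Theta> \<in> carrier (add_end Q)" "b \<in> carrier B" if "graph \<Theta> b" for \<Theta> b
    using graph_closed[OF that] F_PQ_closed by auto
  have 1: "graph (theta_Q R P Q \<psi> q p \<otimes>\<^bsub>add_end Q\<^esub> \<Theta>') (T q \<otimes>\<^bsub>B\<^esub> S p \<otimes>\<^bsub>B\<^esub> b')"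
    if "q \<in> carrier Q" "p \<in> carrier P" for q p
    using assms(2)
  proof induction
    case (theta q' p')
    have "T q \<otimes>\<^bsub>B\<^esub> S p \<otimes>\<^bsub>B\<^esub> (T q' \<otimes>\<^bsub>B\<^esub> S p') = T (q \<triangleleft>\<^bsub>Q\<^esub> \<psi> (tp p q')) \<otimes>\<^bsub>B\<^esub> S p'"
      using theta that by (simp add: T_act psi_pure_closed \<sigma>_psi ST_closed B.nu_m_assoc)
    then show ?case
      using theta that by (auto simp: theta_Q_mult psi_pure_closed Q.ract_closed intro!: pi_graph.theta)
  next
    case zero
    show ?case using that pi_graph.zero[of R P Q \<psi> T S B] by (simp add: theta_Q_closed ST_closed)
  next
    case (neg \<Theta>' b')
    then show ?case using that cl[OF neg(1)] pi_graph.neg[OF neg(2)]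
      by (simp add: theta_Q_closed ST_closed E.nu_r_minus B.nu_r_minus)
  next
    case (add \<Theta>1 b1 \<Theta>2 b2)
    then show ?case using that cl[OF add(1)] cl[OF add(2)] pi_graph.add[OF add(3,4)]
      by (simp add: theta_Q_closed ST_closed E.nu_r_distr B.nu_r_distr)
  qed
  show ?thesis
    using assms(1)
  proof induction
    case (theta q p)
    then show ?case by (rule 1)
  next
    case zero
    show ?case using pi_graph.zero[of R P Q \<psi> T S B] cl[OF assms(2)] by simp
  next
    case (neg \<Theta> b)
    then show ?case using cl[OF neg(1)] cl[OF assms(2)] pi_graph.neg[OF neg(2)]
      by (simp add: E.nu_l_minus B.nu_l_minus)
  next
    case (add \<Theta>1 b1 \<Theta>2 b2)
    then show ?case using cl[OF add(1)] cl[OF add(2)] cl[OF assms(2)] pi_graph.add[OF add(3,4)]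
      by (simp add: E.nu_l_distr B.nu_l_distr)
  qed
qed

text \<open>The counterpart on the other side: the operator \<open>theta_P R P Q \<psi> p q\<close>
  sends y to \<psi>(y, q) p and so becomes right multiplication by T(q) S(p). Through this (FS)
  provides right units for finitely many elements S(p), located in the span of the products T(q)
  S(p).\<close>

lemma F_QP_act:
  assumes "\<Phi> \<in> F_QP R P Q \<psi>"
  shows "\<exists>e\<in>generate (add_monoid B) {T q \<otimes>\<^bsub>B\<^esub> S p | q p. q \<in> carrier Q \<and> p \<in> carrier P}.
    \<forall>y\<in>carrier P. S (\<Phi> y) = S y \<otimes>\<^bsub>B\<^esub> e"
proof -
  interpret E: nu_ring "add_end P" by (rule add_end_P_ring)
  let ?X = "{T q \<otimes>\<^bsub>B\<^esub> S p | q p. q \<in> carrier Q \<and> p \<in> carrier P}"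
  define L where "L = generate (add_monoid B) ?X"
  interpret L: additive_subgroup L B
    unfolding L_def by (rule B.additive_span_subgroup) (auto simp: ST_closed)
  have Lc: "e \<in> carrier B" if "e \<in> L" for e
    using that L.a_subset by auto
  have LI: "T q \<otimes>\<^bsub>B\<^esub> S p \<in> L" if "q \<in> carrier Q" "p \<in> carrier P" for q p
    unfolding L_def by (rule generate.incl) (use that in blast)
  have th: "\<exists>e\<in>L. \<forall>y\<in>carrier P. S (theta_P R P Q \<psi> p q y) = S y \<otimes>\<^bsub>B\<^esub> e"
    if "p \<in> carrier P" "q \<in> carrier Q" for p q
    by (rule bexI[of _ "T q \<otimes>\<^bsub>B\<^esub> S p"])
      (use that in \<open>auto simp: theta_P_def S_act psi_pure_closed \<sigma>_psi ST_closed B.nu_m_assoc LI\<close>)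
  have sub: "\<Phi> \<in> carrier (add_end P)" if "\<Phi> \<in> F_QP R P Q \<psi>" for \<Phi>
    using that additive_subgroup.a_subset[OF F_QP_subgroup] by auto
  have app: "\<Phi> y \<in> carrier P" if "\<Phi> \<in> carrier (add_end P)" "y \<in> carrier P" for \<Phi> y
    using that by (auto simp: add_end_simps add_hom_def)
  let ?H = "{\<Phi> \<in> carrier (add_end P).
    \<exists>e\<in>L. \<forall>y\<in>carrier P. S (\<Phi> y) = S y \<otimes>\<^bsub>B\<^esub> e}"
  have "additive_subgroup ?H (add_end P)"
  proof (rule E.additive_subgroupI)
    show "\<zero>\<^bsub>add_end P\<^esub> \<in> ?H"
      using L.zero_closed by (auto simp: add_end_simps(1) S_zero ST_closed E.zero_closed[unfolded add_end_simps(1)]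
          intro!: bexI[of _ "\<zero>\<^bsub>B\<^esub>"])
  next
    fix \<Phi> assume "\<Phi> \<in> ?H"
    then obtain e where "\<Phi> \<in> carrier (add_end P)" "e \<in> L"
      "\<And>y. y \<in> carrier P \<Longrightarrow> S (\<Phi> y) = S y \<otimes>\<^bsub>B\<^esub> e" by blast
    then show "\<ominus>\<^bsub>add_end P\<^esub> \<Phi> \<in> ?H"
      by (auto simp: add_end_minus P.M.abelian_group_axioms S_minus app B.nu_r_minus ST_closed Lc
          intro!: bexI[of _ "\<ominus>\<^bsub>B\<^esub> e"] L.a_inv_closed)
  next
    fix \<Phi> \<Phi>' assume "\<Phi> \<in> ?H" "\<Phi>' \<in> ?H"
    then obtain e e' where "\<Phi> \<in> carrier (add_end P)" "e \<in> L"
      "\<And>y. y \<in> carrier P \<Longrightarrow> S (\<Phi> y) = S y \<otimes>\<^bsub>B\<^esub> e"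
      "\<Phi>' \<in> carrier (add_end P)" "e' \<in> L"
      "\<And>y. y \<in> carrier P \<Longrightarrow> S (\<Phi>' y) = S y \<otimes>\<^bsub>B\<^esub> e'" by blast
    then show "\<Phi> \<oplus>\<^bsub>add_end P\<^esub> \<Phi>' \<in> ?H"
      using E.a_closed[of \<Phi> \<Phi>']
      by (auto simp: add_end_simps(2) app add_homD[OF S_hom] B.nu_r_distr ST_closed Lc
          intro!: bexI[of _ "e \<oplus>\<^bsub>B\<^esub> e'"])
  qed (rule Collect_restrict)
  then have "F_QP R P Q \<psi> \<subseteq> ?H"
    unfolding F_QP_def by (rule E.additive_span_minimal[rotated]) (use th in \<open>auto simp: theta_P_closed\<close>)
  with assms show ?thesis by (auto simp: L_def)
qed

lemma graph_span:
  assumes "graph \<Theta> b"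
  shows "b \<in> product_span B (T ` carrier Q) (S ` carrier P)"
proof -
  interpret additive_subgroup "product_span B (T ` carrier Q) (S ` carrier P)" B
    by (rule B.product_span_subgroup) (auto simp: ST_closed)
  show ?thesis
    using assms by induction (auto intro: product_span_incl)
qed

text \<open>An element of the span of \<open>T Q S P\<close> is fixed from the right by every element that fixes the
  finitely many \<open>S p\<close> occurring in it, hence it vanishes as soon as it annihilates \<open>T Q\<close> from the
  left.\<close>

lemma graph_zero:
  assumes FS: "condition_FS R P Q \<psi>" and b: "graph \<zero>\<^bsub>add_end Q\<^esub> b"
  shows "b = \<zero>\<^bsub>B\<^esub>"
proof -
  let ?X = "{T q \<otimes>\<^bsub>B\<^esub> S p | q p. q \<in> carrier Q \<and> p \<in> carrier P}"
  have bc: "b \<in> carrier B" using graph_closed[OF b] by simp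
  obtain F where F: "finite F" "F \<subseteq> S ` carrier P"
    and fixed: "\<forall>e\<in>carrier B. (\<forall>y\<in>F. y \<otimes>\<^bsub>B\<^esub> e = y) \<longrightarrow> b \<otimes>\<^bsub>B\<^esub> e = b"
  proof -
    have "T ` carrier Q \<subseteq> carrier B" "S ` carrier P \<subseteq> carrier B" by (auto simp: ST_closed)
    from B.product_span_fixed[OF this graph_span[OF b]] show ?thesis using that by blast
  qed
  then obtain F' where F': "finite F'" "F' \<subseteq> carrier P" "F = S ` F'" by (meson finite_subset_image)
  obtain \<Phi> where \<Phi>: "\<Phi> \<in> F_QP R P Q \<psi>" "\<And>p. p \<in> F' \<Longrightarrow> \<Phi> p = p"
    using FS F' unfolding condition_FS_def by (metis empty_subsetI finite.emptyI)
  obtain e where e: "e \<in> generate (add_monoid B) ?X" "\<And>y. y \<in> carrier P \<Longrightarrow> S (\<Phi> y) = S y \<otimes>\<^bsub>B\<^esub> e"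
    using F_QP_act[OF \<Phi>(1)] by blast
  have bT: "b \<otimes>\<^bsub>B\<^esub> T q = \<zero>\<^bsub>B\<^esub>" if "q \<in> carrier Q" for q
    using graph_act[OF b that] that by (simp add: add_end_simps T_zero)
  have "generate (add_monoid B) ?X \<subseteq> {x \<in> carrier B. b \<otimes>\<^bsub>B\<^esub> x = \<zero>\<^bsub>B\<^esub>}"
    by (rule B.additive_span_minimal)
      (auto simp: ST_closed bT bc B.nu_m_assoc[symmetric] B.nu_r_minus B.nu_r_distr intro!: B.additive_subgroupI)
  with e(1) have "e \<in> carrier B" "b \<otimes>\<^bsub>B\<^esub> e = \<zero>\<^bsub>B\<^esub>" by auto
  moreover have "b \<otimes>\<^bsub>B\<^esub> e = b"
  proof (rule fixed[rule_format])
    fix y assume "y \<in> F"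
    then obtain p where "p \<in> F'" "y = S p" using F'(3) by auto
    then show "y \<otimes>\<^bsub>B\<^esub> e = y" using e(2)[of p] \<Phi>(2)[of p] F'(2) by auto
  qed (fact \<open>e \<in> carrier B\<close>)
  ultimately show ?thesis by simp
qed

lemma graph_unique:
  assumes FS: "condition_FS R P Q \<psi>" and "graph \<Theta> b" "graph \<Theta> b'"
  shows "b = b'"
proof -
  interpret E: nu_ring "add_end Q" by (rule add_end_Q_ring)
  have cl: "\<Theta> \<in> carrier (add_end Q)" "b \<in> carrier B" "b' \<in> carrier B"
    using graph_closed assms(2,3) F_PQ_closed by auto
  have "graph (\<Theta> \<oplus>\<^bsub>add_end Q\<^esub> \<ominus>\<^bsub>add_end Q\<^esub> \<Theta>) (b \<oplus>\<^bsub>B\<^esub> \<ominus>\<^bsub>B\<^esub> b')"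
    using assms by (intro pi_graph.add pi_graph.neg)
  then have "b \<oplus>\<^bsub>B\<^esub> \<ominus>\<^bsub>B\<^esub> b' = \<zero>\<^bsub>B\<^esub>"
    using graph_zero[OF FS] cl by (simp add: E.r_neg)
  then show ?thesis
    using cl B.minus_equality B.minus_minus by (metis B.a_inv_closed)
qed

text \<open>\<open>cp_pi\<close> is a definite description, so the relation \<open>pi_graph\<close>
  is first turned into a function with the required properties. No other function qualifies, because
  a homomorphism with the prescribed values on the operators \<open>theta_Q\<close> respects every
  clause of the relation.\<close>

theorem cp_pi_hom:
  assumes FS: "condition_FS R P Q \<psi>"
  shows "cp_pi R P Q \<psi> T S B \<in> nu_ring_hom (add_end Q\<lparr>carrier := F_PQ R P Q \<psi>\<rparr>) B"
    and "\<And>q p. q \<in> carrier Q \<Longrightarrow> p \<in> carrier P \<Longrightarrow>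
      cp_pi R P Q \<psi> T S B (theta_Q R P Q \<psi> q p) = T q \<otimes>\<^bsub>B\<^esub> S p"
proof -
  interpret E: nu_ring "add_end Q" by (rule add_end_Q_ring)
  interpret FP: additive_subgroup "F_PQ R P Q \<psi>" "add_end Q" by (rule F_PQ_subgroup)
  let ?A = "add_end Q\<lparr>carrier := F_PQ R P Q \<psi>\<rparr>"
  let ?good = "\<lambda>\<pi>. \<pi> \<in> extensional (F_PQ R P Q \<psi>) \<and> \<pi> \<in> nu_ring_hom ?A B \<and>
     (\<forall>q \<in> carrier Q. \<forall>p \<in> carrier P. \<pi> (theta_Q R P Q \<psi> q p) = T q \<otimes>\<^bsub>B\<^esub> S p)"
  define \<pi> where "\<pi> = (\<lambda>\<Theta>\<in>F_PQ R P Q \<psi>. THE b. graph \<Theta> b)"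
  have \<pi>: "\<pi> \<Theta> = b" if "graph \<Theta> b" for \<Theta> b
    using that graph_unique[OF FS] graph_closed[OF that] by (auto simp: \<pi>_def)
  have "\<pi> \<in> nu_ring_hom ?A B"
  proof (rule nu_ring_homI)
    fix x assume "x \<in> carrier ?A"
    then obtain b where "graph x b" using F_PQ_graph by auto
    then show "\<pi> x \<in> carrier B" using \<pi> graph_closed by auto
  next
    fix x y assume "x \<in> carrier ?A" "y \<in> carrier ?A"
    then obtain b b' where g: "graph x b" "graph y b'" using F_PQ_graph by fastforce
    show "\<pi> (x \<oplus>\<^bsub>?A\<^esub> y) = \<pi> x \<oplus>\<^bsub>B\<^esub> \<pi> y"
      using \<pi>[OF g(1)] \<pi>[OF g(2)] \<pi>[OF pi_graph.add[OF g]] by simp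
    show "\<pi> (x \<otimes>\<^bsub>?A\<^esub> y) = \<pi> x \<otimes>\<^bsub>B\<^esub> \<pi> y"
      using \<pi>[OF g(1)] \<pi>[OF g(2)] \<pi>[OF graph_mult[OF g]] by simp
  qed
  then have good: "?good \<pi>"
    using \<pi> pi_graph.theta[of _ Q _ P R \<psi> T S B] by (auto simp: \<pi>_def)
  have uniq: "\<pi>' = \<pi>" if "?good \<pi>'" for \<pi>'
  proof (rule extensionalityI)
    fix \<Theta> assume "\<Theta> \<in> F_PQ R P Q \<psi>"
    then obtain b where "graph \<Theta> b" using F_PQ_graph by auto
    moreover have "\<pi>' \<Theta> = b" if "graph \<Theta> b" for \<Theta> b
      using that
    proof induction
      case zero
      show ?case
        using add_hom_zero[OF E.additive_subgroup_group[OF F_PQ_subgroup] B.abelian_group_axioms]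
          \<open>?good \<pi>'\<close> by (auto dest: nu_ring_hom_add_hom)
    next
      case (neg \<Theta> b)
      then show ?case
        using add_hom_minus[OF E.additive_subgroup_group[OF F_PQ_subgroup] B.abelian_group_axioms,
            of \<pi>' \<Theta>] \<open>?good \<pi>'\<close> graph_closed[OF neg(1)]
        by (auto simp: E.additive_subgroup_minus[OF F_PQ_subgroup] dest: nu_ring_hom_add_hom)
    next
      case (add \<Theta> b \<Theta>' b')
      then show ?case
        using \<open>?good \<pi>'\<close> graph_closed[OF add(1)] graph_closed[OF add(2)]
        by (auto simp: nu_ring_hom_def add_hom_def)
    qed (use \<open>?good \<pi>'\<close> in auto)
    ultimately show "\<pi>' \<Theta> = \<pi> \<Theta>" using \<pi> by auto
  qed (use that good in auto)
  have "cp_pi R P Q \<psi> T S B = \<pi>"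
    unfolding cp_pi_def by (rule the_equality) (use good uniq in blast)+
  with good show "cp_pi R P Q \<psi> T S B \<in> nu_ring_hom ?A B"
    and "\<And>q p. q \<in> carrier Q \<Longrightarrow> p \<in> carrier P \<Longrightarrow>
      cp_pi R P Q \<psi> T S B (theta_Q R P Q \<psi> q p) = T q \<otimes>\<^bsub>B\<^esub> S p"
    by auto
qed

end

section \<open>Graded rings with local units\<close>

text \<open>Directness of the grading is split into independence of finite families and spanning by
  homogeneous elements, the two forms in which injectivity and surjectivity onto \<open>A\<close>
  consume it.\<close>

locale graded_ring = nu_ring A for A :: "'a ring" (structure) +
  fixes deg :: "int \<Rightarrow> 'a set"
  assumes deg_subgroup: "additive_subgroup (deg n) A"
    and deg_mult: "x \<in> deg m \<Longrightarrow> y \<in> deg n \<Longrightarrow> x \<otimes> y \<in> deg (m + n)"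
    and deg_independent: "finite N \<Longrightarrow> (\<And>n. a n \<in> deg n) \<Longrightarrow> finsum A a N = \<zero> \<Longrightarrow> n \<in> N \<Longrightarrow> a n = \<zero>"
    and deg_span: "carrier A \<subseteq> generate (add_monoid A) (\<Union>n. deg n)"
begin

definition R0 :: "'a ring" where "R0 = A\<lparr>carrier := deg 0\<rparr>"

definition component :: "int \<Rightarrow> ('a, 'a) bimodule" where
  "component n = ring.extend (A\<lparr>carrier := deg n\<rparr>) \<lparr>lact = (\<otimes>), ract = (\<otimes>)\<rparr>"

lemma R0_simps [simp]:
  "carrier R0 = deg 0" "x \<otimes>\<^bsub>R0\<^esub> y = x \<otimes> y" "x \<oplus>\<^bsub>R0\<^esub> y = x \<oplus> y" "\<zero>\<^bsub>R0\<^esub> = \<zero>"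
  by (simp_all add: R0_def)

lemma component_simps [simp]:
  "carrier (component n) = deg n" "x \<oplus>\<^bsub>component n\<^esub> y = x \<oplus> y" "\<zero>\<^bsub>component n\<^esub> = \<zero>"
  "r \<triangleright>\<^bsub>component n\<^esub> x = r \<otimes> x" "x \<triangleleft>\<^bsub>component n\<^esub> r = x \<otimes> r"
  by (simp_all add: component_def ring.defs)

lemma deg_carrier: "x \<in> deg n \<Longrightarrow> x \<in> carrier A"
  using additive_subgroup.a_subset[OF deg_subgroup] by blast

lemma deg_zero [simp]: "\<zero> \<in> deg n"
  by (rule additive_subgroup.zero_closed[OF deg_subgroup])

lemma deg_add: "x \<in> deg n \<Longrightarrow> y \<in> deg n \<Longrightarrow> x \<oplus> y \<in> deg n"
  by (rule additive_subgroup.a_closed[OF deg_subgroup])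

lemma deg_minus: "x \<in> deg n \<Longrightarrow> \<ominus> x \<in> deg n"
  by (rule additive_subgroup.a_inv_closed[OF deg_subgroup])

lemma deg_mult_eq: "x \<in> deg m \<Longrightarrow> y \<in> deg n \<Longrightarrow> k = m + n \<Longrightarrow> x \<otimes> y \<in> deg k"
  using deg_mult by simp

lemma deg_act: "r \<in> deg 0 \<Longrightarrow> x \<in> deg n \<Longrightarrow> r \<otimes> x \<in> deg n" "r \<in> deg 0 \<Longrightarrow> x \<in> deg n \<Longrightarrow> x \<otimes> r \<in> deg n"
  by (auto intro: deg_mult_eq)

lemma R0_nu_ring: "nu_ring R0"
proof -
  have "abelian_group R0"
    unfolding R0_def by (rule additive_subgroup_group[OF deg_subgroup])
  then show ?thesis
    by (rule nu_ring.intro, unfold_locales)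
      (simp_all add: nu_m_assoc nu_l_distr nu_r_distr deg_carrier deg_act)
qed

lemma component_group: "abelian_group (component n)"
proof (rule abelian_groupI)
  fix x assume "x \<in> carrier (component n)"
  then show "\<exists>y\<in>carrier (component n). y \<oplus>\<^bsub>component n\<^esub> x = \<zero>\<^bsub>component n\<^esub>"
    by (auto intro!: bexI[of _ "\<ominus> x"] simp: l_neg deg_minus deg_carrier)
qed (auto simp: a_ac deg_add deg_carrier)

lemma component_minus: "x \<in> deg n \<Longrightarrow> \<ominus>\<^bsub>component n\<^esub> x = \<ominus> x"
  by (rule abelian_group.minus_equality[OF component_group]) (simp_all add: l_neg deg_minus deg_carrier)

lemma component_bimodule: "bimodule R0 (component n)"
proof -
  interpret R0: nu_ring R0 by (rule R0_nu_ring)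
  interpret M: abelian_group "component n" by (rule component_group)
  show ?thesis
    by unfold_locales (simp_all add: nu_m_assoc nu_l_distr nu_r_distr deg_carrier deg_act)
qed

end

text \<open>\<open>left_unit\<close> and the case \<open>n = - 1\<close> of
  \<open>right_unit\<close> give (FS); \<open>right_unit\<close> in all nonzero degrees drives the
  inductions on the degree; \<open>annihilator_unit\<close> is the source of maximality of
  \<open>L\<close>. The asymmetry reflects that words grow on the right: units are wanted on the
  right in every nonzero degree, on the left only in degree \<open>1\<close>.\<close>

locale locally_unital_graded_ring = graded_ring +
  assumes left_unit: "finite F \<Longrightarrow> F \<subseteq> deg 1 \<Longrightarrow>
      \<exists>e\<in>product_span A (deg 1) (deg (- 1)). \<forall>f\<in>F. e \<otimes> f = f"
    and right_unit: "n \<noteq> 0 \<Longrightarrow> finite F \<Longrightarrow> F \<subseteq> deg n \<Longrightarrow>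
      \<exists>e\<in>product_span A (deg (- sgn n)) (deg (sgn n)). \<forall>f\<in>F. f \<otimes> e = f"
    and annihilator_unit: "h \<in> deg 0 \<Longrightarrow> (\<And>q. q \<in> deg 1 \<Longrightarrow> h \<otimes> q = \<zero>) \<Longrightarrow>
      \<exists>v\<in>deg 0. h \<otimes> v = h \<and> (\<forall>p\<in>deg (- 1). p \<otimes> v = \<zero>)"
begin

abbreviation "P \<equiv> component (- 1)"
abbreviation "Q \<equiv> component 1"

definition L where "L = product_span A (deg 1) (deg (- 1))"

lemma span_deg0:
  assumes "m + n = 0"
  shows "product_span A (deg m) (deg n) \<subseteq> deg 0"
  by (rule product_span_minimal[OF deg_subgroup]) (use assms in \<open>auto intro: deg_mult_eq\<close>)

lemma span_subgroup: "additive_subgroup (product_span A (deg m) (deg n)) A"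
  by (rule product_span_subgroup) (auto intro: deg_carrier)

lemma L_deg0: "x \<in> L \<Longrightarrow> x \<in> deg 0"
  using span_deg0[of 1 "- 1"] by (auto simp: L_def)

lemma L_subgroup: "additive_subgroup L A"
  unfolding L_def by (rule span_subgroup)

lemma R0_group: "abelian_group R0"
  unfolding R0_def by (rule additive_subgroup_group[OF deg_subgroup])

lemma R0_minus: "x \<in> deg 0 \<Longrightarrow> \<ominus>\<^bsub>R0\<^esub> x = \<ominus> x"
  unfolding R0_def by (rule additive_subgroup_minus[OF deg_subgroup])

text \<open>By associativity and distributivity the product of \<open>A\<close> is balanced and
  linear over degree \<open>0\<close>, so it descends to the tensor product.\<close>

lemma product_pairing_ex:
  "\<exists>\<psi>\<in>bimodule_hom R0 (tensor R0 P Q) (self_bimodule R0).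
    \<forall>p\<in>deg (- 1). \<forall>q\<in>deg 1. \<psi> (pure_tensor R0 P Q p q) = p \<otimes> q"
proof -
  interpret bimodule_pair R0 P Q
    unfolding bimodule_pair_def by (simp add: component_bimodule)
  obtain \<psi> where "\<psi> \<in> bimodule_hom R0 (tensor R0 P Q) (self_bimodule R0)"
    "\<And>p q. p \<in> carrier P \<Longrightarrow> q \<in> carrier Q \<Longrightarrow> \<psi> (pure_tensor R0 P Q p q) = p \<otimes> q"
    by (rule tensor_lift[of "(\<otimes>)"])
      (auto simp: nu_m_assoc nu_l_distr nu_r_distr deg_carrier intro: deg_mult_eq)
  then show ?thesis by auto
qed

end

section \<open>The system of a graded ring and its maximal faithful ideal\<close>

locale graded_ring_system = locally_unital_graded_ring +
  fixes \<psi> :: "('a, 'a) tens \<Rightarrow> 'a"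
  assumes psi: "\<psi> \<in> bimodule_hom R0 (tensor R0 P Q) (self_bimodule R0)"
    and psi_pure: "p \<in> deg (- 1) \<Longrightarrow> q \<in> deg 1 \<Longrightarrow> \<psi> (pure_tensor R0 P Q p q) = p \<otimes> q"
begin

sublocale rs: r_system R0 P Q \<psi>
  unfolding r_system_def r_system_axioms_def by (simp add: component_bimodule psi)

lemma theta_Q_eq_Delta:
  assumes "q \<in> deg 1" "p \<in> deg (- 1)"
  shows "theta_Q R0 P Q \<psi> q p = Delta Q (q \<otimes> p)"
  using assms unfolding theta_Q_def Delta_def
  by (intro restrict_ext) (simp add: psi_pure nu_m_assoc deg_carrier)

lemma Delta_hom: "Delta Q \<in> add_hom R0 (add_end Q)"
  by (auto simp: add_hom_def add_end_simps Delta_def nu_l_distr nu_r_distr deg_carrier deg_add deg_act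
      intro!: restrict_ext)

lemma Delta_eq_iff: "Delta Q r = Delta Q s \<longleftrightarrow> (\<forall>q\<in>deg 1. r \<otimes> q = s \<otimes> q)"
  by (auto simp: Delta_def fun_eq_iff restrict_def)

lemma ker_Delta_eq: "ker_Delta R0 Q = {r \<in> deg 0. \<forall>q\<in>deg 1. r \<otimes> q = \<zero>}"
  by (auto simp: ker_Delta_def Delta_def add_end_simps fun_eq_iff restrict_def)

lemma add_end_Q_ring: "nu_ring (add_end Q)" and add_end_P_ring: "nu_ring (add_end P)"
  by (simp_all add: add_end_nu_ring component_group)

text \<open>\<open>Delta Q\<close> is additive and matches the generators q p of \<open>L\<close>
  with the operators \<open>theta_Q\<close>, so each inclusion is minimality of one span: against
  the image of \<open>L\<close> in one direction, against the preimage of \<open>F_PQ\<close> in the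
  other.\<close>

lemma F_PQ_eq: "F_PQ R0 P Q \<psi> = Delta Q ` L"
proof
  interpret E: nu_ring "add_end Q" by (rule add_end_Q_ring)
  interpret L: additive_subgroup L A by (rule L_subgroup)
  note D0 = add_hom_zero[OF R0_group E.abelian_group_axioms Delta_hom]
  note Dm = add_hom_minus[OF R0_group E.abelian_group_axioms Delta_hom]
  have Da: "Delta Q x \<oplus>\<^bsub>add_end Q\<^esub> Delta Q y = Delta Q (x \<oplus> y)" if "x \<in> deg 0" "y \<in> deg 0" for x y
    using add_hom_add[OF Delta_hom, of x y] that by simp
  have Dc: "Delta Q x \<in> carrier (add_end Q)" if "x \<in> deg 0" for x
    using add_hom_closed[OF Delta_hom, of x] that by simp
  have "additive_subgroup (Delta Q ` L) (add_end Q)"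
  proof (rule E.additive_subgroupI)
    show "\<zero>\<^bsub>add_end Q\<^esub> \<in> Delta Q ` L"
      using D0 L.zero_closed by (metis R0_simps(4) image_eqI)
    show "\<ominus>\<^bsub>add_end Q\<^esub> \<Theta> \<in> Delta Q ` L" if "\<Theta> \<in> Delta Q ` L" for \<Theta>
      using that Dm L.a_inv_closed by (auto simp: L_deg0 R0_minus[symmetric] image_iff) (metis L_deg0 R0_minus)
  qed (auto simp: Da Dc L_deg0)
  then show "F_PQ R0 P Q \<psi> \<subseteq> Delta Q ` L"
    unfolding F_PQ_def
    by (rule E.additive_span_minimal[rotated]) (auto simp: theta_Q_eq_Delta L_def product_span_incl)
  interpret FP: additive_subgroup "F_PQ R0 P Q \<psi>" "add_end Q" by (rule rs.F_PQ_subgroup)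
  have "additive_subgroup {r \<in> deg 0. Delta Q r \<in> F_PQ R0 P Q \<psi>} A"
  proof (rule additive_subgroupI)
    show "\<zero> \<in> {r \<in> deg 0. Delta Q r \<in> F_PQ R0 P Q \<psi>}"
      using D0 by simp
    show "\<ominus> x \<in> {r \<in> deg 0. Delta Q r \<in> F_PQ R0 P Q \<psi>}"
      if "x \<in> {r \<in> deg 0. Delta Q r \<in> F_PQ R0 P Q \<psi>}" for x
      using that Dm[of x] FP.a_inv_closed[of "Delta Q x"] by (auto simp: R0_minus deg_minus)
  qed (auto simp: deg_carrier deg_add Da[symmetric])
  then have "L \<subseteq> {r \<in> deg 0. Delta Q r \<in> F_PQ R0 P Q \<psi>}"
    unfolding L_def
    by (rule product_span_minimal)
      (auto simp: theta_Q_eq_Delta[symmetric] F_PQ_def intro!: deg_mult_eq generate.incl)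
  then show "Delta Q ` L \<subseteq> F_PQ R0 P Q \<psi>" by auto
qed

text \<open>Associativity (y q) p = y (q p) identifies right multiplication by q p with
  \<open>theta_P R0 P Q \<psi> p q\<close>. For a right unit in \<open>L\<close> of finitely many
  elements of \<open>P\<close> this is the second half of (FS).\<close>

lemma right_mult_F_QP:
  assumes "e \<in> L"
  shows "(\<lambda>y\<in>deg (- 1). y \<otimes> e) \<in> F_QP R0 P Q \<psi>"
proof -
  interpret E: nu_ring "add_end P" by (rule add_end_P_ring)
  interpret F: additive_subgroup "F_QP R0 P Q \<psi>" "add_end P" by (rule rs.F_QP_subgroup)
  let ?r = "\<lambda>e. \<lambda>y\<in>deg (- 1). y \<otimes> e"
  have cl: "?r e \<in> carrier (add_end P)" if "e \<in> deg 0" for e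
    using that by (auto simp: add_end_simps add_hom_def deg_act nu_l_distr deg_carrier deg_add)
  have "additive_subgroup {e \<in> deg 0. ?r e \<in> F_QP R0 P Q \<psi>} A"
  proof (rule additive_subgroupI)
    have "?r \<zero> = \<zero>\<^bsub>add_end P\<^esub>" by (auto simp: add_end_simps deg_carrier intro!: restrict_ext)
    then show "\<zero> \<in> {e \<in> deg 0. ?r e \<in> F_QP R0 P Q \<psi>}" by (simp add: F.zero_closed)
  next
    fix e assume e: "e \<in> {e \<in> deg 0. ?r e \<in> F_QP R0 P Q \<psi>}"
    have "\<ominus>\<^bsub>add_end P\<^esub> ?r e = ?r (\<ominus> e)"
    proof (rule E.minus_equality)
      show "?r (\<ominus> e) \<oplus>\<^bsub>add_end P\<^esub> ?r e = \<zero>\<^bsub>add_end P\<^esub>"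
        using e by (auto simp: add_end_simps(1,2) nu_r_minus l_neg deg_carrier nu_m_closed intro!: restrict_ext)
    qed (use e cl deg_minus in blast)+
    then show "\<ominus> e \<in> {e \<in> deg 0. ?r e \<in> F_QP R0 P Q \<psi>}"
      using F.a_inv_closed[of "?r e"] e by (auto simp: deg_minus)
  next
    fix e e' assume e: "e \<in> {e \<in> deg 0. ?r e \<in> F_QP R0 P Q \<psi>}" "e' \<in> {e \<in> deg 0. ?r e \<in> F_QP R0 P Q \<psi>}"
    then have "?r e \<oplus>\<^bsub>add_end P\<^esub> ?r e' = ?r (e \<oplus> e')"
      by (auto simp: add_end_simps nu_r_distr deg_carrier intro!: restrict_ext)
    then show "e \<oplus> e' \<in> {e \<in> deg 0. ?r e \<in> F_QP R0 P Q \<psi>}"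
      using F.a_closed[of "?r e" "?r e'"] e by (auto simp: deg_add)
  qed (auto simp: deg_carrier)
  then have "L \<subseteq> {e \<in> deg 0. ?r e \<in> F_QP R0 P Q \<psi>}"
    unfolding L_def
  proof (rule product_span_minimal)
    fix q p assume qp: "q \<in> deg 1" "p \<in> deg (- 1)"
    then have "?r (q \<otimes> p) = theta_P R0 P Q \<psi> p q"
      by (auto simp: theta_P_def psi_pure nu_m_assoc deg_carrier intro!: restrict_ext)
    then show "q \<otimes> p \<in> {e \<in> deg 0. ?r e \<in> F_QP R0 P Q \<psi>}"
      using qp by (auto simp: F_QP_def intro!: deg_mult_eq generate.incl)
  qed
  with assms show ?thesis by auto
qed

lemma FS: "condition_FS R0 P Q \<psi>"
  unfolding condition_FS_def
proof (intro allI impI, elim conjE)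
  fix X Y assume XY: "finite X" "X \<subseteq> carrier Q" "finite Y" "Y \<subseteq> carrier P"
  obtain e where e: "e \<in> L" "\<forall>f\<in>X. e \<otimes> f = f"
    using left_unit[of X] XY by (auto simp: L_def)
  obtain e' where e': "e' \<in> L" "\<forall>f\<in>Y. f \<otimes> e' = f"
    using right_unit[of "- 1" Y] XY by (auto simp: L_def)
  show "\<exists>\<Theta>\<in>F_PQ R0 P Q \<psi>. \<exists>\<Phi>\<in>F_QP R0 P Q \<psi>. (\<forall>q\<in>X. \<Theta> q = q) \<and> (\<forall>p\<in>Y. \<Phi> p = p)"
  proof (intro bexI conjI)
    show "Delta Q e \<in> F_PQ R0 P Q \<psi>" using e by (auto simp: F_PQ_eq)
    show "(\<lambda>y\<in>deg (- 1). y \<otimes> e') \<in> F_QP R0 P Q \<psi>" by (rule right_mult_F_QP[OF e'(1)])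
  qed (use e e' XY in \<open>auto simp: Delta_def\<close>)
qed

text \<open>In a product q p only the factor p meets \<open>v\<close>. The mirror image
  \<open>annihilates_L\<close> starts from g q = 0 instead.\<close>

lemma L_annihilated:
  assumes "g \<in> L" "v \<in> carrier A" "\<And>p. p \<in> deg (- 1) \<Longrightarrow> p \<otimes> v = \<zero>"
  shows "g \<otimes> v = \<zero>"
proof -
  have "L \<subseteq> {g \<in> carrier A. g \<otimes> v = \<zero>}"
    unfolding L_def
  proof (rule product_span_minimal)
    show "additive_subgroup {g \<in> carrier A. g \<otimes> v = \<zero>} A"
      by (rule additive_subgroupI) (use assms(2) in \<open>auto simp: nu_l_distr nu_l_minus\<close>)
  qed (use assms in \<open>auto simp: nu_m_assoc nu_m_closed deg_carrier\<close>)
  with assms(1) show ?thesis by auto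
qed

lemma annihilates_L:
  assumes "g \<in> carrier A" "\<And>q. q \<in> deg 1 \<Longrightarrow> g \<otimes> q = \<zero>" "e \<in> L"
  shows "g \<otimes> e = \<zero>"
proof -
  have "L \<subseteq> {e \<in> carrier A. g \<otimes> e = \<zero>}"
    unfolding L_def
  proof (rule product_span_minimal)
    show "additive_subgroup {e \<in> carrier A. g \<otimes> e = \<zero>} A"
      by (rule additive_subgroupI) (use assms(1) in \<open>auto simp: nu_r_distr nu_r_minus\<close>)
  qed (use assms in \<open>auto simp: nu_m_assoc[symmetric] nu_m_closed deg_carrier\<close>)
  with assms(3) show ?thesis by auto
qed

text \<open>Elements of degree \<open>0\<close> are absorbed by \<open>Q\<close> on the left and by
  \<open>P\<close> on the right.\<close>

lemma L_ideal: "nu_ideal L R0"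
proof -
  interpret L: additive_subgroup L A by (rule L_subgroup)
  have "additive_subgroup L R0"
    by (rule abelian_group.additive_subgroupI[OF R0_group]) (auto simp: L_deg0 R0_minus)
  moreover have "x \<otimes> a \<in> L \<and> a \<otimes> x \<in> L" if "a \<in> L" "x \<in> deg 0" for a x
  proof -
    have "L \<subseteq> {a \<in> carrier A. x \<otimes> a \<in> L \<and> a \<otimes> x \<in> L}"
    proof -
      have sub: "additive_subgroup {a \<in> carrier A. x \<otimes> a \<in> L \<and> a \<otimes> x \<in> L} A"
        by (rule additive_subgroupI)
          (use that in \<open>auto simp: deg_carrier nu_r_distr nu_r_minus nu_l_distr nu_l_minus\<close>)
      have "x \<otimes> (q \<otimes> p) \<in> L \<and> q \<otimes> p \<otimes> x \<in> L" if "q \<in> deg 1" "p \<in> deg (- 1)" for q p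
        using product_span_incl[of "x \<otimes> q" "deg 1" p "deg (- 1)" A] that \<open>x \<in> deg 0\<close>
          product_span_incl[of q "deg 1" "p \<otimes> x" "deg (- 1)" A]
        by (simp add: nu_m_assoc deg_carrier deg_act L_def)
      then show ?thesis
        unfolding L_def by (intro product_span_minimal[OF sub[unfolded L_def]]) (auto simp: nu_m_closed deg_carrier)
    qed
    with that show ?thesis by auto
  qed
  ultimately show ?thesis by (simp add: nu_ideal_def)
qed

lemma L_faithful: "faithful_psi_compatible R0 P Q \<psi> L"
proof -
  have "g = \<zero>" if g: "g \<in> L" "\<And>q. q \<in> deg 1 \<Longrightarrow> g \<otimes> q = \<zero>" for g
  proof -
    obtain F where F: "finite F" "F \<subseteq> deg (- 1)"
      "\<forall>e\<in>carrier A. (\<forall>y\<in>F. y \<otimes> e = y) \<longrightarrow> g \<otimes> e = g"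
      using product_span_fixed[of "deg 1" "deg (- 1)" g] g(1) by (auto simp: L_def deg_carrier subset_iff)
    \<comment> \<open>This unit fixes the factors of \<open>g\<close> from \<open>P\<close>, hence
      \<open>g\<close> itself, and it lies in \<open>L\<close>, which \<open>g\<close>
      annihilates.\<close>
    obtain e where e: "e \<in> L" "\<forall>f\<in>F. f \<otimes> e = f"
      using right_unit[of "- 1" F] F by (auto simp: L_def)
    have "g \<otimes> e = g" using F(3)[rule_format, of e] e deg_carrier[OF L_deg0] by auto
    with annihilates_L[OF _ g(2) e(1)] g(1) show ?thesis by (auto simp: deg_carrier dest: L_deg0)
  qed
  moreover have "\<zero> \<in> L" by (rule additive_subgroup.zero_closed[OF L_subgroup])
  ultimately show ?thesis
    by (auto simp: faithful_psi_compatible_def psi_compatible_def L_ideal F_PQ_eq ker_Delta_eq deg_carrier)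
qed

text \<open>If \<open>\<Delta> f = \<Delta> g\<close> with \<open>g \<in> L\<close>, a local unit \<open>v\<close> of \<open>f - g\<close> that annihilates \<open>L\<close> exhibits
  \<open>f - g = f v\<close> as an element of the kernel of \<open>\<Delta>\<close> in the ideal generated by \<open>f\<close>.\<close>

lemma L_maximal:
  assumes "faithful_psi_compatible R0 P Q \<psi> L'"
  shows "L' \<subseteq> L"
proof
  fix f assume f: "f \<in> L'"
  have L': "nu_ideal L' R0" "\<And>r. r \<in> L' \<Longrightarrow> Delta Q r \<in> F_PQ R0 P Q \<psi>" "L' \<inter> ker_Delta R0 Q = {\<zero>}"
    using assms by (auto simp: faithful_psi_compatible_def psi_compatible_def)
  have f0: "f \<in> deg 0"
    using L'(1) f additive_subgroup.a_subset[of L' R0] by (auto simp: nu_ideal_def)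
  obtain g where g: "g \<in> L" "Delta Q f = Delta Q g" using L'(2)[OF f] by (auto simp: F_PQ_eq)
  have g0: "g \<in> deg 0" by (rule L_deg0[OF g(1)])
  let ?h = "f \<ominus> g"
  have h0: "?h \<in> deg 0" using f0 g0 by (simp add: minus_eq deg_add deg_minus)
  have hq: "?h \<otimes> q = \<zero>" if "q \<in> deg 1" for q
    using g(2) f0 g0 that
    by (auto simp: Delta_eq_iff minus_eq nu_l_distr nu_l_minus deg_carrier r_neg nu_m_closed)
  obtain v where v: "v \<in> deg 0" "?h \<otimes> v = ?h" "\<And>p. p \<in> deg (- 1) \<Longrightarrow> p \<otimes> v = \<zero>"
    using annihilator_unit[OF h0 hq] by blast
  have gv: "g \<otimes> v = \<zero>" by (rule L_annihilated[OF g(1)]) (use v in \<open>auto simp: deg_carrier\<close>)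
  have "f = ?h \<oplus> g"
    using f0 g0 by (simp add: minus_eq deg_carrier a_assoc l_neg)
  then have "f \<otimes> v = ?h \<otimes> v \<oplus> g \<otimes> v"
    using h0 g0 v(1) nu_l_distr[of ?h g v] by (simp add: deg_carrier)
  then have "f \<otimes> v = ?h"
    using h0 by (simp add: v(2) gv deg_carrier)
  then have "?h \<in> L'" using L'(1) f v(1) by (force simp: nu_ideal_def)
  with L'(3) hq h0 have "?h = \<zero>" by (auto simp: ker_Delta_eq)
  then have "f = g" by (rule eq_if_diff_zero[OF deg_carrier[OF f0] deg_carrier[OF g0]])
  with g show "f \<in> L" by simp
qed

lemma uniquely_maximal_L: "uniquely_maximal R0 P Q \<psi> L"
  by (simp add: uniquely_maximal_def L_faithful L_maximal)

theorem cuntz_pimsner_defined: "cuntz_pimsner_defined R0 P Q \<psi>"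
  using rs.r_system_axioms FS uniquely_maximal_L by (auto simp: cuntz_pimsner_defined_def)

lemma cp_ideal_eq: "cp_ideal R0 P Q \<psi> = toeplitz_ideal R0 P Q \<psi> L"
proof -
  have "(THE L. uniquely_maximal R0 P Q \<psi> L) = L"
    by (rule the_equality) (use uniquely_maximal_L in \<open>auto simp: uniquely_maximal_def\<close>)
  then show ?thesis by (simp add: cp_ideal_def)
qed

end

section \<open>Cuntz--Pimsner rings of graded rings\<close>

text \<open>The properties of the Cuntz-Pimsner ring from which bijectivity of \<open>\<eta>\<close>
  is derived. Indexing the canonical maps by degree packs their relations into one law: degrees (-1,
  1) give the relation of \<psi>, degrees (1, -1) the Cuntz-Pimsner relation, and the others say how
  degree \<open>0\<close> acts. Degrees (1, 1) and (-1, -1) are excluded, as such products cannot be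
  contracted to a letter.\<close>

locale cp_representation = locally_unital_graded_ring A deg + O': nu_ring O'
  for A :: "'a ring" (structure) and deg :: "int \<Rightarrow> 'a set" and O' :: "'b ring" +
  fixes \<iota> :: "int \<Rightarrow> 'a \<Rightarrow> 'b" and \<eta> :: "'b \<Rightarrow> 'a"
  assumes iota_hom: "k \<in> {- 1, 0, 1} \<Longrightarrow> \<iota> k \<in> add_hom (component k) O'"
    and iota_mult: "j \<in> {- 1, 0, 1} \<Longrightarrow> k \<in> {- 1, 0, 1} \<Longrightarrow> j + k \<in> {- 1, 0, 1} \<Longrightarrow>
      x \<in> deg j \<Longrightarrow> y \<in> deg k \<Longrightarrow> \<iota> j x \<otimes>\<^bsub>O'\<^esub> \<iota> k y = \<iota> (j + k) (x \<otimes> y)"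
    and eta_hom: "\<eta> \<in> nu_ring_hom O' A"
    and eta_iota: "k \<in> {- 1, 0, 1} \<Longrightarrow> x \<in> deg k \<Longrightarrow> \<eta> (\<iota> k x) = x"
    and generated: "additive_subgroup X O' \<Longrightarrow>
      (\<And>x y. x \<in> X \<Longrightarrow> y \<in> X \<Longrightarrow> x \<otimes>\<^bsub>O'\<^esub> y \<in> X) \<Longrightarrow>
      (\<And>k. k \<in> {- 1, 0, 1} \<Longrightarrow> \<iota> k ` deg k \<subseteq> X) \<Longrightarrow> carrier O' \<subseteq> X"
begin

text \<open>Reduced words: after contracting adjacent letters of opposite or zero degree, only words with
  all letters of degree \<open>1\<close> or all of degree \<open>- 1\<close> remain.\<close>

inductive word :: "int \<Rightarrow> 'b \<Rightarrow> bool" where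
  base: "r \<in> deg 0 \<Longrightarrow> word 0 (\<iota> 0 r)"
| pos: "word n w \<Longrightarrow> n \<ge> 0 \<Longrightarrow> q \<in> deg 1 \<Longrightarrow> word (n + 1) (w \<otimes>\<^bsub>O'\<^esub> \<iota> 1 q)"
| neg: "word n w \<Longrightarrow> n \<le> 0 \<Longrightarrow> p \<in> deg (- 1) \<Longrightarrow> word (n - 1) (w \<otimes>\<^bsub>O'\<^esub> \<iota> (- 1) p)"
| zero: "word n \<zero>\<^bsub>O'\<^esub>"
| minus: "word n w \<Longrightarrow> word n (\<ominus>\<^bsub>O'\<^esub> w)"
| add: "word n w \<Longrightarrow> word n w' \<Longrightarrow> word n (w \<oplus>\<^bsub>O'\<^esub> w')"

lemma iota_closed: "k \<in> {- 1, 0, 1} \<Longrightarrow> x \<in> deg k \<Longrightarrow> \<iota> k x \<in> carrier O'"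
  using add_hom_closed[OF iota_hom, of k x] by simp

lemma iota_zero: "k \<in> {- 1, 0, 1} \<Longrightarrow> \<iota> k \<zero> = \<zero>\<^bsub>O'\<^esub>"
  using add_hom_zero[OF component_group O'.abelian_group_axioms iota_hom, of k] by simp

lemma iota_minus: "k \<in> {- 1, 0, 1} \<Longrightarrow> x \<in> deg k \<Longrightarrow> \<iota> k (\<ominus> x) = \<ominus>\<^bsub>O'\<^esub> \<iota> k x"
  using add_hom_minus[OF component_group O'.abelian_group_axioms iota_hom, of k x]
  by (simp add: component_minus)

lemma iota_add: "k \<in> {- 1, 0, 1} \<Longrightarrow> x \<in> deg k \<Longrightarrow> y \<in> deg k \<Longrightarrow> \<iota> k (x \<oplus> y) = \<iota> k x \<oplus>\<^bsub>O'\<^esub> \<iota> k y"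
  using add_hom_add[OF iota_hom, of k x y] by simp

lemma eta_closed: "x \<in> carrier O' \<Longrightarrow> \<eta> x \<in> carrier A"
  and eta_add: "x \<in> carrier O' \<Longrightarrow> y \<in> carrier O' \<Longrightarrow> \<eta> (x \<oplus>\<^bsub>O'\<^esub> y) = \<eta> x \<oplus> \<eta> y"
  and eta_mult: "x \<in> carrier O' \<Longrightarrow> y \<in> carrier O' \<Longrightarrow> \<eta> (x \<otimes>\<^bsub>O'\<^esub> y) = \<eta> x \<otimes> \<eta> y"
  using eta_hom by (auto simp: nu_ring_hom_def add_hom_def)

lemma eta_zero: "\<eta> \<zero>\<^bsub>O'\<^esub> = \<zero>"
  by (rule add_hom_zero[OF O'.abelian_group_axioms abelian_group_axioms nu_ring_hom_add_hom[OF eta_hom]])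

lemma eta_minus: "x \<in> carrier O' \<Longrightarrow> \<eta> (\<ominus>\<^bsub>O'\<^esub> x) = \<ominus> \<eta> x"
  by (rule add_hom_minus[OF O'.abelian_group_axioms abelian_group_axioms nu_ring_hom_add_hom[OF eta_hom]])

lemma word_closed: "word n w \<Longrightarrow> w \<in> carrier O'"
  by (induction rule: word.induct) (auto intro!: O'.nu_m_closed iota_closed)

lemma eta_word: "word n w \<Longrightarrow> \<eta> w \<in> deg n"
proof (induction rule: word.induct)
  case (pos n w q)
  then show ?case by (auto simp: eta_mult word_closed iota_closed eta_iota intro: deg_mult_eq)
next
  case (neg n w p)
  then show ?case by (auto simp: eta_mult word_closed iota_closed eta_iota intro: deg_mult_eq)
qed (auto simp: eta_iota eta_zero eta_minus eta_add word_closed deg_minus deg_add)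

text \<open>A letter of the same sign prolongs a reduced word, a letter of degree \<open>0\<close>
  is absorbed by the last letter, and a letter of the opposite sign merges with the last letter into
  one of degree \<open>0\<close>, which the induction hypothesis attaches to the shorter word. For
  this the added letter has to stay arbitrary in the induction.\<close>

lemma word_mult_iota:
  assumes "word n w" "k \<in> {- 1, 0, 1}" "x \<in> deg k"
  shows "word (n + k) (w \<otimes>\<^bsub>O'\<^esub> \<iota> k x)"
  using assms
proof (induction arbitrary: k x rule: word.induct)
  case (base r)
  have "word k (\<iota> 0 r \<otimes>\<^bsub>O'\<^esub> \<iota> k x)"
    using base word.pos[OF word.base[OF base(1)], of x] word.neg[OF word.base[OF base(1)], of x]
    by (auto simp: iota_mult deg_act intro: word.base)
  then show ?case by simp
next
  case (pos n w q)
  have assoc: "w \<otimes>\<^bsub>O'\<^esub> \<iota> 1 q \<otimes>\<^bsub>O'\<^esub> \<iota> k x = w \<otimes>\<^bsub>O'\<^esub> (\<iota> 1 q \<otimes>\<^bsub>O'\<^esub> \<iota> k x)"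
    using pos by (intro O'.nu_m_assoc iota_closed) (auto simp: word_closed)
  consider "k = 1" | "k = 0" | "k = - 1" using pos by auto
  then show ?case
  proof cases
    case 1
    then show ?thesis using word.pos[OF word.pos[OF pos(1-3)], of x] pos by simp
  next
    case 2
    then show ?thesis using word.pos[OF pos(1,2), of "q \<otimes> x"] pos assoc by (simp add: iota_mult deg_act)
  next
    case 3
    then show ?thesis using pos.IH[of 0 "q \<otimes> x"] pos assoc deg_mult_eq[of q 1 x "- 1" 0] by (simp add: iota_mult)
  qed
next
  case (neg n w p)
  have assoc: "w \<otimes>\<^bsub>O'\<^esub> \<iota> (- 1) p \<otimes>\<^bsub>O'\<^esub> \<iota> k x = w \<otimes>\<^bsub>O'\<^esub> (\<iota> (- 1) p \<otimes>\<^bsub>O'\<^esub> \<iota> k x)"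
    using neg by (intro O'.nu_m_assoc iota_closed) (auto simp: word_closed)
  consider "k = 1" | "k = 0" | "k = - 1" using neg by auto
  then show ?case
  proof cases
    case 1
    then show ?thesis using neg.IH[of 0 "p \<otimes> x"] neg assoc deg_mult_eq[of p "- 1" x 1 0] by (simp add: iota_mult)
  next
    case 2
    then show ?thesis using word.neg[OF neg(1,2), of "p \<otimes> x"] neg assoc by (simp add: iota_mult deg_act)
  next
    case 3
    then show ?thesis using word.neg[OF word.neg[OF neg(1-3)], of x] neg by simp
  qed
next
  case (zero n)
  then show ?case using word.zero by (simp add: iota_closed)
next
  case (minus n w)
  then show ?case using word.minus[OF minus.IH[of k x]] by (simp add: O'.nu_l_minus word_closed iota_closed)
next
  case (add n w w')
  then show ?case using word.add[OF add.IH(1)[of k x] add.IH(2)[of k x]]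
    by (simp add: O'.nu_l_distr word_closed iota_closed)
qed

text \<open>The right factor is taken apart letter by letter, and \<open>word_mult_iota\<close>
  attaches each letter to the left factor.\<close>

lemma word_mult:
  assumes "word n y" "word m x"
  shows "word (m + n) (x \<otimes>\<^bsub>O'\<^esub> y)"
  using assms(1)
proof induction
  case (base r)
  then show ?case using word_mult_iota[OF assms(2), of 0 r] by simp
next
  case (pos n w q)
  then show ?case using word_mult_iota[OF pos.IH, of 1 q] assms(2)
    by (simp add: O'.nu_m_assoc word_closed iota_closed add.assoc)
next
  case (neg n w p)
  then show ?case using word_mult_iota[OF neg.IH, of "- 1" p] assms(2)
    by (simp add: O'.nu_m_assoc word_closed iota_closed add_diff_eq)
next
  case (zero n)
  then show ?case using word.zero assms(2) by (simp add: word_closed)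
next
  case (minus n w)
  then show ?case using word.minus[OF minus.IH] assms(2) by (simp add: O'.nu_r_minus word_closed)
next
  case (add n w w')
  then show ?case using word.add[OF add.IH] assms(2) by (simp add: O'.nu_r_distr word_closed)
qed

text \<open>A reduced word begins with a letter of degree \<open>0\<close>, so a single letter of
  degree \<open>1\<close> or \<open>- 1\<close> has to be rewritten. In degree \<open>1\<close> a
  left unit gives x = e x. In degree \<open>- 1\<close> a right unit from the span of Q P is used
  instead: x is a sum of terms (x q) p, and x q has degree \<open>0\<close>.\<close>

lemma word_iota:
  assumes k: "k \<in> {- 1, 0, 1}" and x: "x \<in> deg k"
  shows "word k (\<iota> k x)"
proof -
  consider "k = 0" | "k = 1" | "k = - 1" using k by auto
  then show ?thesis
  proof cases
    case 1
    then show ?thesis using x by (auto intro: word.base)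
  next
    case 2
    obtain e where e: "e \<in> product_span A (deg 1) (deg (- 1))" "e \<otimes> x = x"
      using left_unit[of "{x}"] x 2 by auto
    then have "e \<in> deg 0" using L_deg0 by (simp add: L_def)
    then have "word (0 + 1) (\<iota> 0 e \<otimes>\<^bsub>O'\<^esub> \<iota> 1 x)"
      using x 2 by (intro word.pos word.base) auto
    with \<open>e \<in> deg 0\<close> e(2) x 2 show ?thesis by (simp add: iota_mult)
  next
    case 3
    obtain e where e: "e \<in> product_span A (deg 1) (deg (- 1))" "x \<otimes> e = x"
      using right_unit[of "- 1" "{x}"] x 3 by auto
    have "product_span A (deg 1) (deg (- 1)) \<subseteq> {e \<in> deg 0. word (- 1) (\<iota> (- 1) (x \<otimes> e))}"
    proof (rule product_span_minimal)
      show "additive_subgroup {e \<in> deg 0. word (- 1) (\<iota> (- 1) (x \<otimes> e))} A"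
        by (rule additive_subgroupI)
          (use x 3 in \<open>auto simp: deg_carrier iota_zero deg_minus deg_add nu_r_minus nu_r_distr iota_minus
            iota_add deg_act intro: word.zero word.minus word.add\<close>)
      fix q p assume qp: "q \<in> deg 1" "p \<in> deg (- 1)"
      then have xq: "x \<otimes> q \<in> deg 0" using x 3 by (auto intro: deg_mult_eq)
      then have "word (0 - 1) (\<iota> 0 (x \<otimes> q) \<otimes>\<^bsub>O'\<^esub> \<iota> (- 1) p)"
        using qp by (intro word.neg word.base) auto
      then have "word (- 1) (\<iota> (- 1) (x \<otimes> (q \<otimes> p)))"
        using qp x 3 xq by (simp add: iota_mult nu_m_assoc deg_carrier)
      with qp show "q \<otimes> p \<in> {e \<in> deg 0. word (- 1) (\<iota> (- 1) (x \<otimes> e))}" by (auto intro: deg_mult_eq)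
    qed
    with e 3 show ?thesis by auto
  qed
qed

lemma word_span: "carrier O' \<subseteq> generate (add_monoid O') {w. \<exists>n. word n w}"
proof -
  define D where "D = generate (add_monoid O') {w. \<exists>n. word n w}"
  interpret D: additive_subgroup D O'
    unfolding D_def by (rule O'.additive_span_subgroup) (auto simp: word_closed)
  have Dc: "x \<in> carrier O'" if "x \<in> D" for x using that D.a_subset by auto
  have WD: "w \<in> D" if "word n w" for w n unfolding D_def by (rule generate.incl) (use that in blast)
  have min: "D \<subseteq> H" if "additive_subgroup H O'" "\<And>n w. word n w \<Longrightarrow> w \<in> H" for H
    unfolding D_def by (rule O'.additive_span_minimal[OF _ that(1)]) (use that(2) in auto)
  \<comment> \<open>Closure of the span under products, one factor at a time: first the left factor
    is a word, then it is arbitrary.\<close>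
  have 1: "x \<otimes>\<^bsub>O'\<^esub> y \<in> D" if x: "word m x" and y: "y \<in> D" for m x y
  proof -
    have "D \<subseteq> {y \<in> carrier O'. x \<otimes>\<^bsub>O'\<^esub> y \<in> D}"
    proof (rule min)
      show "additive_subgroup {y \<in> carrier O'. x \<otimes>\<^bsub>O'\<^esub> y \<in> D} O'"
        by (rule O'.additive_subgroupI)
          (use word_closed[OF x] in \<open>auto simp: O'.nu_r_minus O'.nu_r_distr\<close>)
    qed (auto simp: word_closed intro: WD word_mult[OF _ x])
    with y show ?thesis by auto
  qed
  have 2: "x \<otimes>\<^bsub>O'\<^esub> y \<in> D" if x: "x \<in> D" and y: "y \<in> D" for x y
  proof -
    have "D \<subseteq> {x \<in> carrier O'. x \<otimes>\<^bsub>O'\<^esub> y \<in> D}"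
    proof (rule min)
      show "additive_subgroup {x \<in> carrier O'. x \<otimes>\<^bsub>O'\<^esub> y \<in> D} O'"
        by (rule O'.additive_subgroupI)
          (use Dc[OF y] in \<open>auto simp: O'.nu_l_minus O'.nu_l_distr\<close>)
    qed (auto simp: word_closed intro: 1[OF _ y])
    with x show ?thesis by auto
  qed
  have "\<iota> k x \<in> D" if "k \<in> {- 1, 0, 1}" "x \<in> deg k" for k x
    using that by (intro WD[OF word_iota])
  then have "carrier O' \<subseteq> D" by (intro generated D.additive_subgroup_axioms 2) auto
  then show ?thesis by (simp add: D_def)
qed

text \<open>The equation for \<open>\<eta> x\<close> is carried along, so that the termwise image
  comes out of the same induction. The family \<open>w\<close> is total because
  \<open>deg_independent\<close> asks for an element in every degree.\<close>

lemma word_decomposition: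
  assumes "x \<in> carrier O'"
  shows "\<exists>N w. finite N \<and> (\<forall>n. word n (w n)) \<and> x = finsum O' w N \<and> \<eta> x = finsum A (\<lambda>n. \<eta> (w n)) N"
proof -
  \<comment> \<open>Vanishing outside \<open>N\<close> is added so that two families can be extended
    to a common index set without changing their sums.\<close>
  let ?H = "{x \<in> carrier O'. \<exists>N w. finite N \<and> (\<forall>n. word n (w n)) \<and> (\<forall>n. n \<notin> N \<longrightarrow> w n = \<zero>\<^bsub>O'\<^esub>) \<and>
    x = finsum O' w N \<and> \<eta> x = finsum A (\<lambda>n. \<eta> (w n)) N}"
  have "generate (add_monoid O') {w. \<exists>n. word n w} \<subseteq> ?H"
  proof (rule O'.additive_span_minimal)
    show "{w. \<exists>n. word n w} \<subseteq> ?H"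
    proof clarify
      fix n x assume x: "word n x"
      show "x \<in> carrier O' \<and> (\<exists>N w. finite N \<and> (\<forall>n. word n (w n)) \<and> (\<forall>n. n \<notin> N \<longrightarrow> w n = \<zero>\<^bsub>O'\<^esub>) \<and>
          x = finsum O' w N \<and> \<eta> x = finsum A (\<lambda>n. \<eta> (w n)) N)"
        by (intro conjI exI[of _ "{n}"] exI[of _ "\<lambda>m. if m = n then x else \<zero>\<^bsub>O'\<^esub>"])
          (use x in \<open>auto simp: word_closed eta_closed intro: word.zero\<close>)
    qed
    show "additive_subgroup ?H O'"
    proof (rule O'.additive_subgroupI)
      show "\<zero>\<^bsub>O'\<^esub> \<in> ?H"
        by (auto simp: eta_zero intro!: exI[of _ "{}"] exI[of _ "\<lambda>_. \<zero>\<^bsub>O'\<^esub>"] word.zero)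
    next
      fix x y assume "x \<in> ?H" "y \<in> ?H"
      then obtain N w M v where x: "x \<in> carrier O'" "finite N" "\<And>n. word n (w n)" "\<And>n. n \<notin> N \<Longrightarrow> w n = \<zero>\<^bsub>O'\<^esub>"
          "x = finsum O' w N" "\<eta> x = finsum A (\<lambda>n. \<eta> (w n)) N"
        and y: "y \<in> carrier O'" "finite M" "\<And>n. word n (v n)" "\<And>n. n \<notin> M \<Longrightarrow> v n = \<zero>\<^bsub>O'\<^esub>"
          "y = finsum O' v M" "\<eta> y = finsum A (\<lambda>n. \<eta> (v n)) M"
        by auto
      have c: "w n \<in> carrier O'" "v n \<in> carrier O'" for n using x(3) y(3) word_closed by auto
      have xN: "x = finsum O' w (N \<union> M)" "\<eta> x = finsum A (\<lambda>n. \<eta> (w n)) (N \<union> M)"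
        by (subst x(5), rule O'.add.finprod_mono_neutral_cong_left,
            use x(2,4) y(2) c in \<open>auto\<close>, subst x(6), rule add.finprod_mono_neutral_cong_left,
            use x(2,4) y(2) c in \<open>auto simp: eta_zero eta_closed\<close>)
      have yN: "y = finsum O' v (N \<union> M)" "\<eta> y = finsum A (\<lambda>n. \<eta> (v n)) (N \<union> M)"
        by (subst y(5), rule O'.add.finprod_mono_neutral_cong_left,
            use y(2,4) x(2) c in \<open>auto\<close>, subst y(6), rule add.finprod_mono_neutral_cong_left,
            use y(2,4) x(2) c in \<open>auto simp: eta_zero eta_closed\<close>)
      have s: "x \<oplus>\<^bsub>O'\<^esub> y = finsum O' (\<lambda>n. w n \<oplus>\<^bsub>O'\<^esub> v n) (N \<union> M)"
        unfolding xN(1) yN(1) using c by (simp add: O'.finsum_addf)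
      have s': "\<eta> (x \<oplus>\<^bsub>O'\<^esub> y) = finsum A (\<lambda>n. \<eta> (w n \<oplus>\<^bsub>O'\<^esub> v n)) (N \<union> M)"
        unfolding eta_add[OF x(1) y(1)] xN(2) yN(2) using c by (simp add: finsum_addf eta_add eta_closed)
      have f: "finite (N \<union> M)" "\<forall>n. word n (w n \<oplus>\<^bsub>O'\<^esub> v n)"
          "\<forall>n. n \<notin> N \<union> M \<longrightarrow> w n \<oplus>\<^bsub>O'\<^esub> v n = \<zero>\<^bsub>O'\<^esub>"
        using x(2,3,4) y(2,3,4) by (auto intro: word.add)
      show "x \<oplus>\<^bsub>O'\<^esub> y \<in> ?H"
        by (intro CollectI conjI exI[of _ "N \<union> M"] exI[of _ "\<lambda>n. w n \<oplus>\<^bsub>O'\<^esub> v n"])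
          (rule O'.a_closed[OF x(1) y(1)], rule f, rule f, rule f, rule s, rule s')
    next
      fix x assume "x \<in> ?H"
      then obtain N w where x: "x \<in> carrier O'" "finite N" "\<And>n. word n (w n)" "\<And>n. n \<notin> N \<Longrightarrow> w n = \<zero>\<^bsub>O'\<^esub>"
          "x = finsum O' w N" "\<eta> x = finsum A (\<lambda>n. \<eta> (w n)) N"
        by auto
      have c: "w n \<in> carrier O'" for n using x(3) word_closed by auto
      have "x \<oplus>\<^bsub>O'\<^esub> finsum O' (\<lambda>n. \<ominus>\<^bsub>O'\<^esub> w n) N = \<zero>\<^bsub>O'\<^esub>"
        unfolding x(5) using c by (simp add: O'.finsum_addf[symmetric] O'.r_neg O'.finsum_zero)
      then have 1: "\<ominus>\<^bsub>O'\<^esub> x = finsum O' (\<lambda>n. \<ominus>\<^bsub>O'\<^esub> w n) N"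
        using x(1) c by (intro O'.minus_equality) (auto simp: O'.a_comm)
      have "\<eta> x \<oplus> finsum A (\<lambda>n. \<eta> (\<ominus>\<^bsub>O'\<^esub> w n)) N = \<zero>"
        unfolding x(6) using c by (simp add: finsum_addf[symmetric] eta_minus eta_closed r_neg finsum_zero)
      then have 2: "\<eta> (\<ominus>\<^bsub>O'\<^esub> x) = finsum A (\<lambda>n. \<eta> (\<ominus>\<^bsub>O'\<^esub> w n)) N"
        using x(1) c unfolding eta_minus[OF x(1)] by (intro minus_equality) (auto simp: a_comm eta_closed)
      have "\<ominus>\<^bsub>O'\<^esub> \<zero>\<^bsub>O'\<^esub> = \<zero>\<^bsub>O'\<^esub>" by (rule O'.minus_equality) simp_all
      then have f: "\<forall>n. word n (\<ominus>\<^bsub>O'\<^esub> w n)" "\<forall>n. n \<notin> N \<longrightarrow> \<ominus>\<^bsub>O'\<^esub> w n = \<zero>\<^bsub>O'\<^esub>"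
        using x(3,4) by (auto intro: word.minus)
      show "\<ominus>\<^bsub>O'\<^esub> x \<in> ?H"
        by (intro CollectI conjI exI[of _ N] exI[of _ "\<lambda>n. \<ominus>\<^bsub>O'\<^esub> w n"])
          (rule O'.a_inv_closed[OF x(1)], rule x(2), rule f, rule f, rule 1, rule 2)
    qed (rule Collect_restrict)
  qed
  with word_span assms have "x \<in> ?H" by blast
  then show ?thesis by blast
qed

text \<open>Every step that adds a letter moves the degree away from \<open>0\<close>, so in degree
  \<open>0\<close> only sums of single letters occur.\<close>

lemma word_zero: "word n x \<Longrightarrow> n = 0 \<Longrightarrow> \<exists>r\<in>deg 0. x = \<iota> 0 r"
proof (induction rule: word.induct)
  case (zero n)
  then show ?case by (intro bexI[of _ \<zero>]) (auto simp: iota_zero)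
next
  case (minus n w)
  then show ?case by (metis deg_minus iota_minus insertI1 insertI2)
next
  case (add n w w')
  then show ?case by (metis deg_add iota_add insertI1 insertI2)
qed auto

text \<open>A word of nonzero degree is a combination of products whose last letters have degree
  \<open>sgn n\<close>, and a right unit of these finitely many letters fixes the word. Units in
  \<open>O'\<close> are thereby reduced to units in \<open>A\<close>.\<close>

lemma word_fixed:
  assumes "word n x" "n \<noteq> 0"
  shows "\<exists>F. finite F \<and> F \<subseteq> deg (sgn n) \<and> (\<forall>e\<in>deg 0. (\<forall>f\<in>F. f \<otimes> e = f) \<longrightarrow> x \<otimes>\<^bsub>O'\<^esub> \<iota> 0 e = x)"
  using assms
proof (induction rule: word.induct)
  case (pos n w q)
  then show ?case
    by (intro exI[of _ "{q}"]) (auto simp: O'.nu_m_assoc word_closed iota_closed iota_mult)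
next
  case (neg n w p)
  then show ?case
    by (intro exI[of _ "{p}"]) (auto simp: O'.nu_m_assoc word_closed iota_closed iota_mult)
next
  case (zero n)
  then show ?case by (intro exI[of _ "{}"]) (auto simp: iota_closed)
next
  case (minus n w)
  then show ?case by (auto simp: O'.nu_l_minus word_closed iota_closed)
next
  case (add n w w')
  then obtain F F' where "finite F" "F \<subseteq> deg (sgn n)" "finite F'" "F' \<subseteq> deg (sgn n)"
    "\<forall>e\<in>deg 0. (\<forall>f\<in>F. f \<otimes> e = f) \<longrightarrow> w \<otimes>\<^bsub>O'\<^esub> \<iota> 0 e = w"
    "\<forall>e\<in>deg 0. (\<forall>f\<in>F'. f \<otimes> e = f) \<longrightarrow> w' \<otimes>\<^bsub>O'\<^esub> \<iota> 0 e = w'" by auto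
  then show ?case
    using add by (intro exI[of _ "F \<union> F'"]) (auto simp: O'.nu_l_distr word_closed iota_closed)
qed simp

lemma sgn_cases: "n \<noteq> 0 \<Longrightarrow> sgn n \<in> {- 1, 0, 1} \<and> - sgn n \<in> {- 1, 0, 1}" for n :: int
  by (auto simp: sgn_if)

text \<open>Multiplying a word by letters of the opposite degree brings it closer to degree \<open>0\<close>, and a
  local unit recovers the word from these products.\<close>

lemma eta_word_inj:
  assumes "word n x" "\<eta> x = \<zero>"
  shows "x = \<zero>\<^bsub>O'\<^esub>"
  using assms
proof (induction "nat \<bar>n\<bar>" arbitrary: n x rule: less_induct)
  case less
  show ?case
  proof (cases "n = 0")
    case True
    then obtain r where "r \<in> deg 0" "x = \<iota> 0 r" using word_zero less by blast
    then show ?thesis using less eta_iota[of 0 r] iota_zero[of 0] by simp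
  next
    case False
    let ?k = "sgn n"
    have k: "?k \<in> {- 1, 0, 1}" "- ?k \<in> {- 1, 0, 1}" using sgn_cases[OF False] by auto
    note xc = word_closed[OF less(2)]
    have xp: "x \<otimes>\<^bsub>O'\<^esub> \<iota> (- ?k) p = \<zero>\<^bsub>O'\<^esub>" if "p \<in> deg (- ?k)" for p
    proof (rule less(1))
      show "word (n + - ?k) (x \<otimes>\<^bsub>O'\<^esub> \<iota> (- ?k) p)" by (rule word_mult_iota[OF less(2) k(2) that])
      show "nat \<bar>n + - ?k\<bar> < nat \<bar>n\<bar>" using False by (auto simp: sgn_if)
      show "\<eta> (x \<otimes>\<^bsub>O'\<^esub> \<iota> (- ?k) p) = \<zero>"
        using less(3) by (simp add: eta_mult xc iota_closed[OF k(2) that] eta_iota[OF k(2) that] deg_carrier[OF that])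
    qed
    obtain F where F: "finite F" "F \<subseteq> deg ?k" "\<forall>e\<in>deg 0. (\<forall>f\<in>F. f \<otimes> e = f) \<longrightarrow> x \<otimes>\<^bsub>O'\<^esub> \<iota> 0 e = x"
      using word_fixed[OF less(2) False] by auto
    obtain e where e: "e \<in> product_span A (deg (- ?k)) (deg ?k)" "\<forall>f\<in>F. f \<otimes> e = f"
    proof -
      have "?k \<noteq> 0" using False by (simp add: sgn_if)
      from right_unit[OF this F(1,2)] show ?thesis using that by (auto simp: sgn_sgn)
    qed
    have "product_span A (deg (- ?k)) (deg ?k) \<subseteq> {e \<in> deg 0. x \<otimes>\<^bsub>O'\<^esub> \<iota> 0 e = \<zero>\<^bsub>O'\<^esub>}"
    proof (rule product_span_minimal)
      have "\<ominus>\<^bsub>O'\<^esub> \<zero>\<^bsub>O'\<^esub> = \<zero>\<^bsub>O'\<^esub>" by (rule O'.minus_equality) simp_all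
      then show "additive_subgroup {e \<in> deg 0. x \<otimes>\<^bsub>O'\<^esub> \<iota> 0 e = \<zero>\<^bsub>O'\<^esub>} A"
        by (intro additive_subgroupI)
          (auto simp: deg_carrier iota_zero xc deg_minus iota_minus O'.nu_r_minus iota_closed deg_add
            iota_add O'.nu_r_distr)
      fix p q assume pq: "p \<in> deg (- ?k)" "q \<in> deg ?k"
      have "\<iota> 0 (p \<otimes> q) = \<iota> (- ?k) p \<otimes>\<^bsub>O'\<^esub> \<iota> ?k q"
        using iota_mult[OF k(2,1) _ pq] by simp
      then have "x \<otimes>\<^bsub>O'\<^esub> \<iota> 0 (p \<otimes> q) = \<zero>\<^bsub>O'\<^esub>"
        using xp[OF pq(1)] by (simp add: O'.nu_m_assoc[symmetric] xc iota_closed[OF k(2) pq(1)] iota_closed[OF k(1) pq(2)])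
      then show "p \<otimes> q \<in> {e \<in> deg 0. x \<otimes>\<^bsub>O'\<^esub> \<iota> 0 e = \<zero>\<^bsub>O'\<^esub>}"
        using deg_mult_eq[OF pq, of 0] by simp
    qed
    with e F(3) show ?thesis by auto
  qed
qed

text \<open>The elements \<open>e\<close> for which \<open>a \<otimes> e\<close> is the image of a
  word of degree \<open>n\<close> form a subgroup. By induction it contains every product
  \<open>p \<otimes> q\<close>, since \<open>a \<otimes> p\<close> is closer to degree
  \<open>0\<close>; hence it contains a right unit of \<open>a\<close>.\<close>

lemma eta_word_surj:
  assumes "a \<in> deg n"
  shows "\<exists>x. word n x \<and> \<eta> x = a"
  using assms
proof (induction "nat \<bar>n\<bar>" arbitrary: n a rule: less_induct)
  case less
  show ?case
  proof (cases "n = 0")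
    case True
    then show ?thesis using less(2) eta_iota[of 0 a] word.base[of a] by auto
  next
    case False
    let ?k = "sgn n"
    have k: "?k \<in> {- 1, 0, 1}" "- ?k \<in> {- 1, 0, 1}" using sgn_cases[OF False] by auto
    note ac = deg_carrier[OF less(2)]
    obtain e where e: "e \<in> product_span A (deg (- ?k)) (deg ?k)" "a \<otimes> e = a"
      using right_unit[of n "{a}"] less(2) False by auto
    have "product_span A (deg (- ?k)) (deg ?k) \<subseteq> {e \<in> carrier A. \<exists>x. word n x \<and> \<eta> x = a \<otimes> e}"
    proof (rule product_span_minimal)
      show "additive_subgroup {e \<in> carrier A. \<exists>x. word n x \<and> \<eta> x = a \<otimes> e} A"
      proof (rule additive_subgroupI)
        show "\<zero> \<in> {e \<in> carrier A. \<exists>x. word n x \<and> \<eta> x = a \<otimes> e}"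
          using ac eta_zero word.zero by auto
        fix e assume "e \<in> {e \<in> carrier A. \<exists>x. word n x \<and> \<eta> x = a \<otimes> e}"
        then obtain x where "e \<in> carrier A" "word n x" "\<eta> x = a \<otimes> e" by auto
        then show "\<ominus> e \<in> {e \<in> carrier A. \<exists>x. word n x \<and> \<eta> x = a \<otimes> e}"
          using ac by (auto simp: nu_r_minus eta_minus word_closed intro!: exI[of _ "\<ominus>\<^bsub>O'\<^esub> x"] word.minus)
      next
        fix e e' assume "e \<in> {e \<in> carrier A. \<exists>x. word n x \<and> \<eta> x = a \<otimes> e}"
          "e' \<in> {e \<in> carrier A. \<exists>x. word n x \<and> \<eta> x = a \<otimes> e}"
        then obtain x x' where "e \<in> carrier A" "e' \<in> carrier A" "word n x" "word n x'"
          "\<eta> x = a \<otimes> e" "\<eta> x' = a \<otimes> e'" by auto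
        then show "e \<oplus> e' \<in> {e \<in> carrier A. \<exists>x. word n x \<and> \<eta> x = a \<otimes> e}"
          using ac by (auto simp: nu_r_distr eta_add word_closed intro!: exI[of _ "x \<oplus>\<^bsub>O'\<^esub> x'"] word.add)
      qed (rule Collect_restrict)
      fix p q assume pq: "p \<in> deg (- ?k)" "q \<in> deg ?k"
      have "a \<otimes> p \<in> deg (n + - ?k)" by (rule deg_mult[OF less(2) pq(1)])
      moreover have "nat \<bar>n + - ?k\<bar> < nat \<bar>n\<bar>" using False by (auto simp: sgn_if)
      ultimately obtain x where x: "word (n + - ?k) x" "\<eta> x = a \<otimes> p" using less(1) by blast
      have "word n (x \<otimes>\<^bsub>O'\<^esub> \<iota> ?k q)" using word_mult_iota[OF x(1) k(1) pq(2)] by simp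
      moreover have "\<eta> (x \<otimes>\<^bsub>O'\<^esub> \<iota> ?k q) = a \<otimes> (p \<otimes> q)"
        using x pq by (simp add: eta_mult word_closed iota_closed[OF k(1)] eta_iota[OF k(1)] nu_m_assoc ac deg_carrier)
      ultimately show "p \<otimes> q \<in> {e \<in> carrier A. \<exists>x. word n x \<and> \<eta> x = a \<otimes> e}"
        using pq by (auto simp: nu_m_closed deg_carrier)
    qed
    with e(1) have "e \<in> {e \<in> carrier A. \<exists>x. word n x \<and> \<eta> x = a \<otimes> e}" by blast
    then show ?thesis by (simp add: e(2))
  qed
qed

text \<open>Injectivity borrows directness from \<open>A\<close>: if a sum of words of distinct
  degrees maps to zero, the images are homogeneous of distinct degrees, so each of them vanishes and
  \<open>eta_word_inj\<close> applies to each word. Surjectivity holds since all homogeneous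
  elements are hit and they span \<open>A\<close>.\<close>

theorem eta_bij: "bij_betw \<eta> (carrier O') (carrier A)"
  unfolding bij_betw_def
proof
  have 0: "x = \<zero>\<^bsub>O'\<^esub>" if x: "x \<in> carrier O'" "\<eta> x = \<zero>" for x
  proof -
    obtain N w where w: "finite N" "\<And>n. word n (w n)" "x = finsum O' w N" "\<eta> x = finsum A (\<lambda>n. \<eta> (w n)) N"
      using word_decomposition[OF x(1)] by auto
    have "\<eta> (w n) = \<zero>" if "n \<in> N" for n
      by (rule deg_independent[OF w(1) _ _ that]) (use w x in \<open>auto intro: eta_word\<close>)
    then have "w n = \<zero>\<^bsub>O'\<^esub>" if "n \<in> N" for n using that eta_word_inj[OF w(2)] by auto
    then have "finsum O' w N = finsum O' (\<lambda>_. \<zero>\<^bsub>O'\<^esub>) N" by (intro O'.finsum_cong') auto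
    then show ?thesis using w(3) by (simp add: O'.finsum_zero)
  qed
  show "inj_on \<eta> (carrier O')"
  proof (rule inj_onI)
    fix x y assume xy: "x \<in> carrier O'" "y \<in> carrier O'" "\<eta> x = \<eta> y"
    then have "x \<ominus>\<^bsub>O'\<^esub> y = \<zero>\<^bsub>O'\<^esub>"
      by (intro 0) (auto simp: O'.minus_eq eta_add eta_minus eta_closed r_neg)
    then show "x = y" by (rule O'.eq_if_diff_zero[OF xy(1,2)])
  qed
  have "additive_subgroup (\<eta> ` carrier O') A"
    by (rule additive_subgroupI)
      (auto simp: eta_closed eta_zero[symmetric] eta_minus[symmetric] eta_add[symmetric])
  then have "generate (add_monoid A) (\<Union>n. deg n) \<subseteq> \<eta> ` carrier O'"
    by (rule additive_span_minimal[rotated]) (use eta_word_surj word_closed in fastforce)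
  then show "\<eta> ` carrier O' = carrier A" using deg_span eta_closed by auto
qed

lemma eta_word_image: "\<eta> ` {x. word n x} = deg n"
  using eta_word eta_word_surj by fast

end

section \<open>The Cuntz-Pimsner ring of a graded ring\<close>

context graded_ring_system
begin

abbreviation "T \<equiv> toeplitz_ring R0 P Q \<psi>"
abbreviation "tR \<equiv> toep_R R0 P Q \<psi>"
abbreviation "tP \<equiv> toep_P R0 P Q \<psi>"
abbreviation "tQ \<equiv> toep_Q R0 P Q \<psi>"
abbreviation "I \<equiv> cp_ideal R0 P Q \<psi>"
abbreviation "CP \<equiv> cuntz_pimsner_ring R0 P Q \<psi>"
abbreviation "\<kappa> \<equiv> cp_quotient_map R0 P Q \<psi>"
abbreviation "cppi \<equiv> cp_pi R0 P Q \<psi> tQ tP T"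

sublocale T: covariant_representation R0 P Q \<psi> tP tQ tR T
  unfolding covariant_representation_def covariant_representation_axioms_def
  using rs.r_system_axioms toeplitz_nu_ring rs.toeplitz_covariant by blast

lemma inclusion_covariant: "covariant_rep R0 P Q \<psi> (\<lambda>x. x) (\<lambda>x. x) (\<lambda>x. x) A"
  by (auto simp: covariant_rep_def add_hom_def nu_ring_hom_def deg_carrier nu_ring_axioms psi_pure)

lemma Delta_L_closed: "x \<in> L \<Longrightarrow> Delta Q x \<in> F_PQ R0 P Q \<psi>"
  by (simp add: F_PQ_eq)

lemma cppi_Delta_closed: "x \<in> L \<Longrightarrow> cppi (Delta Q x) \<in> carrier T"
  using add_hom_closed[OF nu_ring_hom_add_hom[OF T.cp_pi_hom(1)[OF FS]]] Delta_L_closed by simp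

lemma cppi_Delta_mult:
  assumes "q \<in> deg 1" "p \<in> deg (- 1)"
  shows "cppi (Delta Q (q \<otimes> p)) = tQ q \<otimes>\<^bsub>T\<^esub> tP p"
  using T.cp_pi_hom(2)[OF FS, of q p] assms by (simp add: theta_Q_eq_Delta)

lemma cppi_Delta_hom: "(\<lambda>x. cppi (Delta Q x)) \<in> add_hom (A\<lparr>carrier := L\<rparr>) T"
  using nu_ring_hom_add_hom[OF T.cp_pi_hom(1)[OF FS]] Delta_hom Delta_L_closed L_deg0
    cppi_Delta_closed
  by (auto simp: add_hom_def)

lemma relator_closed: "x \<in> L \<Longrightarrow> tR x \<ominus>\<^bsub>T\<^esub> cppi (Delta Q x) \<in> carrier T"
  using T.\<sigma>_closed[of x] cppi_Delta_closed by (auto simp: T.B.minus_eq L_deg0)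

lemma cp_ideal_gen: "I = nu_genideal T {tR x \<ominus>\<^bsub>T\<^esub> cppi (Delta Q x) | x. x \<in> L}"
  by (simp add: cp_ideal_eq toeplitz_ideal_def)

lemma cp_ideal: "nu_ideal I T"
  unfolding cp_ideal_gen by (rule nu_genideal_ideal[OF toeplitz_nu_ring]) (auto simp: relator_closed)

lemma CP_nu_ring: "nu_ring CP"
  and kappa_hom: "\<kappa> \<in> nu_ring_hom T CP"
  and kappa_surj: "\<kappa> ` carrier T = carrier CP"
  and kappa_eq_iff: "x \<in> carrier T \<Longrightarrow> y \<in> carrier T \<Longrightarrow> \<kappa> x = \<kappa> y \<longleftrightarrow> x \<ominus>\<^bsub>T\<^esub> y \<in> I"
  using nu_quotient_ring[OF toeplitz_nu_ring cp_ideal] nu_quotient_hom[OF toeplitz_nu_ring cp_ideal]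
    nu_quotient_surj[OF toeplitz_nu_ring cp_ideal] nu_quotient_eq_iff[OF toeplitz_nu_ring cp_ideal, of x y]
  by (simp_all add: cuntz_pimsner_ring_def cp_quotient_map_def[abs_def])

lemma kappa_closed: "x \<in> carrier T \<Longrightarrow> \<kappa> x \<in> carrier CP"
  and kappa_add: "x \<in> carrier T \<Longrightarrow> y \<in> carrier T \<Longrightarrow> \<kappa> (x \<oplus>\<^bsub>T\<^esub> y) = \<kappa> x \<oplus>\<^bsub>CP\<^esub> \<kappa> y"
  and kappa_mult: "x \<in> carrier T \<Longrightarrow> y \<in> carrier T \<Longrightarrow> \<kappa> (x \<otimes>\<^bsub>T\<^esub> y) = \<kappa> x \<otimes>\<^bsub>CP\<^esub> \<kappa> y"
  using kappa_hom by (auto simp: nu_ring_hom_def add_hom_def)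

lemma kappa_zero: "\<kappa> \<zero>\<^bsub>T\<^esub> = \<zero>\<^bsub>CP\<^esub>"
  by (rule add_hom_zero[OF nu_ring.axioms(1)[OF toeplitz_nu_ring] nu_ring.axioms(1)[OF CP_nu_ring]
        nu_ring_hom_add_hom[OF kappa_hom]])

lemma kappa_minus: "x \<in> carrier T \<Longrightarrow> \<kappa> (\<ominus>\<^bsub>T\<^esub> x) = \<ominus>\<^bsub>CP\<^esub> \<kappa> x"
  by (rule add_hom_minus[OF nu_ring.axioms(1)[OF toeplitz_nu_ring] nu_ring.axioms(1)[OF CP_nu_ring]
        nu_ring_hom_add_hom[OF kappa_hom]])

text \<open>This is the relator of \<open>q \<otimes> p\<close>, written out with the value of
  \<open>cppi\<close> at the rank one operator \<open>Delta Q (q \<otimes> p)\<close>.\<close>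

lemma kappa_QP:
  assumes "q \<in> deg 1" "p \<in> deg (- 1)"
  shows "\<kappa> (tQ q) \<otimes>\<^bsub>CP\<^esub> \<kappa> (tP p) = \<kappa> (tR (q \<otimes> p))"
proof -
  have L: "q \<otimes> p \<in> L" using assms by (simp add: L_def product_span_incl)
  then have "tR (q \<otimes> p) \<ominus>\<^bsub>T\<^esub> tQ q \<otimes>\<^bsub>T\<^esub> tP p \<in> I"
    using nu_genideal_incl[of "{tR x \<ominus>\<^bsub>T\<^esub> cppi (Delta Q x) | x. x \<in> L}" T] cppi_Delta_mult[OF assms]
    unfolding cp_ideal_gen by force
  then have "\<kappa> (tR (q \<otimes> p)) = \<kappa> (tQ q \<otimes>\<^bsub>T\<^esub> tP p)"
    using assms L by (subst kappa_eq_iff) (auto simp: T.ST_closed L_deg0)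
  then show ?thesis using assms by (simp add: kappa_mult T.ST_closed)
qed

text \<open>The inclusions form a covariant representation in \<open>A\<close>, so the Toeplitz ring
  maps to \<open>A\<close>. This map sends \<open>cppi (Delta Q x)\<close> back to \<open>x\<close>
  for \<open>x \<in> L\<close>, as both sides are additive in \<open>x\<close> and agree on products
  q p; hence the relators vanish and the map factors through the quotient.\<close>

lemma eta_ex:
  "\<exists>\<eta>\<in>nu_ring_hom CP A. (\<forall>r\<in>deg 0. \<eta> (\<kappa> (tR r)) = r) \<and> (\<forall>p\<in>deg (- 1). \<eta> (\<kappa> (tP p)) = p) \<and>
    (\<forall>q\<in>deg 1. \<eta> (\<kappa> (tQ q)) = q)"
proof -
  obtain h where h: "h \<in> nu_ring_hom T A" and hR: "\<And>r. r \<in> deg 0 \<Longrightarrow> h (tR r) = r"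
    and hP: "\<And>p. p \<in> deg (- 1) \<Longrightarrow> h (tP p) = p" and hQ: "\<And>q. q \<in> deg 1 \<Longrightarrow> h (tQ q) = q"
    using ex1_implies_ex[OF rs.toeplitz_universal[OF inclusion_covariant]] by (elim exE conjE) auto
  note h' = nu_ring_hom_add_hom[OF h]
  note Tg = nu_ring.axioms(1)[OF toeplitz_nu_ring[of R0 P Q \<psi>]]
  interpret L: additive_subgroup L A by (rule L_subgroup)
  let ?c = "\<lambda>x. h (cppi (Delta Q x))"
  have c: "?c \<in> add_hom (A\<lparr>carrier := L\<rparr>) A"
    using cppi_Delta_hom h' cppi_Delta_closed by (auto simp: add_hom_def Pi_iff)
  have "additive_subgroup {x \<in> L. ?c x = x} A"
  proof (rule additive_subgroupI)
    show "\<zero> \<in> {x \<in> L. ?c x = x}"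
      using add_hom_zero[OF additive_subgroup_group[OF L_subgroup] abelian_group_axioms c] by simp
    show "\<ominus> x \<in> {x \<in> L. ?c x = x}" if "x \<in> {x \<in> L. ?c x = x}" for x
      using add_hom_minus[OF additive_subgroup_group[OF L_subgroup] abelian_group_axioms c, of x] that
      by (simp add: additive_subgroup_minus[OF L_subgroup])
    show "x \<oplus> y \<in> {x \<in> L. ?c x = x}" if "x \<in> {x \<in> L. ?c x = x}" "y \<in> {x \<in> L. ?c x = x}" for x y
      using add_hom_add[OF c, of x y] that by simp
  qed (use L.a_subset in auto)
  then have "L \<subseteq> {x \<in> L. ?c x = x}"
    unfolding L_def[THEN eq_reflection, symmetric]
    by (subst L_def, intro product_span_minimal)
      (auto simp: cppi_Delta_mult nu_ring_hom_mult[OF h] T.ST_closed hP hQ product_span_incl L_def)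
  then have hL: "h (cppi (Delta Q x)) = x" if "x \<in> L" for x using that by auto
  have "I \<subseteq> {t \<in> carrier T. h t = \<zero>}"
    unfolding cp_ideal_gen
  proof (rule nu_genideal_minimal[OF nu_ideal_kernel[OF toeplitz_nu_ring nu_ring_axioms h]])
    show "{tR x \<ominus>\<^bsub>T\<^esub> cppi (Delta Q x) | x. x \<in> L} \<subseteq> {t \<in> carrier T. h t = \<zero>}"
    proof clarify
      fix x assume x: "x \<in> L"
      then have "h (tR x \<ominus>\<^bsub>T\<^esub> cppi (Delta Q x)) = x \<oplus> \<ominus> x"
        unfolding T.B.minus_eq
        by (simp add: add_hom_add[OF h'] add_hom_minus[OF Tg abelian_group_axioms h'] T.ST_closed
            L_deg0 cppi_Delta_closed hL hR)
      then show "tR x \<ominus>\<^bsub>T\<^esub> cppi (Delta Q x) \<in> carrier T \<and> h (tR x \<ominus>\<^bsub>T\<^esub> cppi (Delta Q x)) = \<zero>"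
        using x relator_closed L_deg0 by (simp add: r_neg deg_carrier)
    qed
  qed
  then have ker: "h t = h u" if "t \<in> carrier T" "u \<in> carrier T" "\<kappa> t = \<kappa> u" for t u
  proof -
    have "h (t \<ominus>\<^bsub>T\<^esub> u) = \<zero>" using \<open>I \<subseteq> _\<close> that kappa_eq_iff by auto
    then have "h t \<ominus> h u = \<zero>"
      using that by (simp add: T.B.minus_eq minus_eq add_hom_add[OF h'] add_hom_minus[OF Tg abelian_group_axioms h'])
    then show ?thesis by (rule eq_if_diff_zero[OF add_hom_closed[OF h' that(1)] add_hom_closed[OF h' that(2)]])
  qed
  obtain \<eta> where "\<eta> \<in> nu_ring_hom CP A" "\<And>t. t \<in> carrier T \<Longrightarrow> \<eta> (\<kappa> t) = h t"
  proof (rule nu_ring_hom_factor[OF toeplitz_nu_ring kappa_hom kappa_surj h])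
    show "h t = h u" if "t \<in> carrier T" "u \<in> carrier T" "\<kappa> t = \<kappa> u" for t u
      by (rule ker[OF that])
  qed blast
  then show ?thesis by (auto simp: T.ST_closed hR hP hQ intro!: bexI[of _ \<eta>])
qed

text \<open>The last branch is meant for \<open>k = - 1\<close>, the one remaining degree in which
  the map is considered.\<close>

definition \<iota> :: "int \<Rightarrow> 'a \<Rightarrow> ('a, 'a, 'a) toep set" where
  "\<iota> k x = \<kappa> (if k = 0 then tR x else if k = 1 then tQ x else tP x)"

lemma iota_simps: "\<iota> 0 x = \<kappa> (tR x)" "\<iota> 1 x = \<kappa> (tQ x)" "\<iota> (- 1) x = \<kappa> (tP x)"
  by (simp_all add: \<iota>_def)

lemma cp_representation_ex:
  "\<exists>\<eta>. cp_representation A deg CP \<iota> \<eta>"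
proof -
  obtain \<eta> where \<eta>: "\<eta> \<in> nu_ring_hom CP A" "\<And>r. r \<in> deg 0 \<Longrightarrow> \<eta> (\<kappa> (tR r)) = r"
    "\<And>p. p \<in> deg (- 1) \<Longrightarrow> \<eta> (\<kappa> (tP p)) = p" "\<And>q. q \<in> deg 1 \<Longrightarrow> \<eta> (\<kappa> (tQ q)) = q"
    using eta_ex by auto
  interpret CP: nu_ring CP by (rule CP_nu_ring)
  have tR: "tR x \<in> carrier T" if "x \<in> deg 0" for x using T.\<sigma>_closed that by simp
  have tQ: "tQ x \<in> carrier T" if "x \<in> deg 1" for x using T.T_closed that by simp
  have tP: "tP x \<in> carrier T" if "x \<in> deg (- 1)" for x using T.S_closed that by simp
  have "cp_representation A deg CP \<iota> \<eta>"
  proof unfold_locales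
    fix k :: int assume "k \<in> {- 1, 0, 1}"
    then consider "k = 0" | "k = 1" | "k = - 1" by auto
    then show "\<iota> k \<in> add_hom (component k) CP"
    proof cases
      case 1
      then show ?thesis
        using add_homD[OF nu_ring_hom_add_hom[OF T.\<sigma>_hom]]
        by (auto simp: add_hom_def iota_simps kappa_closed kappa_add)
    next
      case 2
      then show ?thesis
        using add_homD[OF T.T_hom] by (auto simp: add_hom_def iota_simps kappa_closed kappa_add)
    next
      case 3
      then show ?thesis
        using add_homD[OF T.S_hom] by (auto simp: add_hom_def iota_simps kappa_closed kappa_add)
    qed
  next
    fix j k :: int and x y
    assume jk: "j \<in> {- 1, 0, 1}" "k \<in> {- 1, 0, 1}" "j + k \<in> {- 1, 0, 1}" and xy: "x \<in> deg j" "y \<in> deg k"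
    consider "j = 0" "k = 0" | "j = 0" "k = 1" | "j = 0" "k = - 1" | "j = 1" "k = 0" | "j = - 1" "k = 0"
      | "j = 1" "k = - 1" | "j = - 1" "k = 1"
      using jk by auto
    then show "\<iota> j x \<otimes>\<^bsub>CP\<^esub> \<iota> k y = \<iota> (j + k) (x \<otimes> y)"
    proof cases
      case 1
      then show ?thesis
        using xy nu_ring_hom_mult[OF T.\<sigma>_hom, of x y] by (simp add: iota_simps kappa_mult[symmetric] tR)
    next
      case 2
      then show ?thesis
        using xy T.T_act(2)[of y x] by (simp add: iota_simps kappa_mult[symmetric] tR tQ)
    next
      case 3
      then show ?thesis
        using xy T.S_act(2)[of y x] by (simp add: iota_simps kappa_mult[symmetric] tR tP)
    next
      case 4
      then show ?thesis
        using xy T.T_act(1)[of x y] by (simp add: iota_simps kappa_mult[symmetric] tR tQ)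
    next
      case 5
      then show ?thesis
        using xy T.S_act(1)[of x y] by (simp add: iota_simps kappa_mult[symmetric] tR tP)
    next
      \<comment> \<open>The one relation that comes from the quotient and not from the Toeplitz
        ring.\<close>
      case 6
      then show ?thesis using xy kappa_QP by (simp add: iota_simps)
    next
      case 7
      then show ?thesis
        using xy T.\<sigma>_psi[of x y] by (simp add: iota_simps kappa_mult[symmetric] tQ tP psi_pure)
    qed
  next
    fix k :: int and x assume "k \<in> {- 1, 0, 1}" "x \<in> deg k"
    then show "\<eta> (\<iota> k x) = x" using \<eta> by (auto simp: iota_simps)
  next
    fix X assume X: "additive_subgroup X CP" "\<And>x y. x \<in> X \<Longrightarrow> y \<in> X \<Longrightarrow> x \<otimes>\<^bsub>CP\<^esub> y \<in> X"
      "\<And>k. k \<in> {- 1, 0, 1} \<Longrightarrow> \<iota> k ` deg k \<subseteq> X"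
    interpret X: additive_subgroup X CP by (rule X)
    have "carrier T \<subseteq> {t \<in> carrier T. \<kappa> t \<in> X}"
    proof (rule toeplitz_generated)
      show "additive_subgroup {t \<in> carrier T. \<kappa> t \<in> X} T"
        by (rule T.B.additive_subgroupI) (auto simp: kappa_zero kappa_minus kappa_add)
    qed (use X(2) X(3)[of 0] X(3)[of 1] X(3)[of "- 1"] in
        \<open>auto simp: kappa_mult T.B.nu_m_closed tR tP tQ iota_simps\<close>)
    then show "carrier CP \<subseteq> X" unfolding kappa_surj[symmetric] by auto
  qed (rule \<eta>)
  then show ?thesis by (rule exI[of _ \<eta>])
qed

lemma homogeneous_closed: "toep_homogeneous R0 P Q \<psi> n t \<Longrightarrow> t \<in> carrier T"
  by (induction rule: toep_homogeneous.induct) (auto simp: T.ST_closed)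

theorem cuntz_pimsner_graded_iso:
  obtains \<phi> where "\<phi> \<in> nu_ring_hom A CP" "bij_betw \<phi> (carrier A) (carrier CP)"
    "\<And>n. \<phi> ` deg n = cp_component R0 P Q \<psi> n"
    "\<And>r. r \<in> deg 0 \<Longrightarrow> \<phi> r = \<kappa> (tR r)" "\<And>p. p \<in> deg (- 1) \<Longrightarrow> \<phi> p = \<kappa> (tP p)"
    "\<And>q. q \<in> deg 1 \<Longrightarrow> \<phi> q = \<kappa> (tQ q)"
proof -
  obtain \<eta> where "cp_representation A deg CP \<iota> \<eta>" using cp_representation_ex by auto
  then interpret cp: cp_representation A deg CP \<iota> \<eta> .
  define \<phi> where "\<phi> = inv_into (carrier CP) \<eta>"
  have inj: "inj_on \<eta> (carrier CP)" using cp.eta_bij by (simp add: bij_betw_def)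
  have \<phi>\<eta>: "\<phi> (\<eta> x) = x" if "x \<in> carrier CP" for x
    unfolding \<phi>_def by (rule inv_into_f_f[OF inj that])
  have "\<phi> (\<eta> (\<iota> k x)) = \<iota> k x" if "k \<in> {- 1, 0, 1}" "x \<in> deg k" for k x
    by (rule \<phi>\<eta>[OF cp.iota_closed[OF that]])
  then have \<phi>\<iota>: "\<phi> x = \<iota> k x" if "k \<in> {- 1, 0, 1}" "x \<in> deg k" for k x
    using that cp.eta_iota[OF that] by metis
  \<comment> \<open>Products of generators contract to reduced words of the same degree, and
    conversely a reduced word lifts to the Toeplitz ring letter by letter.\<close>
  have comp: "cp_component R0 P Q \<psi> n = {w. cp.word n w}" for n
  proof
    have "cp.word n (\<kappa> t)" if "toep_homogeneous R0 P Q \<psi> n t" for n t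
      using that
    proof induction
      case (1 r)
      then show ?case using cp.word_iota[of 0 r] by (simp add: iota_simps)
    next
      case (2 q)
      then show ?case using cp.word_iota[of 1 q] by (simp add: iota_simps)
    next
      case (3 p)
      then show ?case using cp.word_iota[of "- 1" p] by (simp add: iota_simps)
    qed (auto simp: kappa_zero kappa_minus kappa_add kappa_mult homogeneous_closed
        intro: cp.word.zero cp.word.minus cp.word.add cp.word_mult)
    then show "cp_component R0 P Q \<psi> n \<subseteq> {w. cp.word n w}"
      by (auto simp: cp_component_def toeplitz_component_def)
    have "\<exists>t. toep_homogeneous R0 P Q \<psi> n t \<and> \<kappa> t = w" if "cp.word n w" for n w
      using that
    proof induction
      case (base r)
      then show ?case by (intro exI[of _ "tR r"]) (auto simp: iota_simps intro: toep_homogeneous.intros(1))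
    next
      case (pos n w q)
      then obtain t where "toep_homogeneous R0 P Q \<psi> n t" "\<kappa> t = w" by auto
      with pos(3) show ?case
        using toep_homogeneous.intros(7)[of R0 P Q \<psi> n t 1 "tQ q"] toep_homogeneous.intros(2)[of q Q R0 P \<psi>]
        by (intro exI[of _ "t \<otimes>\<^bsub>T\<^esub> tQ q"])
          (auto simp: iota_simps kappa_mult T.ST_closed homogeneous_closed)
    next
      case (neg n w p)
      then obtain t where "toep_homogeneous R0 P Q \<psi> n t" "\<kappa> t = w" by auto
      with neg(3) show ?case
        using toep_homogeneous.intros(7)[of R0 P Q \<psi> n t "- 1" "tP p"] toep_homogeneous.intros(3)[of p P R0 Q \<psi>]
        by (intro exI[of _ "t \<otimes>\<^bsub>T\<^esub> tP p"])
          (auto simp: iota_simps kappa_mult T.ST_closed homogeneous_closed)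
    next
      case (zero n)
      show ?case by (intro exI[of _ "\<zero>\<^bsub>T\<^esub>"]) (simp add: kappa_zero toep_homogeneous.intros(4))
    next
      case (minus n w)
      then obtain t where "toep_homogeneous R0 P Q \<psi> n t" "\<kappa> t = w" by auto
      then show ?case
        by (intro exI[of _ "\<ominus>\<^bsub>T\<^esub> t"]) (auto simp: kappa_minus homogeneous_closed intro: toep_homogeneous.intros(5))
    next
      case (add n w w')
      then obtain t t' where "toep_homogeneous R0 P Q \<psi> n t" "\<kappa> t = w"
        "toep_homogeneous R0 P Q \<psi> n t'" "\<kappa> t' = w'" by auto
      then show ?case
        by (intro exI[of _ "t \<oplus>\<^bsub>T\<^esub> t'"]) (auto simp: kappa_add homogeneous_closed intro: toep_homogeneous.intros(6))
    qed
    then show "{w. cp.word n w} \<subseteq> cp_component R0 P Q \<psi> n"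
      unfolding cp_component_def toeplitz_component_def by blast
  qed
  show thesis
  proof
    show "\<phi> \<in> nu_ring_hom A CP"
      unfolding \<phi>_def by (rule nu_ring_hom_inv_into[OF CP_nu_ring cp.eta_hom cp.eta_bij])
    show "bij_betw \<phi> (carrier A) (carrier CP)"
      unfolding \<phi>_def by (rule bij_betw_inv_into[OF cp.eta_bij])
    show "\<phi> ` deg n = cp_component R0 P Q \<psi> n" for n
      unfolding comp cp.eta_word_image[of n, symmetric]
      using cp.word_closed \<phi>\<eta> by (auto simp: image_image)
    show "\<phi> r = \<kappa> (tR r)" if "r \<in> deg 0" for r using \<phi>\<iota>[of 0 r] that by (simp add: iota_simps)
    show "\<phi> p = \<kappa> (tP p)" if "p \<in> deg (- 1)" for p using \<phi>\<iota>[of "- 1" p] that by (simp add: iota_simps)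
    show "\<phi> q = \<kappa> (tQ q)" if "q \<in> deg 1" for q using \<phi>\<iota>[of 1 q] that by (simp add: iota_simps)
  qed
qed

text \<open>In degrees \<open>0\<close>, \<open>1\<close> and \<open>- 1\<close> the map
  \<open>\<phi>\<close> restricts to the canonical maps, so scalars transported along
  \<open>\<phi>\<close> make these linear once scaling preserves degrees.\<close>

theorem cuntz_pimsner_graded_algebra_iso:
  fixes s :: "'k::field \<Rightarrow> 'a \<Rightarrow> 'a"
  assumes alg: "k_algebra s A" and s: "\<And>k n x. x \<in> deg n \<Longrightarrow> s k x \<in> deg n"
  shows "\<exists>s' \<phi>. cp_algebra_structure s s s R0 P Q \<psi> s' \<and>
    graded_algebra_iso s A deg s' CP (cp_component R0 P Q \<psi>) \<phi>"
proof -
  obtain \<phi> where \<phi>: "\<phi> \<in> nu_ring_hom A CP" "bij_betw \<phi> (carrier A) (carrier CP)"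
    "\<And>n. \<phi> ` deg n = cp_component R0 P Q \<psi> n"
    "\<And>r. r \<in> deg 0 \<Longrightarrow> \<phi> r = \<kappa> (tR r)" "\<And>p. p \<in> deg (- 1) \<Longrightarrow> \<phi> p = \<kappa> (tP p)"
    "\<And>q. q \<in> deg 1 \<Longrightarrow> \<phi> q = \<kappa> (tQ q)"
    by (rule cuntz_pimsner_graded_iso) blast
  define s' where "s' k x = \<phi> (s k (inv_into (carrier A) \<phi> x))" for k x
  have inj: "inj_on \<phi> (carrier A)" using \<phi>(2) by (simp add: bij_betw_def)
  have lin: "s' k (\<phi> x) = \<phi> (s k x)" if "x \<in> carrier A" for k x
    by (simp add: s'_def inv_into_f_f[OF inj that])
  have "k_algebra s' CP"
    unfolding s'_def[abs_def] by (rule k_algebra_transport[OF alg CP_nu_ring \<phi>(1,2)])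
  moreover have "s' k (\<kappa> (tR x)) = \<kappa> (tR (s k x))" if "x \<in> deg 0" for k x
    using lin[OF deg_carrier[OF that], of k] \<phi>(4)[OF that] \<phi>(4)[OF s[OF that]] by simp
  moreover have "s' k (\<kappa> (tP x)) = \<kappa> (tP (s k x))" if "x \<in> deg (- 1)" for k x
    using lin[OF deg_carrier[OF that], of k] \<phi>(5)[OF that] \<phi>(5)[OF s[OF that]] by simp
  moreover have "s' k (\<kappa> (tQ x)) = \<kappa> (tQ (s k x))" if "x \<in> deg 1" for k x
    using lin[OF deg_carrier[OF that], of k] \<phi>(6)[OF that] \<phi>(6)[OF s[OF that]] by simp
  ultimately have "cp_algebra_structure s s s R0 P Q \<psi> s'"
    by (simp add: cp_algebra_structure_def k_linear_on_def)
  moreover have "graded_algebra_iso s A deg s' CP (cp_component R0 P Q \<psi>) \<phi>"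
    using \<phi>(1-3) lin by (simp add: graded_algebra_iso_def k_linear_on_def)
  ultimately show ?thesis by blast
qed

end

section \<open>Groupoids\<close>

context groupoid
begin

lemma composable_iff: "(x, y) \<in> composable G \<longleftrightarrow> x \<in> arrows G \<and> y \<in> arrows G \<and> src G x = rng G y"
  by (simp add: composable_def)

lemma comp_closed: "x \<in> arrows G \<Longrightarrow> y \<in> arrows G \<Longrightarrow> src G x = rng G y \<Longrightarrow> gcomp G x y \<in> arrows G"
  and rng_comp: "x \<in> arrows G \<Longrightarrow> y \<in> arrows G \<Longrightarrow> src G x = rng G y \<Longrightarrow> rng G (gcomp G x y) = rng G x"
  and src_comp: "x \<in> arrows G \<Longrightarrow> y \<in> arrows G \<Longrightarrow> src G x = rng G y \<Longrightarrow> src G (gcomp G x y) = src G y"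
  by (simp_all add: gcomp_closed rng_gcomp src_gcomp composable_iff)

lemma comp_assoc:
  "x \<in> arrows G \<Longrightarrow> y \<in> arrows G \<Longrightarrow> z \<in> arrows G \<Longrightarrow> src G x = rng G y \<Longrightarrow> src G y = rng G z \<Longrightarrow>
    gcomp G (gcomp G x y) z = gcomp G x (gcomp G y z)"
  by (simp add: gcomp_assoc composable_iff)

lemmas closures = rng_closed src_closed ginv_closed comp_closed

lemma inv_comp_cancel:
  "x \<in> arrows G \<Longrightarrow> y \<in> arrows G \<Longrightarrow> src G x = rng G y \<Longrightarrow> gcomp G (ginv G x) (gcomp G x y) = y"
  by (simp add: comp_assoc[symmetric] closures src_ginv gcomp_ginv_left rng_gcomp_left)

lemma comp_inv_cancel:
  "x \<in> arrows G \<Longrightarrow> z \<in> arrows G \<Longrightarrow> rng G x = rng G z \<Longrightarrow> gcomp G x (gcomp G (ginv G x) z) = z"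
  by (simp add: comp_assoc[symmetric] closures src_ginv rng_ginv gcomp_ginv_right rng_gcomp_left)

lemma comp_inv_cancel_right:
  "x \<in> arrows G \<Longrightarrow> y \<in> arrows G \<Longrightarrow> src G x = rng G y \<Longrightarrow> gcomp G (gcomp G x y) (ginv G y) = x"
  by (simp add: comp_assoc closures rng_ginv gcomp_ginv_right) (metis src_gcomp_right)

lemma ginv_ginv:
  assumes "x \<in> arrows G" shows "ginv G (ginv G x) = x"
proof -
  have "x = gcomp G x (gcomp G (ginv G x) (ginv G (ginv G x)))"
    using assms by (simp add: gcomp_ginv_right ginv_closed rng_ginv src_gcomp_right)
  also have "\<dots> = ginv G (ginv G x)"
    using assms by (intro comp_inv_cancel) (simp_all add: closures rng_ginv src_ginv)
  finally show ?thesis by simp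
qed

definition units :: "'g set" where "units = rng G ` arrows G"

lemma units_iff: "u \<in> units \<longleftrightarrow> u \<in> arrows G \<and> rng G u = u"
proof
  assume "u \<in> arrows G \<and> rng G u = u"
  then show "u \<in> units" unfolding units_def by (metis image_eqI)
qed (auto simp: units_def rng_closed rng_rng)

lemma units_src: "u \<in> units \<Longrightarrow> src G u = u"
  by (auto simp: units_def src_rng)

lemma rng_units: "x \<in> arrows G \<Longrightarrow> rng G x \<in> units" and src_units: "x \<in> arrows G \<Longrightarrow> src G x \<in> units"
  by (simp_all add: units_iff closures rng_rng rng_src)

lemma set_compI:
  "x \<in> X \<Longrightarrow> y \<in> Y \<Longrightarrow> src G x = rng G y \<Longrightarrow> gcomp G x y \<in> set_comp G X Y"
  by (auto simp: set_comp_def)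

lemma set_comp_assoc:
  assumes "X \<subseteq> arrows G" "Y \<subseteq> arrows G" "Z \<subseteq> arrows G"
  shows "set_comp G (set_comp G X Y) Z = set_comp G X (set_comp G Y Z)"
proof
  show "set_comp G (set_comp G X Y) Z \<subseteq> set_comp G X (set_comp G Y Z)"
  proof
    fix w assume "w \<in> set_comp G (set_comp G X Y) Z"
    then obtain x y z where "x \<in> X" "y \<in> Y" "z \<in> Z" "src G x = rng G y"
      "src G (gcomp G x y) = rng G z" "w = gcomp G (gcomp G x y) z"
      by (auto simp: set_comp_def)
    with assms show "w \<in> set_comp G X (set_comp G Y Z)"
      by (auto simp: comp_assoc src_comp rng_comp subset_iff intro!: set_compI)
  qed
  show "set_comp G X (set_comp G Y Z) \<subseteq> set_comp G (set_comp G X Y) Z"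
  proof
    fix w assume "w \<in> set_comp G X (set_comp G Y Z)"
    then obtain x y z where "x \<in> X" "y \<in> Y" "z \<in> Z" "src G y = rng G z"
      "src G x = rng G (gcomp G y z)" "w = gcomp G x (gcomp G y z)"
      by (auto simp: set_comp_def)
    with assms show "w \<in> set_comp G (set_comp G X Y) Z"
      by (auto simp: comp_assoc[symmetric] src_comp rng_comp subset_iff intro!: set_compI)
  qed
qed

end

section \<open>Bisections of ample groupoids\<close>

context topological_groupoid
begin

lemma continuous_comp:
  assumes f: "continuous_map X (gtop G) f" and g: "continuous_map X (gtop G) g"
    and fg: "\<And>x. x \<in> topspace X \<Longrightarrow> src G (f x) = rng G (g x)"
  shows "continuous_map X (gtop G) (\<lambda>x. gcomp G (f x) (g x))"
proof -
  have "continuous_map X (prod_topology (gtop G) (gtop G)) (\<lambda>x. (f x, g x))"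
    using f g by (simp add: continuous_map_paired)
  then have "continuous_map X (subtopology (prod_topology (gtop G) (gtop G)) (composable G)) (\<lambda>x. (f x, g x))"
    using f g fg by (intro continuous_map_into_subtopology) (auto simp: composable_iff continuous_map_def)
  from continuous_map_compose[OF this continuous_gcomp] show ?thesis by (simp add: o_def)
qed

text \<open>Continuity of the range is not an axiom; it follows from r(x) = x x^{-1}.\<close>

lemma continuous_rng: "continuous_map (gtop G) (gtop G) (rng G)"
  by (rule continuous_map_eq[OF continuous_comp[of _ "\<lambda>x. x" "ginv G"]])
    (auto simp: continuous_ginv rng_ginv gcomp_ginv_right)

lemma continuous_src: "continuous_map (gtop G) (gtop G) (src G)"
  by (rule continuous_map_eq[OF continuous_comp[of _ "ginv G" "\<lambda>x. x"]])
    (auto simp: continuous_ginv src_ginv gcomp_ginv_left)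

lemma ginv_image_eq:
  assumes "B \<subseteq> arrows G"
  shows "ginv G ` B = {x \<in> arrows G. ginv G x \<in> B}"
proof
  show "{x \<in> arrows G. ginv G x \<in> B} \<subseteq> ginv G ` B"
  proof clarify
    fix x assume "x \<in> arrows G" "ginv G x \<in> B"
    then show "x \<in> ginv G ` B" using imageI[of "ginv G x" B "ginv G"] by (simp add: ginv_ginv)
  qed
qed (use assms in \<open>auto simp: ginv_ginv ginv_closed\<close>)

lemma openin_ginv: "openin (gtop G) B \<Longrightarrow> openin (gtop G) (ginv G ` B)"
  using openin_continuous_map_preimage[OF continuous_ginv] by (simp add: ginv_image_eq openin_subset)

end

context ample_hausdorff_groupoid
begin

lemma bisection_nbhd:
  assumes "openin (gtop G) U" "x \<in> U"
  obtains B where "compact_open_bisection G B" "x \<in> B" "B \<subseteq> U"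
  using compact_open_bisection_base[OF assms] by blast

lemma bisection_open: "compact_open_bisection G B \<Longrightarrow> openin (gtop G) B"
  and bisection_compact: "compact_open_bisection G B \<Longrightarrow> compactin (gtop G) B"
  by (auto simp: compact_open_bisection_def open_bisection_def)

lemma bisection_inj_rng: "compact_open_bisection G B \<Longrightarrow> inj_on (rng G) B"
  and bisection_inj_src: "compact_open_bisection G B \<Longrightarrow> inj_on (src G) B"
  using homeomorphic_imp_injective_map[of "subtopology (gtop G) B"] openin_subset[of "gtop G" B]
  by (auto simp: compact_open_bisection_def open_bisection_def Int_absorb1)

lemma bisection_subset: "compact_open_bisection G B \<Longrightarrow> B \<subseteq> arrows G"
  by (simp add: bisection_open openin_subset)

lemma compact_closed: "compactin (gtop G) K \<Longrightarrow> closedin (gtop G) K"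
  by (rule compactin_imp_closedin[OF hausdorff])

text \<open>If \<open>B\<close> is a bisection around a unit \<open>u\<close>, then the elements \<open>x\<close> of \<open>B\<close> with \<open>r x\<close> in \<open>B\<close> form a
  neighbourhood of \<open>u\<close> consisting of units, as \<open>r (r x) = r x\<close>.\<close>

lemma openin_units: "openin (gtop G) units"
proof (subst openin_subopen, intro ballI)
  fix u assume u: "u \<in> units"
  then have "u \<in> arrows G" "rng G u = u" by (auto simp: units_iff)
  then obtain B where B: "compact_open_bisection G B" "u \<in> B"
    using bisection_nbhd[OF openin_topspace, of u] by auto
  let ?W = "{x \<in> B. rng G x \<in> B}"
  have "openin (gtop G) ?W"
    using openin_continuous_map_preimage_gen[OF continuous_rng] bisection_open[OF B(1)] by blast
  moreover have "u \<in> ?W" using B \<open>rng G u = u\<close> by simp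
  moreover have "?W \<subseteq> units"
    using bisection_inj_rng[OF B(1)] bisection_subset[OF B(1)] by (auto simp: units_iff rng_rng inj_on_def)
  ultimately show "\<exists>T. openin (gtop G) T \<and> u \<in> T \<and> T \<subseteq> units" by blast
qed

lemma openin_unit_space: "openin (unit_space G) V \<longleftrightarrow> openin (gtop G) V \<and> V \<subseteq> units"
  using openin_open_subtopology[OF openin_units] by (simp add: unit_space_def units_def)

text \<open>Every open set is a union of bisections, whose ranges are open in the unit space, and
  the unit space is open in the space of arrows.\<close>

lemma openin_rng:
  assumes W: "openin (gtop G) W" shows "openin (gtop G) (rng G ` W)"
proof (subst openin_subopen, intro ballI)
  fix u assume "u \<in> rng G ` W"
  then obtain x where x: "x \<in> W" "u = rng G x" by blast
  obtain B where B: "compact_open_bisection G B" "x \<in> B" "B \<subseteq> W" using bisection_nbhd[OF W x(1)] .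
  have "openin (unit_space G) (rng G ` B)"
    using B(1) by (simp add: compact_open_bisection_def open_bisection_def)
  then show "\<exists>T. openin (gtop G) T \<and> u \<in> T \<and> T \<subseteq> rng G ` W"
    using B x by (intro exI[of _ "rng G ` B"]) (auto simp: openin_unit_space)
qed

lemma src_image_eq: "B \<subseteq> arrows G \<Longrightarrow> src G ` B = rng G ` ginv G ` B"
  unfolding image_image by (rule image_cong) (auto simp: rng_ginv)

lemma openin_src: "openin (gtop G) W \<Longrightarrow> openin (gtop G) (src G ` W)"
  by (simp add: src_image_eq openin_subset openin_rng openin_ginv)

text \<open>Both \<open>rng\<close> and \<open>src\<close> are continuous and open, so the
  homeomorphism clauses of a bisection reduce to injectivity.\<close>

lemma bisectionI:
  assumes B: "openin (gtop G) B" "compactin (gtop G) B" and inj: "inj_on (rng G) B" "inj_on (src G) B"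
  shows "compact_open_bisection G B"
proof -
  note sub = openin_subset[OF B(1)]
  have hom: "homeomorphic_map (subtopology (gtop G) B) (subtopology (unit_space G) (f ` B)) f"
    if cont: "continuous_map (gtop G) (gtop G) f" and op: "\<And>W. openin (gtop G) W \<Longrightarrow> openin (gtop G) (f ` W)"
      and f: "inj_on f B" "f ` B \<subseteq> units" for f
  proof (rule bijective_open_imp_homeomorphic_map)
    have top: "subtopology (unit_space G) (f ` B) = subtopology (gtop G) (f ` B)"
      using f(2) by (simp add: unit_space_def subtopology_subtopology units_def Int_absorb1)
    have tB: "topspace (subtopology (gtop G) B) = B" using sub by auto
    have tfB: "topspace (subtopology (unit_space G) (f ` B)) = f ` B"
      using f(2) unfolding top by (auto simp: units_iff)
    show "continuous_map (subtopology (gtop G) B) (subtopology (unit_space G) (f ` B)) f"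
      unfolding top by (rule continuous_map_into_subtopology)
        (use cont in \<open>auto simp: continuous_map_from_subtopology\<close>)
    show "open_map (subtopology (gtop G) B) (subtopology (unit_space G) (f ` B)) f"
      using op unfolding open_map_def top by (auto simp: openin_open_subtopology B(1))
    show "f ` topspace (subtopology (gtop G) B) = topspace (subtopology (unit_space G) (f ` B))"
      by (simp only: tB tfB)
    show "inj_on f (topspace (subtopology (gtop G) B))" using f(1) by (simp only: tB)
  qed
  have "rng G ` B \<subseteq> units" "src G ` B \<subseteq> units" using sub by (auto intro: rng_units src_units)
  then show ?thesis
    using hom[OF continuous_rng openin_rng inj(1)] hom[OF continuous_src openin_src inj(2)] B
    by (auto simp: compact_open_bisection_def open_bisection_def openin_unit_space openin_rng openin_src)
qed

lemma bisection_mono: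
  assumes "compact_open_bisection G B" "openin (gtop G) C" "compactin (gtop G) C" "C \<subseteq> B"
  shows "compact_open_bisection G C"
  by (rule bisectionI[OF assms(2,3)])
    (rule inj_on_subset[OF bisection_inj_rng[OF assms(1)] assms(4)],
      rule inj_on_subset[OF bisection_inj_src[OF assms(1)] assms(4)])

lemma bisection_Int_clopen:
  assumes "compact_open_bisection G B" "openin (gtop G) C" "closedin (gtop G) C"
  shows "compact_open_bisection G (B \<inter> C)"
  by (rule bisection_mono[OF assms(1)])
    (simp_all add: assms openin_Int bisection_open compact_Int_closedin bisection_compact)

lemma bisection_empty: "compact_open_bisection G {}"
  by (rule bisectionI) auto

lemma bisection_units:
  assumes "openin (gtop G) V" "compactin (gtop G) V" "V \<subseteq> units"
  shows "compact_open_bisection G V"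
  by (rule bisectionI) (use assms in \<open>auto simp: inj_on_def units_iff units_src subset_iff\<close>)

lemma bisection_ginv:
  assumes "compact_open_bisection G B"
  shows "compact_open_bisection G (ginv G ` B)"
proof (rule bisectionI)
  note sub = bisection_subset[OF assms]
  show "inj_on (rng G) (ginv G ` B)" "inj_on (src G) (ginv G ` B)"
    using bisection_inj_rng[OF assms] bisection_inj_src[OF assms] sub
    by (auto simp: inj_on_def rng_ginv src_ginv subset_iff)
qed (rule openin_ginv[OF bisection_open[OF assms]],
    rule image_compactin[OF bisection_compact[OF assms] continuous_ginv])

text \<open>The composable pairs form the equalizer of two continuous maps into a Hausdorff space,
  hence a closed set. Compactness is stated in the subspace because composition is continuous only
  there.\<close>

lemma compact_composable:
  assumes "compactin (gtop G) X" "compactin (gtop G) Y"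
  shows "compactin (subtopology (prod_topology (gtop G) (gtop G)) (composable G)) ((X \<times> Y) \<inter> composable G)"
proof -
  let ?P = "prod_topology (gtop G) (gtop G)"
  have "continuous_map ?P (gtop G) (src G \<circ> fst)" "continuous_map ?P (gtop G) (rng G \<circ> snd)"
    by (rule continuous_map_compose[OF continuous_map_fst continuous_src],
        rule continuous_map_compose[OF continuous_map_snd continuous_rng])
  then have "closedin ?P {p \<in> topspace ?P. (src G \<circ> fst) p = (rng G \<circ> snd) p}"
    using closedin_continuous_maps_eq[OF hausdorff] by blast
  moreover have "{p \<in> topspace ?P. (src G \<circ> fst) p = (rng G \<circ> snd) p} = composable G"
    by (auto simp: composable_def)
  ultimately have "closedin ?P (composable G)" by simp
  then have "compactin ?P ((X \<times> Y) \<inter> composable G)"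
    using assms by (intro compact_Int_closedin) (auto simp: compactin_Times)
  then show ?thesis by (simp add: compactin_subtopology)
qed

lemma compactin_set_comp:
  assumes "compactin (gtop G) X" "compactin (gtop G) Y"
  shows "compactin (gtop G) (set_comp G X Y)"
proof -
  have "set_comp G X Y = (\<lambda>(x, y). gcomp G x y) ` ((X \<times> Y) \<inter> composable G)"
    using compactin_subset_topspace[OF assms(1)] compactin_subset_topspace[OF assms(2)]
    by (force simp: set_comp_def composable_def)
  then show ?thesis using image_compactin[OF compact_composable[OF assms] continuous_gcomp] by simp
qed

text \<open>Near z = x y an arrow w factors as v (v^{-1} w): as \<open>rng\<close> is open, some v
  close to x has the same range as w, and continuity of composition at (x^{-1}, z) keeps v^{-1} w
  inside \<open>Y\<close>.\<close>

lemma openin_set_comp: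
  assumes X: "openin (gtop G) X" and Y: "openin (gtop G) Y"
  shows "openin (gtop G) (set_comp G X Y)"
proof (subst openin_subopen, intro ballI)
  fix z assume "z \<in> set_comp G X Y"
  then obtain x y where xy: "x \<in> X" "y \<in> Y" "src G x = rng G y" "z = gcomp G x y" by (auto simp: set_comp_def)
  note arr = openin_subset[OF X] openin_subset[OF Y]
  have a: "x \<in> arrows G" "y \<in> arrows G" using arr xy by auto
  obtain B where B: "compact_open_bisection G B" "x \<in> B" "B \<subseteq> X" using bisection_nbhd[OF X xy(1)] .
  let ?P = "prod_topology (gtop G) (gtop G)"
  let ?C = "subtopology ?P (composable G)"
  let ?W = "{p \<in> topspace ?C. (\<lambda>(x, y). gcomp G x y) p \<in> Y}"
  have "openin ?C ?W" by (rule openin_continuous_map_preimage[OF continuous_gcomp Y])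
  then obtain W where W: "openin ?P W" "?W = W \<inter> composable G" by (auto simp: openin_subtopology)
  have "(ginv G x, z) \<in> ?W"
    using a xy by (auto simp: composable_iff closures rng_comp src_ginv inv_comp_cancel)
  then have zW: "(ginv G x, z) \<in> W" unfolding W(2) by (rule IntD1)
  obtain N1 N2 where N: "openin (gtop G) N1" "openin (gtop G) N2" "ginv G x \<in> N1" "z \<in> N2" "N1 \<times> N2 \<subseteq> W"
    using W(1)[unfolded openin_prod_topology_alt, rule_format, OF zW] by blast
  let ?N = "B \<inter> ginv G ` N1"
  have oN: "openin (gtop G) ?N" using bisection_open[OF B(1)] openin_ginv[OF N(1)] by blast
  let ?T = "{w \<in> N2. rng G w \<in> rng G ` ?N}"
  have "openin (gtop G) ?T"
    by (rule openin_continuous_map_preimage_gen[OF continuous_rng N(2) openin_rng[OF oN]])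
  moreover have "z \<in> ?T"
    using N(3,4) B(2) a xy by (force simp: rng_comp ginv_ginv)
  moreover have "?T \<subseteq> set_comp G X Y"
  proof
    fix w assume "w \<in> ?T"
    then obtain n v where w: "w \<in> N2" "v \<in> B" and "rng G w = rng G v" and n: "n \<in> N1" "v = ginv G n" by auto
    have arr': "w \<in> arrows G" "v \<in> arrows G" "n \<in> arrows G"
      using w n openin_subset[OF N(2)] openin_subset[OF N(1)] bisection_subset[OF B(1)] by auto
    have "(ginv G v, w) \<in> W" using n w N(5) arr' by (auto simp: ginv_ginv)
    moreover have "(ginv G v, w) \<in> composable G"
      using arr' \<open>rng G w = rng G v\<close> by (simp add: composable_iff closures src_ginv)
    ultimately have "(ginv G v, w) \<in> ?W" unfolding W(2) by (rule IntI)
    then have y: "gcomp G (ginv G v) w \<in> Y" by auto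
    have eq: "w = gcomp G v (gcomp G (ginv G v) w)"
      using arr' \<open>rng G w = rng G v\<close> by (simp add: comp_inv_cancel)
    have "gcomp G v (gcomp G (ginv G v) w) \<in> set_comp G X Y"
    proof (rule set_compI)
      show "v \<in> X" using w B by auto
      show "gcomp G (ginv G v) w \<in> Y" by (rule y)
      show "src G v = rng G (gcomp G (ginv G v) w)"
        using arr' \<open>rng G w = rng G v\<close> by (simp add: rng_comp ginv_closed src_ginv rng_ginv)
    qed
    then show "w \<in> set_comp G X Y" by (subst eq)
  qed
  ultimately show "\<exists>T. openin (gtop G) T \<and> z \<in> T \<and> T \<subseteq> set_comp G X Y" by blast
qed

lemma bisection_set_comp:
  assumes X: "compact_open_bisection G X" and Y: "compact_open_bisection G Y"
  shows "compact_open_bisection G (set_comp G X Y)"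
proof (rule bisectionI)
  note sub = bisection_subset[OF X] bisection_subset[OF Y]
  note inj = bisection_inj_rng[OF X] bisection_inj_rng[OF Y] bisection_inj_src[OF X] bisection_inj_src[OF Y]
  show "inj_on (rng G) (set_comp G X Y)"
  proof (rule inj_onI)
    fix z z' assume "z \<in> set_comp G X Y" "z' \<in> set_comp G X Y" "rng G z = rng G z'"
    then obtain x y x' y' where *: "x \<in> X" "y \<in> Y" "src G x = rng G y" "z = gcomp G x y"
      "x' \<in> X" "y' \<in> Y" "src G x' = rng G y'" "z' = gcomp G x' y'"
      by (auto simp: set_comp_def)
    with sub \<open>rng G z = rng G z'\<close> have "rng G x = rng G x'" by (auto simp: rng_comp subset_iff)
    with * inj(1) have "x = x'" by (auto simp: inj_on_def)
    with * inj(2) have "y = y'" by (auto simp: inj_on_def)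
    with * \<open>x = x'\<close> show "z = z'" by simp
  qed
  show "inj_on (src G) (set_comp G X Y)"
  proof (rule inj_onI)
    fix z z' assume "z \<in> set_comp G X Y" "z' \<in> set_comp G X Y" "src G z = src G z'"
    then obtain x y x' y' where *: "x \<in> X" "y \<in> Y" "src G x = rng G y" "z = gcomp G x y"
      "x' \<in> X" "y' \<in> Y" "src G x' = rng G y'" "z' = gcomp G x' y'"
      by (auto simp: set_comp_def)
    with sub \<open>src G z = src G z'\<close> have "src G y = src G y'" by (auto simp: src_comp subset_iff)
    with * inj(4) have "y = y'" by (auto simp: inj_on_def)
    with * inj(3) have "x = x'" by (auto simp: inj_on_def)
    with * \<open>y = y'\<close> show "z = z'" by simp
  qed
qed (rule openin_set_comp[OF bisection_open[OF X] bisection_open[OF Y]],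
    rule compactin_set_comp[OF bisection_compact[OF X] bisection_compact[OF Y]])

end

section \<open>Steinberg algebras\<close>

context ample_hausdorff_groupoid
begin

lemma steinberg_indicator: "compact_open_bisection G B \<Longrightarrow> (\<lambda>x. a * indicator B x) \<in> steinberg_functions G"
  unfolding steinberg_functions_def by (auto intro!: exI[of _ "{B}"] exI[of _ "\<lambda>_. a"])

lemma steinberg_indicator1: "compact_open_bisection G B \<Longrightarrow> indicator B \<in> steinberg_functions G"
  using steinberg_indicator[of B 1] by simp

lemma steinberg_add:
  assumes "f \<in> steinberg_functions G" "g \<in> steinberg_functions G"
  shows "(\<lambda>x. f x + g x) \<in> steinberg_functions G"
proof -
  obtain F a where F: "finite F" "\<forall>B\<in>F. compact_open_bisection G B" "f = (\<lambda>x. \<Sum>B\<in>F. a B * indicator B x)"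
    using assms(1) unfolding steinberg_functions_def by auto
  obtain H b where H: "finite H" "\<forall>B\<in>H. compact_open_bisection G B" "g = (\<lambda>x. \<Sum>B\<in>H. b B * indicator B x)"
    using assms(2) unfolding steinberg_functions_def by auto
  \<comment> \<open>A bisection may occur in both sums, so the coefficients are extended by
    \<open>0\<close> and added over the union.\<close>
  let ?a = "\<lambda>B. if B \<in> F then a B else 0" and ?b = "\<lambda>B. if B \<in> H then b B else 0"
  have "f x + g x = (\<Sum>B\<in>F \<union> H. (?a B + ?b B) * indicator B x)" for x
  proof -
    have "f x = (\<Sum>B\<in>F \<union> H. ?a B * indicator B x)"
      unfolding F(3) by (rule sum.mono_neutral_cong_left) (use F H in auto)
    moreover have "g x = (\<Sum>B\<in>F \<union> H. ?b B * indicator B x)"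
      unfolding H(3) by (rule sum.mono_neutral_cong_left) (use F H in auto)
    ultimately show ?thesis by (simp add: sum.distrib distrib_right)
  qed
  then have "(\<lambda>x. f x + g x) = (\<lambda>x. \<Sum>B\<in>F \<union> H. (?a B + ?b B) * indicator B x)" by (rule ext)
  then show ?thesis
    unfolding steinberg_functions_def
    by (intro CollectI exI[of _ "F \<union> H"] exI[of _ "\<lambda>B. ?a B + ?b B"] conjI) (use F H in auto)
qed

lemma steinberg_induct [consumes 1, case_names add indicator]:
  assumes f: "f \<in> steinberg_functions G"
    and add: "\<And>f g. f \<in> steinberg_functions G \<Longrightarrow> g \<in> steinberg_functions G \<Longrightarrow> P f \<Longrightarrow> P g \<Longrightarrow>
      P (\<lambda>x. f x + g x)"
    and ind: "\<And>a B. compact_open_bisection G B \<Longrightarrow> P (\<lambda>x. a * indicator B x)"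
  shows "P f"
proof -
  obtain F a where F: "finite F" "\<forall>B\<in>F. compact_open_bisection G B" "f = (\<lambda>x. \<Sum>B\<in>F. a B * indicator B x)"
    using f unfolding steinberg_functions_def by auto
  have "(\<lambda>x. \<Sum>B\<in>F. a B * indicator B x) \<in> steinberg_functions G \<and> P (\<lambda>x. \<Sum>B\<in>F. a B * indicator B x)"
    using F(1,2)
  proof (induction F)
    \<comment> \<open>The rule has no clause for the zero function, which is obtained as a multiple
      of the indicator of the empty bisection.\<close>
    case empty
    show ?case
      using ind[OF bisection_empty, of 0] steinberg_indicator[OF bisection_empty, of 0] by simp
  next
    case (insert B F)
    then have B: "compact_open_bisection G B" and IH: "(\<lambda>x. \<Sum>B\<in>F. a B * indicator B x) \<in> steinberg_functions G"
      "P (\<lambda>x. \<Sum>B\<in>F. a B * indicator B x)" by auto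
    show ?case
      unfolding sum.insert[OF insert(1,2)]
      using add[OF steinberg_indicator[OF B] IH(1) ind[OF B] IH(2)] steinberg_add[OF steinberg_indicator[OF B] IH(1)]
      by blast
  qed
  with F(3) show ?thesis by simp
qed

lemma steinberg_scale: "f \<in> steinberg_functions G \<Longrightarrow> (\<lambda>x. k * f x) \<in> steinberg_functions G"
proof (induction rule: steinberg_induct)
  case (add f g)
  then show ?case using steinberg_add by (auto simp: distrib_left)
next
  case (indicator a B)
  then show ?case using steinberg_indicator[of B "k * a"] by (simp add: mult.assoc)
qed

lemma steinberg_zero: "(\<lambda>x. 0) \<in> steinberg_functions G"
  using steinberg_indicator[OF bisection_empty, of 0] by simp

lemma steinberg_outside: "f \<in> steinberg_functions G \<Longrightarrow> x \<notin> arrows G \<Longrightarrow> f x = 0"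
  by (induction rule: steinberg_induct) (auto simp: indicator_def dest: bisection_subset)

text \<open>A bisection meets each fibre of \<open>rng\<close> at most once. This is what makes the
  sums in convolutions finite.\<close>

lemma steinberg_fibre_finite:
  "f \<in> steinberg_functions G \<Longrightarrow> finite {x. f x \<noteq> 0 \<and> rng G x = u}"
proof (induction rule: steinberg_induct)
  case (add f g)
  then have "finite ({x. f x \<noteq> 0 \<and> rng G x = u} \<union> {x. g x \<noteq> 0 \<and> rng G x = u})" by simp
  then show ?case by (rule finite_subset[rotated]) auto
next
  case (indicator a B)
  have "finite (rng G -` {u} \<inter> B)" by (rule finite_vimage_IntI) (use bisection_inj_rng[OF indicator] in auto)
  then show ?case by (rule finite_subset[rotated]) (auto simp: indicator_def)
qed

text \<open>Hausdorffness enters here: compact open bisections are closed, so their indicators are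
  locally constant. Supports become clopen in this way.\<close>

lemma steinberg_locally_constant:
  "f \<in> steinberg_functions G \<Longrightarrow> openin (gtop G) {x \<in> arrows G. f x = k}"
proof (induction arbitrary: k rule: steinberg_induct)
  case (add f g)
  have "{x \<in> arrows G. f x + g x = k} = (\<Union>j. {x \<in> arrows G. f x = j} \<inter> {x \<in> arrows G. g x = k - j})"
    by auto
  moreover have "openin (gtop G) \<dots>" using add by (intro openin_Union) auto
  ultimately show ?case by simp
next
  case (indicator a B)
  have B: "openin (gtop G) B" "openin (gtop G) (arrows G - B)" "B \<subseteq> arrows G"
    using bisection_open[OF indicator] compact_closed[OF bisection_compact[OF indicator]]
      bisection_subset[OF indicator] by auto
  have "{x \<in> arrows G. a * indicator B x = k} = (if a = k then B else {}) \<union> (if 0 = k then arrows G - B else {})"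
    using B(3) by (auto simp: indicator_def split: if_splits)
  with B show ?case by auto
qed

lemma steinberg_bounded_support:
  "f \<in> steinberg_functions G \<Longrightarrow> \<exists>K. compactin (gtop G) K \<and> (\<forall>x. f x \<noteq> 0 \<longrightarrow> x \<in> K)"
proof (induction rule: steinberg_induct)
  case (add f g)
  then obtain K L where "compactin (gtop G) K" "compactin (gtop G) L"
    "\<forall>x. f x \<noteq> 0 \<longrightarrow> x \<in> K" "\<forall>x. g x \<noteq> 0 \<longrightarrow> x \<in> L" by auto
  moreover have "f x \<noteq> 0 \<or> g x \<noteq> 0" if "f x + g x \<noteq> 0" for x using that by auto
  ultimately show ?case by (intro exI[of _ "K \<union> L"]) (blast intro: compactin_Un)
next
  case (indicator a B)
  then show ?case by (intro exI[of _ B]) (auto simp: bisection_compact indicator_def)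
qed

lemma
  assumes f: "f \<in> steinberg_functions G"
  shows steinberg_support_open: "openin (gtop G) {x. f x \<noteq> 0}"
    and steinberg_support_compact: "compactin (gtop G) {x. f x \<noteq> 0}"
proof -
  have eq: "{x. f x \<noteq> 0} = (\<Union>k\<in>- {0}. {x \<in> arrows G. f x = k})"
    using steinberg_outside[OF f] by auto
  show op: "openin (gtop G) {x. f x \<noteq> 0}"
    unfolding eq by (intro openin_Union) (auto simp: steinberg_locally_constant[OF f])
  have "arrows G - {x. f x \<noteq> 0} = {x \<in> arrows G. f x = 0}" by auto
  then have cl: "closedin (gtop G) {x. f x \<noteq> 0}"
    using openin_subset[OF op] steinberg_locally_constant[OF f, of 0] by (simp add: closedin_def)
  obtain K where K: "compactin (gtop G) K" "\<forall>x. f x \<noteq> 0 \<longrightarrow> x \<in> K" using steinberg_bounded_support[OF f] by blast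
  show "compactin (gtop G) {x. f x \<noteq> 0}"
    by (rule closed_compactin[OF K(1) _ cl]) (use K(2) in auto)
qed

text \<open>A factorization z = x y is determined by x, with y = x^{-1} z, so the sum over pairs
  becomes a sum over a fibre of \<open>rng\<close>. The index set may be any finite part of the
  fibre that contains the support of \<open>f\<close> there, which lets several convolutions share
  one index set.\<close>

lemma convolution_eq_sum:
  assumes f: "f \<in> steinberg_functions G" and z: "z \<in> arrows G" and X: "finite X"
    and Xz: "\<And>x. x \<in> X \<Longrightarrow> x \<in> arrows G \<and> rng G x = rng G z"
    and cover: "\<And>x. f x \<noteq> 0 \<Longrightarrow> rng G x = rng G z \<Longrightarrow> x \<in> X"
  shows "convolution G f g z = (\<Sum>x\<in>X. f x * g (gcomp G (ginv G x) z))"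
proof -
  let ?i = "\<lambda>x. (x, gcomp G (ginv G x) z)"
  let ?X = "{x \<in> X. f x \<noteq> 0 \<and> g (gcomp G (ginv G x) z) \<noteq> 0}"
  have "{(x, y) \<in> composable G. gcomp G x y = z \<and> f x \<noteq> 0 \<and> g y \<noteq> 0} = ?i ` ?X" (is "?S = _")
  proof
    show "?S \<subseteq> ?i ` ?X"
    proof
      fix p assume "p \<in> ?S"
      then obtain x y where p: "p = (x, y)"
        and xy: "(x, y) \<in> composable G" "f x \<noteq> 0" "g y \<noteq> 0" "z = gcomp G x y" by auto
      then have "gcomp G (ginv G x) z = y" "rng G x = rng G z"
        by (simp_all add: composable_iff inv_comp_cancel rng_comp)
      with xy cover[of x] show "p \<in> ?i ` ?X" unfolding p by (intro image_eqI[of _ _ x]) auto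
    qed
    show "?i ` ?X \<subseteq> ?S"
    proof
      fix p assume "p \<in> ?i ` ?X"
      then obtain x where p: "p = ?i x" and x: "x \<in> X" "f x \<noteq> 0" "g (gcomp G (ginv G x) z) \<noteq> 0" by auto
      then have a: "x \<in> arrows G" "rng G x = rng G z" using Xz by auto
      then show "p \<in> ?S"
        unfolding p using x z by (simp add: composable_iff closures src_ginv rng_ginv rng_comp comp_inv_cancel)
    qed
  qed
  then have "convolution G f g z = (\<Sum>(x, y)\<in>?i ` ?X. f x * g y)" by (simp add: convolution_def)
  also have "\<dots> = (\<Sum>x\<in>?X. f x * g (gcomp G (ginv G x) z))"
    by (subst sum.reindex) (auto simp: inj_on_def)
  also have "\<dots> = (\<Sum>x\<in>X. f x * g (gcomp G (ginv G x) z))"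
    by (rule sum.mono_neutral_left) (use X in auto)
  finally show ?thesis .
qed

lemma convolution_outside: "z \<notin> arrows G \<Longrightarrow> convolution G f g z = 0"
proof -
  assume "z \<notin> arrows G"
  then have "{(x, y) \<in> composable G. gcomp G x y = z \<and> f x \<noteq> 0 \<and> g y \<noteq> 0} = {}"
    using gcomp_closed by auto
  then show ?thesis by (simp only: convolution_def sum.empty)
qed

lemma convolution_nonzero:
  assumes "convolution G f g z \<noteq> 0"
  shows "\<exists>x y. (x, y) \<in> composable G \<and> gcomp G x y = z \<and> f x \<noteq> 0 \<and> g y \<noteq> 0"
proof (rule ccontr)
  assume "\<not> ?thesis"
  then have "{(x, y) \<in> composable G. gcomp G x y = z \<and> f x \<noteq> 0 \<and> g y \<noteq> 0} = {}" by auto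
  then have "convolution G f g z = 0" by (simp only: convolution_def sum.empty)
  with assms show False by simp
qed

lemma convolution_add_left:
  assumes "f \<in> steinberg_functions G" "f' \<in> steinberg_functions G"
  shows "convolution G (\<lambda>x. f x + f' x) g = (\<lambda>z. convolution G f g z + convolution G f' g z)"
proof
  fix z
  \<comment> \<open>One index set for all three convolutions: it covers the support of the sum as
    well.\<close>
  let ?X = "{x. f x \<noteq> 0 \<and> rng G x = rng G z} \<union> {x. f' x \<noteq> 0 \<and> rng G x = rng G z}"
  have X: "finite ?X" "\<And>x. x \<in> ?X \<Longrightarrow> x \<in> arrows G \<and> rng G x = rng G z"
    using steinberg_fibre_finite assms steinberg_outside by blast+
  show "convolution G (\<lambda>x. f x + f' x) g z = convolution G f g z + convolution G f' g z"
  proof (cases "z \<in> arrows G")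
    case True
    show ?thesis
      by (subst (1 2 3) convolution_eq_sum[OF _ True X])
        (use assms in \<open>auto simp: steinberg_add distrib_right sum.distrib\<close>)
  qed (simp add: convolution_outside)
qed

lemma convolution_add_right:
  assumes "f \<in> steinberg_functions G"
  shows "convolution G f (\<lambda>x. g x + g' x) = (\<lambda>z. convolution G f g z + convolution G f g' z)"
proof
  fix z
  let ?X = "{x. f x \<noteq> 0 \<and> rng G x = rng G z}"
  have X: "finite ?X" "\<And>x. x \<in> ?X \<Longrightarrow> x \<in> arrows G \<and> rng G x = rng G z"
    using steinberg_fibre_finite[OF assms] steinberg_outside[OF assms] by blast+
  show "convolution G f (\<lambda>x. g x + g' x) z = convolution G f g z + convolution G f g' z"
  proof (cases "z \<in> arrows G")
    case True
    show ?thesis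
      by (subst (1 2 3) convolution_eq_sum[OF assms True X]) (auto simp: distrib_left sum.distrib)
  qed (simp add: convolution_outside)
qed

lemma convolution_scale:
  assumes "f \<in> steinberg_functions G"
  shows "convolution G (\<lambda>x. k * f x) g = (\<lambda>z. k * convolution G f g z)"
    and "convolution G f (\<lambda>x. k * g x) = (\<lambda>z. k * convolution G f g z)"
proof -
  have X: "finite {x. f x \<noteq> 0 \<and> rng G x = rng G z}"
      "\<And>x. x \<in> {x. f x \<noteq> 0 \<and> rng G x = rng G z} \<Longrightarrow> x \<in> arrows G \<and> rng G x = rng G z" for z
    using steinberg_fibre_finite[OF assms] steinberg_outside[OF assms] by blast+
  have 1: "convolution G (\<lambda>x. k * f x) g z = k * convolution G f g z" if "z \<in> arrows G" for z
    by (subst (1 2) convolution_eq_sum[OF _ that X])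
      (use assms in \<open>auto simp: steinberg_scale sum_distrib_left mult.assoc\<close>)
  have 2: "convolution G f (\<lambda>x. k * g x) z = k * convolution G f g z" if "z \<in> arrows G" for z
    by (subst (1 2) convolution_eq_sum[OF assms that X]) (auto simp: sum_distrib_left mult.left_commute)
  show "convolution G (\<lambda>x. k * f x) g = (\<lambda>z. k * convolution G f g z)"
  proof
    show "convolution G (\<lambda>x. k * f x) g z = k * convolution G f g z" for z
      by (cases "z \<in> arrows G") (simp_all add: 1 convolution_outside)
  qed
  show "convolution G f (\<lambda>x. k * g x) = (\<lambda>z. k * convolution G f g z)"
  proof
    show "convolution G f (\<lambda>x. k * g x) z = k * convolution G f g z" for z
      by (cases "z \<in> arrows G") (simp_all add: 2 convolution_outside)
  qed
qed

text \<open>At most one element x of \<open>B\<close> has the range of z, so the sum has at most one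
  term, which survives only if x^{-1} z lies in \<open>D\<close>, that is, if z lies in the product
  set.\<close>

lemma convolution_indicator:
  assumes B: "compact_open_bisection G B" and D: "compact_open_bisection G D"
  shows "convolution G (\<lambda>x. a * indicator B x) (\<lambda>x. b * indicator D x) =
    (\<lambda>z. (a * b) * indicator (set_comp G B D) z)"
proof
  fix z
  note sub = bisection_subset[OF B] bisection_subset[OF D]
  note eq_sum = convolution_eq_sum[OF steinberg_indicator[OF B, of a], where g = "\<lambda>x. b * indicator D x"]
  show "convolution G (\<lambda>x. a * indicator B x) (\<lambda>x. b * indicator D x) z = (a * b) * indicator (set_comp G B D) z"
  proof (cases "z \<in> set_comp G B D")
    case True
    then obtain x y where xy: "x \<in> B" "y \<in> D" "src G x = rng G y" "z = gcomp G x y" by (auto simp: set_comp_def)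
    then have a: "x \<in> arrows G" "y \<in> arrows G" using sub by auto
    have "convolution G (\<lambda>x. a * indicator B x) (\<lambda>x. b * indicator D x) z =
        (\<Sum>x\<in>{x}. a * indicator B x * (b * indicator D (gcomp G (ginv G x) z)))"
    proof (rule eq_sum)
      show "x' \<in> {x}" if "a * indicator B x' \<noteq> 0" "rng G x' = rng G z" for x'
        using that a xy bisection_inj_rng[OF B] by (auto simp: rng_comp inj_on_def indicator_def split: if_splits)
    qed (use a xy in \<open>auto simp: rng_comp comp_closed\<close>)
    also have "\<dots> = a * b" using a xy by (simp add: inv_comp_cancel)
    finally show ?thesis using True by simp
  next
    case False
    show ?thesis
    proof (cases "z \<in> arrows G")
      case True
      have "convolution G (\<lambda>x. a * indicator B x) (\<lambda>x. b * indicator D x) z =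
          (\<Sum>x\<in>rng G -` {rng G z} \<inter> B. a * indicator B x * (b * indicator D (gcomp G (ginv G x) z)))"
      proof (rule eq_sum[OF True])
        show "finite (rng G -` {rng G z} \<inter> B)"
          by (rule finite_vimage_IntI) (use bisection_inj_rng[OF B] in auto)
      qed (use sub in \<open>auto simp: indicator_def split: if_splits\<close>)
      also have "\<dots> = 0"
      proof (rule sum.neutral, intro ballI)
        fix x assume x: "x \<in> rng G -` {rng G z} \<inter> B"
        have "gcomp G (ginv G x) z \<notin> D"
        proof
          assume "gcomp G (ginv G x) z \<in> D"
          then have "gcomp G x (gcomp G (ginv G x) z) \<in> set_comp G B D"
            using x sub True by (intro set_compI) (auto simp: rng_comp closures src_ginv rng_ginv subset_iff)
          with False x sub True show False by (auto simp: comp_inv_cancel subset_iff)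
        qed
        then show "a * indicator B x * (b * indicator D (gcomp G (ginv G x) z)) = 0" by simp
      qed
      finally show ?thesis using False by simp
    qed (use False in \<open>simp add: convolution_outside\<close>)
  qed
qed

lemma convolution_closed:
  assumes "f \<in> steinberg_functions G" "g \<in> steinberg_functions G"
  shows "convolution G f g \<in> steinberg_functions G"
  using assms(1)
proof (induction rule: steinberg_induct)
  case (add f f')
  then show ?case by (simp add: convolution_add_left steinberg_add)
next
  case (indicator a B)
  from assms(2) show ?case
  proof (induction rule: steinberg_induct)
    case (add g g')
    then show ?case by (simp add: convolution_add_right[OF steinberg_indicator[OF indicator]] steinberg_add)
  next
    case (indicator b D)
    then show ?case
      using \<open>compact_open_bisection G B\<close> by (simp add: convolution_indicator steinberg_indicator bisection_set_comp)
  qed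
qed

text \<open>Additivity in each argument reduces the claim to three indicators, where it is
  associativity of the product of sets.\<close>

lemma convolution_assoc:
  assumes "f \<in> steinberg_functions G" "g \<in> steinberg_functions G" "h \<in> steinberg_functions G"
  shows "convolution G (convolution G f g) h = convolution G f (convolution G g h)"
  using assms(1)
proof (induction rule: steinberg_induct)
  case (add f f')
  then show ?case by (simp add: convolution_add_left convolution_closed assms)
next
  case (indicator a B)
  note B = steinberg_indicator[OF indicator]
  from assms(2) show ?case
  proof (induction rule: steinberg_induct)
    case (add g g')
    then show ?case by (simp add: convolution_add_left convolution_add_right B convolution_closed assms(3))
  next
    case (indicator b D)
    note D = steinberg_indicator[OF indicator]
    from assms(3) show ?case
    proof (induction rule: steinberg_induct)
      case (add h h')
      then show ?case by (simp add: convolution_add_right B D convolution_closed)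
    next
      case (indicator e E)
      then show ?case
        using \<open>compact_open_bisection G B\<close> \<open>compact_open_bisection G D\<close>
        by (simp add: convolution_indicator bisection_set_comp set_comp_assoc bisection_subset)
          (simp add: mult.assoc)?
    qed
  qed
qed

text \<open>As \<open>X\<close> is a bisection, \<open>y\<close> is its only element with the source
  of \<open>y\<close>, so v y' = x y with y' in \<open>X\<close> forces v = x. Right multiplication
  by the indicator of \<open>X\<close> therefore only translates the values of \<open>f\<close>, and
  a value \<open>f x\<close> can be read off from the product.\<close>

lemma convolution_indicator_right:
  assumes f: "f \<in> steinberg_functions G" and X: "compact_open_bisection G X"
    and xy: "x \<in> arrows G" "y \<in> X" "src G x = rng G y"
  shows "convolution G f (indicator X) (gcomp G x y) = f x"
proof -
  have y: "y \<in> arrows G" using xy bisection_subset[OF X] by auto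
  define z where "z = gcomp G x y"
  \<comment> \<open>\<open>x\<close> is inserted because \<open>f x\<close> may be
    \<open>0\<close>.\<close>
  let ?X = "insert x {v. f v \<noteq> 0 \<and> rng G v = rng G z}"
  have z: "z \<in> arrows G" "rng G z = rng G x" "src G z = src G y"
    using xy y by (simp_all add: z_def comp_closed rng_comp src_comp)
  have fin: "finite ?X" using steinberg_fibre_finite[OF f] by simp
  have arr: "v \<in> arrows G \<and> rng G v = rng G z" if "v \<in> ?X" for v
    using that steinberg_outside[OF f, of v] xy(1) z(2) by (cases "v = x") auto
  have "convolution G f (indicator X) z = (\<Sum>v\<in>?X. f v * indicator X (gcomp G (ginv G v) z))"
    by (rule convolution_eq_sum[OF f z(1) fin arr]) auto
  also have "\<dots> = (\<Sum>v\<in>{x}. f v * indicator X (gcomp G (ginv G v) z))"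
  proof (rule sum.mono_neutral_right[OF fin])
    show "\<forall>v\<in>?X - {x}. f v * indicator X (gcomp G (ginv G v) z) = 0"
    proof
      fix v assume v: "v \<in> ?X - {x}"
      then have va: "v \<in> arrows G" "rng G v = rng G z" using arr[of v] by blast+
      have "gcomp G (ginv G v) z \<notin> X"
      proof
        assume *: "gcomp G (ginv G v) z \<in> X"
        have "src G (gcomp G (ginv G v) z) = src G y"
          using va z by (simp add: src_comp ginv_closed src_ginv)
        with * xy bisection_inj_src[OF X] have eq: "gcomp G (ginv G v) z = y" by (auto simp: inj_on_def)
        have vz: "gcomp G v y = z" using comp_inv_cancel[OF va(1) z(1) va(2)] by (simp add: eq)
        have "src G v = rng G y"
          using rng_comp[of "ginv G v" z] va z by (simp add: eq ginv_closed src_ginv rng_ginv)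
        then have "v = gcomp G (gcomp G v y) (ginv G y)" using va y by (simp add: comp_inv_cancel_right)
        also have "\<dots> = x" using xy y by (simp add: vz z_def comp_inv_cancel_right)
        finally show False using v by simp
      qed
      then show "f v * indicator X (gcomp G (ginv G v) z) = 0" by simp
    qed
  qed auto
  also have "\<dots> = f x" using xy y by (simp add: z_def inv_comp_cancel)
  finally show ?thesis by (simp add: z_def)
qed

lemma convolution_unit_right:
  assumes f: "f \<in> steinberg_functions G" and V: "compact_open_bisection G V" "V \<subseteq> units"
  shows "convolution G f (indicator V) z = (if src G z \<in> V \<and> z \<in> arrows G then f z else 0)"
proof (cases "src G z \<in> V \<and> z \<in> arrows G")
  case True
  then show ?thesis
    using convolution_indicator_right[OF f V(1), of z "src G z"] by (simp add: rng_src src_gcomp_right)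
next
  case False
  have "convolution G f (indicator V) z = 0"
  proof (rule ccontr)
    assume "convolution G f (indicator V) z \<noteq> 0"
    then obtain x y where "(x, y) \<in> composable G" "gcomp G x y = z" "y \<in> V"
      using convolution_nonzero[of f "indicator V" z] by (auto simp: indicator_def split: if_splits)
    with False V(2) units_src[of y] show False by (auto simp: composable_iff comp_closed src_comp)
  qed
  with False show ?thesis by auto
qed

lemma convolution_unit_left:
  assumes f: "f \<in> steinberg_functions G" and V: "compact_open_bisection G V" "V \<subseteq> units"
  shows "convolution G (indicator V) f z = (if rng G z \<in> V \<and> z \<in> arrows G then f z else 0)"
proof (cases "rng G z \<in> V \<and> z \<in> arrows G")
  case True
  have "convolution G (indicator V) f z = (\<Sum>x\<in>{rng G z}. indicator V x * f (gcomp G (ginv G x) z))"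
  proof (rule convolution_eq_sum[OF steinberg_indicator1[OF V(1)]])
    show "x \<in> {rng G z}" if "indicator V x \<noteq> (0 :: 'a)" "rng G x = rng G z" for x
      using that V(2) by (auto simp: indicator_def units_iff split: if_splits)
  qed (use True in \<open>auto simp: closures rng_rng\<close>)
  also have "\<dots> = f z"
    using True inv_comp_cancel[of "rng G z" z] by (simp add: rng_gcomp_left src_rng closures)
  finally show ?thesis using True by simp
next
  case False
  have "convolution G (indicator V) f z = 0"
  proof (rule ccontr)
    assume "convolution G (indicator V) f z \<noteq> 0"
    then obtain x y where "(x, y) \<in> composable G" "gcomp G x y = z" "x \<in> V"
      using convolution_nonzero[of "indicator V" f z] by (auto simp: indicator_def split: if_splits)
    with False V(2) show False by (auto simp: composable_iff comp_closed rng_comp units_iff)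
  qed
  with False show ?thesis by auto
qed

text \<open>Only products x x^{-1} occur, because the source determines x in \<open>X\<close>.
  Indicators of sets of units thus arise as products of functions of opposite degrees.\<close>

lemma convolution_bisection_inverse:
  assumes X: "compact_open_bisection G X"
  shows "convolution G (indicator X) (indicator (ginv G ` X)) = (indicator (rng G ` X) :: _ \<Rightarrow> 'k::field)"
proof -
  have "set_comp G X (ginv G ` X) = rng G ` X"
  proof
    show "set_comp G X (ginv G ` X) \<subseteq> rng G ` X"
    proof
      fix z assume "z \<in> set_comp G X (ginv G ` X)"
      then obtain x y where xy: "x \<in> X" "y \<in> X" "src G x = rng G (ginv G y)" "z = gcomp G x (ginv G y)"
        by (auto simp: set_comp_def)
      have a: "x \<in> arrows G" "y \<in> arrows G" using xy bisection_subset[OF X] by auto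
      with xy bisection_inj_src[OF X] have "x = y" by (auto simp: inj_on_def rng_ginv)
      with xy a show "z \<in> rng G ` X" by (simp add: gcomp_ginv_right)
    qed
    show "rng G ` X \<subseteq> set_comp G X (ginv G ` X)"
    proof clarify
      fix x assume x: "x \<in> X"
      then have a: "x \<in> arrows G" using bisection_subset[OF X] by auto
      have "gcomp G x (ginv G x) \<in> set_comp G X (ginv G ` X)"
        using x a by (intro set_compI) (auto simp: rng_ginv)
      with a show "rng G x \<in> set_comp G X (ginv G ` X)" by (simp add: gcomp_ginv_right)
    qed
  qed
  then show ?thesis using convolution_indicator[OF X bisection_ginv[OF X], of 1 1] by simp
qed

end

section \<open>Gradings by cocycles\<close>

context groupoid
begin

lemma ginv_comp:
  assumes "x \<in> arrows G" "y \<in> arrows G" "src G x = rng G y"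
  shows "ginv G (gcomp G x y) = gcomp G (ginv G y) (ginv G x)"
proof -
  have z: "gcomp G x y \<in> arrows G" "rng G (gcomp G x y) = rng G x" "src G (gcomp G x y) = src G y"
    using assms by (simp_all add: comp_closed rng_comp src_comp)
  have "gcomp G (gcomp G (ginv G y) (ginv G x)) (gcomp G x y) =
      gcomp G (ginv G y) (gcomp G (ginv G x) (gcomp G x y))"
    using assms z by (intro comp_assoc) (simp_all add: ginv_closed rng_ginv src_ginv)
  also have "\<dots> = src G y"
    using assms by (simp add: inv_comp_cancel gcomp_ginv_left)
  finally have eq: "gcomp G (gcomp G (ginv G y) (ginv G x)) (gcomp G x y) = src G y" .
  have w: "gcomp G (ginv G y) (ginv G x) \<in> arrows G" "src G (gcomp G (ginv G y) (ginv G x)) = rng G x"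
    "rng G (gcomp G (ginv G y) (ginv G x)) = src G y"
    using assms by (simp_all add: comp_closed rng_comp src_comp ginv_closed rng_ginv src_ginv)
  have "gcomp G (ginv G y) (ginv G x) = gcomp G (src G y) (ginv G (gcomp G x y))"
    using comp_inv_cancel_right[OF w(1) z(1)] by (simp add: w z eq)
  also have "\<dots> = ginv G (gcomp G x y)"
    using rng_gcomp_left[OF ginv_closed[OF z(1)]] by (simp add: rng_ginv z)
  finally show ?thesis by simp
qed

lemma gprod_props:
  assumes "gs \<noteq> []" "set gs \<subseteq> arrows G" "successively (\<lambda>x y. src G x = rng G y) gs"
  shows "gprod G gs \<in> arrows G \<and> rng G (gprod G gs) = rng G (hd gs) \<and> src G (gprod G gs) = src G (last gs)"
  using assms
proof (induction gs rule: induct_list012)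
  case (3 x y zs)
  then have "gprod G (y # zs) \<in> arrows G" "rng G (gprod G (y # zs)) = rng G y"
    "src G (gprod G (y # zs)) = src G (last (y # zs))" by auto
  with 3(3-5) show ?case by (simp add: comp_closed rng_comp src_comp)
qed auto

lemma gprod_append1:
  assumes "gs \<noteq> []" "set gs \<subseteq> arrows G" "successively (\<lambda>x y. src G x = rng G y) gs"
    "x \<in> arrows G" "src G (last gs) = rng G x"
  shows "gprod G (gs @ [x]) = gcomp G (gprod G gs) x"
  using assms
proof (induction gs rule: induct_list012)
  case (3 u v zs)
  then have IH: "gprod G (v # zs @ [x]) = gcomp G (gprod G (v # zs)) x" by auto
  have "gprod G (v # zs) \<in> arrows G" "rng G (gprod G (v # zs)) = rng G v"
    "src G (gprod G (v # zs)) = rng G x" using gprod_props[of "v # zs"] 3 by auto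
  with 3(3-6) IH show ?case by (simp add: comp_assoc)
qed auto

text \<open>Reversing and inverting carries factorizations from positive degrees, where
  unperforation provides them, to negative degrees.\<close>

lemma is_product_ginv:
  assumes "is_product G gs g" "set gs \<subseteq> arrows G"
  shows "is_product G (rev (map (ginv G) gs)) (ginv G g)"
  using assms
proof (induction gs arbitrary: g rule: induct_list012)
  case (3 x y zs)
  let ?h = "gprod G (y # zs)"
  let ?l = "rev (map (ginv G) (y # zs))"
  have suc: "src G x = rng G y" "successively (\<lambda>x y. src G x = rng G y) (y # zs)" "g = gcomp G x ?h"
    and arr: "x \<in> arrows G" "set (y # zs) \<subseteq> arrows G"
    using 3 by (auto simp: is_product_def)
  have h: "?h \<in> arrows G" "rng G ?h = rng G y" using gprod_props[of "y # zs"] suc arr by auto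
  have "is_product G ?l (ginv G ?h)" using 3(2)[of ?h] suc arr by (simp add: is_product_def)
  then have l: "successively (\<lambda>x y. src G x = rng G y) ?l" "ginv G ?h = gprod G ?l"
    by (simp_all only: is_product_def)
  have la: "set ?l \<subseteq> arrows G" using arr by (auto simp: ginv_closed)
  have last: "src G (last ?l) = rng G (ginv G x)" using arr suc by (simp add: src_ginv rng_ginv)
  have "gprod G (?l @ [ginv G x]) = gcomp G (ginv G ?h) (ginv G x)"
    using gprod_append1[OF _ la l(1) ginv_closed[OF arr(1)] last] by (simp add: l(2))
  also have "\<dots> = ginv G g" using ginv_comp[OF arr(1) h(1)] suc h by simp
  finally have "ginv G g = gprod G (?l @ [ginv G x])" by simp
  moreover have "successively (\<lambda>x y. src G x = rng G y) (?l @ [ginv G x])"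
    using l(1) last by (simp only: successively_append_iff) simp
  ultimately show ?case by (simp add: is_product_def)
qed (auto simp: is_product_def)

end

locale cocycle_groupoid = ample_hausdorff_groupoid G for G :: "'g groupoid" +
  fixes c :: "'g \<Rightarrow> int"
  assumes cocycle: "continuous_cocycle G c"
begin

lemma c_comp: "x \<in> arrows G \<Longrightarrow> y \<in> arrows G \<Longrightarrow> src G x = rng G y \<Longrightarrow> c (gcomp G x y) = c x + c y"
  using cocycle by (auto simp: continuous_cocycle_def composable_iff)

lemma c_rng: "x \<in> arrows G \<Longrightarrow> c (rng G x) = 0"
  using c_comp[of "rng G x" x] by (simp add: closures src_rng rng_gcomp_left)

lemma c_src: "x \<in> arrows G \<Longrightarrow> c (src G x) = 0"
  using c_comp[of x "src G x"] by (simp add: closures rng_src src_gcomp_right)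

lemma c_ginv: "x \<in> arrows G \<Longrightarrow> c (ginv G x) = - c x"
  using c_comp[of x "ginv G x"] by (simp add: closures rng_ginv gcomp_ginv_right c_rng)

abbreviation "lev \<equiv> level G c"

lemma lev_iff: "x \<in> lev n \<longleftrightarrow> x \<in> arrows G \<and> c x = n"
  by (simp add: level_def)

lemma preimage_clopen:
  shows openin_preimage: "openin (gtop G) {x \<in> arrows G. c x \<in> N}"
    and closedin_preimage: "closedin (gtop G) {x \<in> arrows G. c x \<in> N}"
  using cocycle openin_continuous_map_preimage[of "gtop G" "discrete_topology UNIV" c N]
    closedin_continuous_map_preimage[of "gtop G" "discrete_topology UNIV" c N]
  by (auto simp: continuous_cocycle_def)

lemma lev_open: "openin (gtop G) (lev n)"
  using openin_preimage[of "{n}"] by (simp add: level_def)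

lemma set_comp_lev: "set_comp G (lev m) (lev n) \<subseteq> lev (m + n)"
  by (auto simp: set_comp_def lev_iff c_comp comp_closed)

lemma ginv_lev: "x \<in> lev n \<Longrightarrow> ginv G x \<in> lev (- n)"
  by (simp add: lev_iff c_ginv ginv_closed)

lemma rng_lev_set_comp: "rng G ` lev 1 \<union> src G ` lev (- 1) \<subseteq> set_comp G (lev 1) (lev (- 1))"
proof -
  have "rng G x \<in> set_comp G (lev 1) (lev (- 1))" if "x \<in> lev 1" for x
    using set_compI[OF that ginv_lev[OF that]] that by (simp add: lev_iff rng_ginv gcomp_ginv_right)
  moreover have "src G x \<in> set_comp G (lev 1) (lev (- 1))" if "x \<in> lev (- 1)" for x
    using set_compI[of "ginv G x" "lev 1" x "lev (- 1)"] ginv_lev[OF that] that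
    by (simp add: lev_iff src_ginv gcomp_ginv_left)
  ultimately show ?thesis by auto
qed

abbreviation steinberg :: "('g \<Rightarrow> 'k::field) ring" where
  "steinberg \<equiv> steinberg_ring G (arrows G)"

abbreviation deg :: "int \<Rightarrow> ('g \<Rightarrow> 'k::field) set" where
  "deg n \<equiv> steinberg_supported G (lev n)"

lemma steinberg_ring_simps [simp]:
  "carrier (steinberg_ring G H) = steinberg_supported G H"
  "f \<otimes>\<^bsub>steinberg_ring G H\<^esub> g = convolution G f g"
  "f \<oplus>\<^bsub>steinberg_ring G H\<^esub> g = (\<lambda>x. f x + g x)"
  "\<zero>\<^bsub>steinberg_ring G H\<^esub> = (\<lambda>x. 0)"
  by (simp_all add: steinberg_ring_def)

lemma steinberg_carrier: "f \<in> steinberg_supported G (arrows G) \<longleftrightarrow> f \<in> steinberg_functions G"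
  using steinberg_outside by (auto simp: steinberg_supported_def)

lemma steinberg_nu_ring: "nu_ring (steinberg :: ('g \<Rightarrow> 'k::field) ring)"
proof -
  have "abelian_group (steinberg :: ('g \<Rightarrow> 'k) ring)"
  proof (rule abelian_groupI)
    fix f assume "f \<in> carrier (steinberg :: ('g \<Rightarrow> 'k) ring)"
    then show "\<exists>g\<in>carrier steinberg. g \<oplus>\<^bsub>steinberg\<^esub> f = \<zero>\<^bsub>steinberg\<^esub>"
      using steinberg_scale[of f "- 1"] by (intro bexI[of _ "\<lambda>x. - 1 * f x"]) (auto simp: steinberg_carrier)
  qed (auto simp: steinberg_carrier steinberg_add steinberg_zero add_ac)
  then show ?thesis
    by (rule nu_ring.intro, unfold_locales)
      (simp_all add: steinberg_carrier convolution_closed convolution_assoc convolution_add_left convolution_add_right)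
qed

lemma steinberg_minus:
  assumes "f \<in> steinberg_functions G"
  shows "\<ominus>\<^bsub>steinberg\<^esub> f = (\<lambda>x. - f x :: 'k::field)"
proof -
  interpret nu_ring "steinberg :: ('g \<Rightarrow> 'k) ring" by (rule steinberg_nu_ring)
  have "(\<lambda>x. - f x) \<in> steinberg_functions G" using steinberg_scale[OF assms, of "- 1"] by simp
  with assms show ?thesis by (intro minus_equality) (auto simp: steinberg_carrier)
qed

lemma steinberg_finsum:
  assumes "finite N" "\<And>n. n \<in> N \<Longrightarrow> a n \<in> steinberg_functions G"
  shows "finsum steinberg a N x = (\<Sum>n\<in>N. a n x :: 'k::field)"
proof -
  interpret nu_ring "steinberg :: ('g \<Rightarrow> 'k) ring" by (rule steinberg_nu_ring)
  show ?thesis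
    using assms by (induction N) (simp_all add: finsum_insert steinberg_carrier Pi_iff)
qed

lemma deg_iff: "f \<in> deg n \<longleftrightarrow> f \<in> steinberg_functions G \<and> (\<forall>x. f x \<noteq> 0 \<longrightarrow> x \<in> lev n)"
  by (auto simp: steinberg_supported_def)

lemma indicator_deg: "compact_open_bisection G B \<Longrightarrow> B \<subseteq> lev n \<Longrightarrow> (\<lambda>x. a * indicator B x) \<in> deg n"
  by (simp add: deg_iff steinberg_indicator) (auto simp: indicator_def)

lemma indicator1_deg: "compact_open_bisection G B \<Longrightarrow> B \<subseteq> lev n \<Longrightarrow> indicator B \<in> deg n"
  using indicator_deg[of B n 1] by simp

lemma deg_span: "steinberg_functions G \<subseteq> generate (add_monoid steinberg) (\<Union>n. deg n :: ('g \<Rightarrow> 'k::field) set)"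
proof
  define D where "D = generate (add_monoid steinberg) (\<Union>n. deg n :: ('g \<Rightarrow> 'k) set)"
  interpret nu_ring "steinberg :: ('g \<Rightarrow> 'k) ring" by (rule steinberg_nu_ring)
  interpret D: additive_subgroup D "steinberg :: ('g \<Rightarrow> 'k) ring"
    unfolding D_def by (rule additive_span_subgroup) (auto simp: steinberg_carrier deg_iff)
  have D_add: "(\<lambda>x. f x + g x) \<in> D" if "f \<in> D" "g \<in> D" for f g
    using D.a_closed[OF that] by simp
  fix f :: "'g \<Rightarrow> 'k" assume "f \<in> steinberg_functions G"
  then have "f \<in> D"
  proof (induction rule: steinberg_induct)
    case (add f g)
    then show ?case by (intro D_add)
  next
    case (indicator a B)
    \<comment> \<open>A compact set has finite image in the discrete integers, so \<open>B\<close>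
      meets finitely many levels; \<open>?r N\<close> is the part of the function over the levels in
      \<open>N\<close>, and the induction adds one level at a time.\<close>
    let ?r = "\<lambda>N x. a * indicator (B \<inter> {x \<in> arrows G. c x \<in> N}) x"
    have "compactin (discrete_topology UNIV) (c ` B)"
      by (rule image_compactin[OF bisection_compact[OF indicator]])
        (use cocycle in \<open>simp add: continuous_cocycle_def\<close>)
    then have fin: "finite (c ` B)" by (simp add: compactin_discrete_topology)
    have "?r N \<in> D" if "finite N" for N
      using that
    proof (induction N)
      case empty
      then show ?case using D.zero_closed by simp
    next
      case (insert n N)
      have "?r {n} \<in> deg n"
        by (rule indicator_deg[OF bisection_Int_clopen[OF indicator openin_preimage closedin_preimage]])
          (auto simp: lev_iff)
      then have "?r {n} \<in> D" unfolding D_def by (intro generate.incl) auto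
      from D_add[OF this insert(3)] have "(\<lambda>x. ?r {n} x + ?r N x) \<in> D" .
      moreover have "(\<lambda>x. ?r {n} x + ?r N x) = ?r (insert n N)"
        using insert(2) by (auto simp: indicator_def fun_eq_iff)
      ultimately show ?case by simp
    qed
    from this[OF fin] have "?r (c ` B) \<in> D" .
    moreover have "B \<inter> {x \<in> arrows G. c x \<in> c ` B} = B" using bisection_subset[OF indicator] by auto
    ultimately show ?case by simp
  qed
  then show "f \<in> generate (add_monoid steinberg) (\<Union>n. deg n)" by (simp only: D_def)
qed

lemma steinberg_graded_ring: "graded_ring (steinberg :: ('g \<Rightarrow> 'k::field) ring) deg"
proof -
  interpret nu_ring "steinberg :: ('g \<Rightarrow> 'k) ring" by (rule steinberg_nu_ring)
  show ?thesis
  proof (rule graded_ring.intro[OF steinberg_nu_ring], rule graded_ring_axioms.intro)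
    show "additive_subgroup (deg n) (steinberg :: ('g \<Rightarrow> 'k) ring)" for n
    proof (rule additive_subgroupI)
      show "\<ominus>\<^bsub>steinberg\<^esub> f \<in> deg n" if "f \<in> deg n" for f :: "'g \<Rightarrow> 'k"
        using that steinberg_scale[of f "- 1"] by (simp add: deg_iff steinberg_minus)
      show "f \<oplus>\<^bsub>steinberg\<^esub> g \<in> deg n" if "f \<in> deg n" "g \<in> deg n" for f g :: "'g \<Rightarrow> 'k"
      proof -
        have "f x \<noteq> 0 \<or> g x \<noteq> 0" if "f x + g x \<noteq> 0" for x using that by auto
        with that show ?thesis by (auto simp: deg_iff steinberg_add)
      qed
    qed (auto simp: deg_iff steinberg_carrier steinberg_zero)
  next
    fix f g :: "'g \<Rightarrow> 'k" and m n assume fg: "f \<in> deg m" "g \<in> deg n"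
    have "z \<in> lev (m + n)" if "convolution G f g z \<noteq> 0" for z
      using convolution_nonzero[OF that] fg by (auto simp: deg_iff lev_iff composable_iff c_comp comp_closed)
    with fg show "f \<otimes>\<^bsub>steinberg\<^esub> g \<in> deg (m + n)" by (simp add: deg_iff convolution_closed)
  next
    fix N :: "int set" and a :: "int \<Rightarrow> 'g \<Rightarrow> 'k" and n
    assume N: "finite N" and a: "\<And>n. a n \<in> deg n" and sum: "finsum steinberg a N = \<zero>\<^bsub>steinberg\<^esub>" and n: "n \<in> N"
    have "a n x = 0" for x
    proof (rule ccontr)
      assume nz: "a n x \<noteq> 0"
      \<comment> \<open>A nonzero value of \<open>a n\<close> at \<open>x\<close> places
        \<open>x\<close> in level \<open>n\<close>, which forces the other components to vanish
        there.\<close>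
      have other: "a m x = 0" if "m \<noteq> n" for m
        using a[of n] a[of m] nz that by (force simp: deg_iff lev_iff)
      have "(\<Sum>m\<in>N. a m x) = a n x"
        using N n other by (subst sum.remove[of _ n]) auto
      moreover have "(\<Sum>m\<in>N. a m x) = 0"
        using steinberg_finsum[OF N, of a x] a sum by (simp add: deg_iff)
      ultimately show False using nz by simp
    qed
    then show "a n = \<zero>\<^bsub>steinberg\<^esub>" by auto
  next
    show "carrier steinberg \<subseteq> generate (add_monoid steinberg) (\<Union>n. deg n :: ('g \<Rightarrow> 'k) set)"
      using deg_span by (auto simp: steinberg_carrier)
  qed
qed

text \<open>The unit is a sum of products \<open>1\<^sub>X 1\<^sub>Y\<close> with \<open>Y\<close> the inverse of \<open>X\<close>, for finitely many bisections
  \<open>X\<close> whose ranges cover \<open>K\<close>.\<close>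

lemma local_unit:
  assumes K: "compactin (gtop G) K" "K \<subseteq> rng G ` lev k"
  obtains V where "compact_open_bisection G V" "V \<subseteq> units" "K \<subseteq> V"
    "(indicator V :: 'g \<Rightarrow> 'k::field) \<in> product_span steinberg (deg k) (deg (- k))"
proof -
  let ?S = "product_span steinberg (deg k) (deg (- k)) :: ('g \<Rightarrow> 'k) set"
  interpret nu_ring "steinberg :: ('g \<Rightarrow> 'k) ring" by (rule steinberg_nu_ring)
  interpret S: additive_subgroup ?S "steinberg :: ('g \<Rightarrow> 'k) ring"
    by (rule product_span_subgroup) (auto simp: steinberg_carrier deg_iff)
  let ?B = "{X. compact_open_bisection G X \<and> X \<subseteq> lev k}"
  have "K \<subseteq> \<Union>((`) (rng G) ` ?B)"
  proof
    fix u assume "u \<in> K"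
    then obtain x where x: "x \<in> lev k" "u = rng G x" using K(2) by auto
    then obtain X where "compact_open_bisection G X" "x \<in> X" "X \<subseteq> lev k"
      using bisection_nbhd[OF lev_open] by metis
    with x show "u \<in> \<Union>((`) (rng G) ` ?B)" by blast
  qed
  moreover have "openin (gtop G) U" if "U \<in> (`) (rng G) ` ?B" for U
    using that by (auto intro: openin_rng bisection_open)
  ultimately obtain \<F> where \<F>: "finite \<F>" "\<F> \<subseteq> (`) (rng G) ` ?B" "K \<subseteq> \<Union>\<F>"
    using compactinD[OF K(1), of "(`) (rng G) ` ?B"] by auto
  have "\<exists>V. openin (gtop G) V \<and> compactin (gtop G) V \<and> V \<subseteq> units \<and> \<Union>\<F> \<subseteq> V \<and> (indicator V :: 'g \<Rightarrow> 'k) \<in> ?S"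
    using \<F>(1,2)
  proof (induction \<F>)
    case empty
    have "(indicator {} :: 'g \<Rightarrow> 'k) = \<zero>\<^bsub>steinberg\<^esub>" by (simp add: fun_eq_iff)
    then have "(indicator {} :: 'g \<Rightarrow> 'k) \<in> ?S" using S.zero_closed by (simp only:)
    then show ?case by (intro exI[of _ "{}"] conjI) (assumption | simp)+
  next
    case (insert U \<F>)
    then obtain V where V: "openin (gtop G) V" "compactin (gtop G) V" "V \<subseteq> units" "\<Union>\<F> \<subseteq> V"
      "(indicator V :: 'g \<Rightarrow> 'k) \<in> ?S" by auto
    obtain X where X: "compact_open_bisection G X" "X \<subseteq> lev k" "U = rng G ` X" using insert by auto
    \<comment> \<open>Arrows whose range already lies in \<open>V\<close> are cut off from
      \<open>X\<close>, so that the new range set is \<open>U\<close> minus \<open>V\<close> and the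
      two indicators add up to that of \<open>V \<union> U\<close> in any characteristic.\<close>
    let ?C = "{x \<in> arrows G. rng G x \<in> arrows G - V}"
    have "openin (gtop G) ?C"
      by (rule openin_continuous_map_preimage[OF continuous_rng]) (simp add: compact_closed openin_diff V)
    moreover have "closedin (gtop G) ?C"
      by (rule closedin_continuous_map_preimage[OF continuous_rng]) (simp add: closedin_diff V)
    ultimately have X': "compact_open_bisection G (X \<inter> ?C)" by (rule bisection_Int_clopen[OF X(1)])
    let ?X = "X \<inter> ?C"
    have "(indicator ?X :: 'g \<Rightarrow> 'k) \<in> deg k"
      by (rule indicator1_deg[OF X']) (use X(2) in blast)
    moreover have "(indicator (ginv G ` ?X) :: 'g \<Rightarrow> 'k) \<in> deg (- k)"
      by (rule indicator1_deg[OF bisection_ginv[OF X']]) (use X(2) ginv_lev in blast)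
    ultimately have "indicator ?X \<otimes>\<^bsub>steinberg\<^esub> indicator (ginv G ` ?X) \<in> ?S"
      by (rule product_span_incl)
    then have "convolution G (indicator ?X) (indicator (ginv G ` ?X)) \<in> ?S"
      by (simp only: steinberg_ring_simps)
    then have "indicator (rng G ` ?X) \<in> ?S" by (simp only: convolution_bisection_inverse[OF X'])
    from S.a_closed[OF V(5) this] have "(\<lambda>x. indicator V x + indicator (rng G ` ?X) x) \<in> ?S"
      by (simp only: steinberg_ring_simps)
    moreover have "(\<lambda>x. indicator V x + indicator (rng G ` ?X) x :: 'k) = indicator (V \<union> U)"
    proof
      fix x
      have "x \<in> rng G ` ?X \<longleftrightarrow> x \<in> U \<and> x \<notin> V"
        using bisection_subset[OF X(1)] X(3) by (auto simp: rng_closed)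
      then show "indicator V x + indicator (rng G ` ?X) x = (indicator (V \<union> U) x :: 'k)"
        by (auto simp: indicator_def)
    qed
    ultimately have S: "(indicator (V \<union> U) :: 'g \<Rightarrow> 'k) \<in> ?S" by (simp only:)
    have "openin (gtop G) U" unfolding X(3) by (rule openin_rng[OF bisection_open[OF X(1)]])
    moreover have "compactin (gtop G) U"
      unfolding X(3) by (rule image_compactin[OF bisection_compact[OF X(1)] continuous_rng])
    moreover have "U \<subseteq> units" unfolding X(3) using bisection_subset[OF X(1)] rng_units by blast
    ultimately have "openin (gtop G) (V \<union> U)" "compactin (gtop G) (V \<union> U)" "V \<union> U \<subseteq> units"
      using V(1-3) by (simp_all add: openin_Un compactin_Un)
    moreover have "\<Union>(insert U \<F>) \<subseteq> V \<union> U" using V(4) by auto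
    ultimately show ?case using S by blast
  qed
  then obtain V where V: "openin (gtop G) V" "compactin (gtop G) V" "V \<subseteq> units" "\<Union>\<F> \<subseteq> V"
    "(indicator V :: 'g \<Rightarrow> 'k) \<in> ?S" by (elim exE conjE)
  show thesis
    by (rule that[OF bisection_units[OF V(1-3)] V(3) order.trans[OF \<F>(3) V(4)] V(5)])
qed

end

section \<open>Local units from unperforation and the conclusion\<close>

locale unperforated_groupoid = cocycle_groupoid G c for G :: "'g groupoid" and c :: "'g \<Rightarrow> int" +
  assumes unperforated: "unperforated G c"
begin

lemma unperforated_list:
  assumes "g \<in> lev n" "n > 0"
  obtains gs where "gs \<noteq> []" "set gs \<subseteq> lev 1" "is_product G gs g"
proof -
  have "g \<in> lev (int (nat n))" "nat n > 0" using assms by auto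
  then obtain gs where "length gs = nat n" "set gs \<subseteq> lev 1" "is_product G gs g"
    using unperforated unfolding unperforated_def by blast
  then show thesis using that by (auto simp: is_product_def)
qed

lemma unperforated_rng_src:
  assumes "g \<in> lev n" "n > 0"
  shows "rng G g \<in> rng G ` lev 1" "src G g \<in> src G ` lev 1"
proof -
  obtain gs where gs: "gs \<noteq> []" "set gs \<subseteq> lev 1" "is_product G gs g"
    using unperforated_list[OF assms] .
  then have "rng G g = rng G (hd gs)" "src G g = src G (last gs)"
    using gprod_props[of gs] by (auto simp: is_product_def lev_iff subset_iff)
  with gs show "rng G g \<in> rng G ` lev 1" "src G g \<in> src G ` lev 1"
    by (auto simp: subset_iff)
qed

text \<open>For n > 0 the inverse of the last factor of \<open>g\<close> has range s(g); for n < 0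
  the first factor of the inverse of \<open>g\<close> has it. This is the covering hypothesis of
  \<open>local_unit\<close> for right units, and the point where unperforation yields local
  units.\<close>

lemma src_in_rng_lev:
  assumes "g \<in> lev n" "n \<noteq> 0"
  shows "src G g \<in> rng G ` lev (- sgn n)"
proof (cases "n > 0")
  case True
  then obtain h where "h \<in> lev 1" "src G g = src G h" using unperforated_rng_src(2)[OF assms(1)] by auto
  then have "src G g = rng G (ginv G h)" "ginv G h \<in> lev (- 1)"
    using ginv_lev by (auto simp: lev_iff rng_ginv)
  with True show ?thesis by simp
next
  case False
  then have "n < 0" using assms by simp
  then have "rng G (ginv G g) \<in> rng G ` lev 1" using unperforated_rng_src(1)[OF ginv_lev[OF assms(1)]] by simp
  with \<open>n < 0\<close> assms show ?thesis by (simp add: lev_iff rng_ginv)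
qed

lemma product_of_levels:
  assumes g: "g \<in> arrows G"
  shows "\<exists>gs. set gs \<subseteq> lev 0 \<union> lev 1 \<union> lev (- 1) \<and> is_product G gs g"
proof -
  consider "c g = 0" | "c g > 0" | "c g < 0" by linarith
  then show ?thesis
  proof cases
    case 1
    with g have "set [g] \<subseteq> lev 0 \<union> lev 1 \<union> lev (- 1)" "is_product G [g] g"
      by (simp_all add: is_product_def lev_iff)
    then show ?thesis by blast
  next
    case 2
    have "g \<in> lev (c g)" using g by (simp add: lev_iff)
    then obtain gs where "gs \<noteq> []" "set gs \<subseteq> lev 1" "is_product G gs g"
      using unperforated_list[OF _ 2] by blast
    then show ?thesis by blast
  next
    case 3
    have "ginv G g \<in> lev (- c g)" using g by (intro ginv_lev) (simp add: lev_iff)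
    moreover have "0 < - c g" using 3 by simp
    ultimately obtain gs where gs: "gs \<noteq> []" "set gs \<subseteq> lev 1" "is_product G gs (ginv G g)"
      using unperforated_list by blast
    have "set gs \<subseteq> arrows G" using gs(2) by (auto simp: lev_iff)
    from is_product_ginv[OF gs(3) this] have "is_product G (rev (map (ginv G) gs)) g"
      by (simp add: ginv_ginv g)
    moreover have "set (rev (map (ginv G) gs)) \<subseteq> lev (- 1)" using gs(2) ginv_lev by auto
    ultimately show ?thesis by blast
  qed
qed

lemma steinberg_locally_unital:
  "locally_unital_graded_ring (steinberg :: ('g \<Rightarrow> 'k::field) ring) deg"
proof -
  interpret graded_ring "steinberg :: ('g \<Rightarrow> 'k) ring" deg by (rule steinberg_graded_ring)
  show ?thesis
  proof unfold_locales
    fix F :: "('g \<Rightarrow> 'k) set" assume F: "finite F" "F \<subseteq> deg 1"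
    let ?K = "\<Union>f\<in>F. rng G ` {x. f x \<noteq> 0}"
    have "compactin (gtop G) ?K"
      using F by (intro compactin_Union) (auto simp: deg_iff intro!: image_compactin[OF steinberg_support_compact continuous_rng])
    moreover have "?K \<subseteq> rng G ` lev 1" using F by (auto simp: deg_iff)
    ultimately obtain V where V: "compact_open_bisection G V" "V \<subseteq> units" "?K \<subseteq> V"
      "(indicator V :: 'g \<Rightarrow> 'k) \<in> product_span steinberg (deg 1) (deg (- 1))"
      by (rule local_unit)
    have "convolution G (indicator V) f = f" if "f \<in> F" for f
    proof
      fix z
      have f: "f \<in> steinberg_functions G" using that F by (auto simp: deg_iff)
      show "convolution G (indicator V) f z = f z"
        unfolding convolution_unit_left[OF f V(1,2)] using that V(3) steinberg_outside[OF f, of z] by auto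
    qed
    with V(4) show "\<exists>e\<in>product_span steinberg (deg 1) (deg (- 1)). \<forall>f\<in>F. e \<otimes>\<^bsub>steinberg\<^esub> f = f"
      by auto
  next
    fix n :: int and F :: "('g \<Rightarrow> 'k) set" assume F: "n \<noteq> 0" "finite F" "F \<subseteq> deg n"
    let ?K = "\<Union>f\<in>F. src G ` {x. f x \<noteq> 0}"
    have "compactin (gtop G) ?K"
      using F by (intro compactin_Union) (auto simp: deg_iff intro!: image_compactin[OF steinberg_support_compact continuous_src])
    moreover have "?K \<subseteq> rng G ` lev (- sgn n)" using F src_in_rng_lev[OF _ F(1)] by (auto simp: deg_iff)
    ultimately obtain V where V: "compact_open_bisection G V" "V \<subseteq> units" "?K \<subseteq> V"
      "(indicator V :: 'g \<Rightarrow> 'k) \<in> product_span steinberg (deg (- sgn n)) (deg (- (- sgn n)))"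
      by (rule local_unit)
    have "convolution G f (indicator V) = f" if "f \<in> F" for f
    proof
      fix z
      have f: "f \<in> steinberg_functions G" using that F by (auto simp: deg_iff)
      show "convolution G f (indicator V) z = f z"
        unfolding convolution_unit_right[OF f V(1,2)] using that V(3) steinberg_outside[OF f, of z] by auto
    qed
    with V(4) show "\<exists>e\<in>product_span steinberg (deg (- sgn n)) (deg (sgn n)). \<forall>f\<in>F. f \<otimes>\<^bsub>steinberg\<^esub> e = f"
      by auto
  next
    fix h :: "'g \<Rightarrow> 'k" assume h: "h \<in> deg 0" and ann: "\<And>q. q \<in> deg 1 \<Longrightarrow> h \<otimes>\<^bsub>steinberg\<^esub> q = \<zero>\<^bsub>steinberg\<^esub>"
    have hS: "h \<in> steinberg_functions G" using h by (simp add: deg_iff)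
    \<comment> \<open>The smallest candidate for a right unit of \<open>h\<close>: the sources of
      its support, a compact open set as \<open>src\<close> is continuous and open.\<close>
    let ?V = "src G ` {x. h x \<noteq> 0}"
    have arr: "x \<in> arrows G" if "h x \<noteq> 0" for x using that steinberg_outside[OF hS] by blast
    have V: "compact_open_bisection G ?V" "?V \<subseteq> units"
      using arr by (auto intro!: bisection_units openin_src steinberg_support_open[OF hS]
          image_compactin[OF steinberg_support_compact[OF hS] continuous_src] src_units)
    have "convolution G h (indicator ?V) = h"
    proof
      show "convolution G h (indicator ?V) z = h z" for z
        unfolding convolution_unit_right[OF hS V] using arr[of z] by auto
    qed
    moreover have "convolution G p (indicator ?V) = (\<lambda>x. 0)" if p: "p \<in> deg (- 1)" for p
    proof
      fix z
      have pS: "p \<in> steinberg_functions G" using p by (simp add: deg_iff)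
      have "p z = 0" if "src G z \<in> ?V"
      proof (rule ccontr)
        assume "p z \<noteq> 0"
        then have z: "z \<in> lev (- 1)" using p by (simp add: deg_iff)
        obtain x where x: "h x \<noteq> 0" "src G z = src G x" using \<open>src G z \<in> ?V\<close> by auto
        \<comment> \<open>Since z and x share their source, x z^{-1} is defined, and a bisection of
          degree \<open>1\<close> around z^{-1} gives a q with (h q)(x z^{-1}) = h(x), contrary to h
          q = 0.\<close>
        have y: "ginv G z \<in> lev 1" using ginv_lev[OF z] by simp
        obtain X where X: "compact_open_bisection G X" "ginv G z \<in> X" "X \<subseteq> lev 1"
          using bisection_nbhd[OF lev_open y] .
        have "src G x = rng G (ginv G z)" using z x by (simp add: lev_iff rng_ginv)
        then have "h x = 0"
          using convolution_indicator_right[OF hS X(1) arr[OF x(1)] X(2)] ann[OF indicator1_deg[OF X(1,3)]] by simp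
        with x show False by simp
      qed
      then show "convolution G p (indicator ?V) z = 0"
        unfolding convolution_unit_right[OF pS V] by auto
    qed
    moreover have "(indicator ?V :: 'g \<Rightarrow> 'k) \<in> deg 0"
      using arr by (intro indicator1_deg V) (auto simp: lev_iff c_src src_closed)
    ultimately show "\<exists>v\<in>deg 0. h \<otimes>\<^bsub>steinberg\<^esub> v = h \<and> (\<forall>p\<in>deg (- 1). p \<otimes>\<^bsub>steinberg\<^esub> v = \<zero>\<^bsub>steinberg\<^esub>)"
      by auto
  qed
qed

lemma steinberg_k_algebra: "k_algebra scale_fun (steinberg :: ('g \<Rightarrow> 'k::field) ring)"
  by (auto simp: k_algebra_def steinberg_nu_ring scale_fun_def steinberg_carrier steinberg_scale
      convolution_scale algebra_simps)

theorem steinberg_cuntz_pimsner: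
  defines "A \<equiv> steinberg :: ('g \<Rightarrow> 'k::field) ring"
    and "R \<equiv> steinberg_ring G (lev 0)" and "P \<equiv> steinberg_bimodule G (lev (- 1))"
    and "Q \<equiv> steinberg_bimodule G (lev 1)"
  shows "\<exists>\<psi>. r_system R P Q \<psi> \<and>
    (\<forall>a \<in> carrier P. \<forall>b \<in> carrier Q. \<psi> (pure_tensor R P Q a b) = a \<otimes>\<^bsub>A\<^esub> b) \<and>
    cuntz_pimsner_defined R P Q \<psi> \<and>
    (\<exists>s \<phi>. cp_algebra_structure scale_fun scale_fun scale_fun R P Q \<psi> s \<and>
       graded_algebra_iso scale_fun A deg s (cuntz_pimsner_ring R P Q \<psi>) (cp_component R P Q \<psi>) \<phi>)"
proof -
  interpret lu: locally_unital_graded_ring "steinberg :: ('g \<Rightarrow> 'k) ring" deg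
    by (rule steinberg_locally_unital)
  \<comment> \<open>The concrete ring and bimodules coincide with those built from the grading as
    records, fields without meaning included, so no isomorphism of systems intervenes.\<close>
  have R: "R = lu.R0" unfolding R_def lu.R0_def by (simp add: steinberg_ring_def)
  have comp: "steinberg_bimodule G (lev n) = lu.component n" for n
    unfolding lu.component_def steinberg_bimodule_def by (simp add: steinberg_ring_def ring.defs)
  have PQ: "P = lu.component (- 1)" "Q = lu.component 1" by (simp_all add: P_def Q_def comp)
  obtain \<psi> where \<psi>: "\<psi> \<in> bimodule_hom lu.R0 (tensor lu.R0 lu.P lu.Q) (self_bimodule lu.R0)"
    "\<forall>p\<in>deg (- 1). \<forall>q\<in>deg 1. \<psi> (pure_tensor lu.R0 lu.P lu.Q p q) = p \<otimes>\<^bsub>steinberg\<^esub> q"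
    using lu.product_pairing_ex by blast
  interpret sys: graded_ring_system "steinberg :: ('g \<Rightarrow> 'k) ring" deg \<psi>
    by unfold_locales (use \<psi> in auto)
  have "scale_fun k f \<in> deg n" if "f \<in> deg n" for k :: 'k and f n
    using that by (auto simp: deg_iff scale_fun_def steinberg_scale)
  then show ?thesis
    unfolding R PQ A_def
    using sys.rs.r_system_axioms \<psi>(2) sys.cuntz_pimsner_defined
      sys.cuntz_pimsner_graded_algebra_iso[OF steinberg_k_algebra]
    by (intro exI[of _ \<psi>]) simp
qed

end

theorem corollary4p6:
  fixes G :: "'g groupoid" and c :: "'g \<Rightarrow> int"
    and A :: "('g \<Rightarrow> 'k::field) ring" and R :: "('g \<Rightarrow> 'k) ring"
    and P Q :: "('g \<Rightarrow> 'k, 'g \<Rightarrow> 'k) bimodule"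
    and H0 H1 Hm1 :: "'g set"
  assumes ample: "ample_hausdorff_groupoid G"
    and loc_compact: "locally_compact_space (gtop G)"
    and cocycle: "continuous_cocycle G c"
    and unperf: "unperforated G c"
  defines "H0 \<equiv> level G c 0" and "H1 \<equiv> level G c 1" and "Hm1 \<equiv> level G c (- 1)"
    and "A \<equiv> steinberg_ring G (arrows G)"
    and "R \<equiv> steinberg_ring G (level G c 0)"
    and "P \<equiv> steinberg_bimodule G (level G c (- 1))"
    and "Q \<equiv> steinberg_bimodule G (level G c 1)"
  shows "(set_comp G H0 H0 \<subseteq> H0 \<and>
          set_comp G H0 H1 \<union> set_comp G H1 H0 \<subseteq> H1 \<and>
          set_comp G H0 Hm1 \<union> set_comp G Hm1 H0 \<subseteq> Hm1 \<and>
          set_comp G Hm1 H1 \<subseteq> H0 \<and>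
          rng G ` H1 \<union> src G ` Hm1 \<subseteq> set_comp G H1 Hm1) \<and>
         (\<forall>B. compact_open_bisection G B \<and> B \<subseteq> H0 \<and> src G ` B \<inter> rng G ` H1 = {} \<longrightarrow>
            src G ` B \<subseteq> H0) \<and>
         (\<forall>g \<in> arrows G. \<exists>gs. set gs \<subseteq> H0 \<union> H1 \<union> Hm1 \<and> is_product G gs g) \<and>
         (\<exists>\<psi>. r_system R P Q \<psi> \<and>
            (\<forall>a \<in> carrier P. \<forall>b \<in> carrier Q. \<psi> (pure_tensor R P Q a b) = a \<otimes>\<^bsub>A\<^esub> b) \<and>
            cuntz_pimsner_defined R P Q \<psi> \<and>
            (\<exists>s \<phi>. cp_algebra_structure
                      (scale_fun :: 'k \<Rightarrow> _) (scale_fun :: 'k \<Rightarrow> _) (scale_fun :: 'k \<Rightarrow> _) R P Q \<psi> s \<and>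
               graded_algebra_iso
                 (scale_fun :: 'k \<Rightarrow> _) A (\<lambda>n. steinberg_supported G (level G c n))
                 s (cuntz_pimsner_ring R P Q \<psi>) (cp_component R P Q \<psi>) \<phi>))"
proof -
  interpret ample_hausdorff_groupoid G by (rule ample)
  interpret unperforated_groupoid G c
    by unfold_locales (rule cocycle, rule unperf)
  have 1: "set_comp G H0 H0 \<subseteq> H0 \<and>
      set_comp G H0 H1 \<union> set_comp G H1 H0 \<subseteq> H1 \<and>
      set_comp G H0 Hm1 \<union> set_comp G Hm1 H0 \<subseteq> Hm1 \<and>
      set_comp G Hm1 H1 \<subseteq> H0 \<and>
      rng G ` H1 \<union> src G ` Hm1 \<subseteq> set_comp G H1 Hm1"
    using set_comp_lev[of 0 0] set_comp_lev[of 0 1] set_comp_lev[of 1 0] set_comp_lev[of 0 "- 1"]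
      set_comp_lev[of "- 1" 0] set_comp_lev[of "- 1" 1] rng_lev_set_comp
    unfolding H0_def H1_def Hm1_def by simp
  \<comment> \<open>Sources are identity arrows, on which a cocycle vanishes.\<close>
  have 2: "\<forall>B. compact_open_bisection G B \<and> B \<subseteq> H0 \<and> src G ` B \<inter> rng G ` H1 = {} \<longrightarrow> src G ` B \<subseteq> H0"
    unfolding H0_def by (auto simp: lev_iff c_src src_closed)
  have 3: "\<forall>g\<in>arrows G. \<exists>gs. set gs \<subseteq> H0 \<union> H1 \<union> Hm1 \<and> is_product G gs g"
    unfolding H0_def H1_def Hm1_def by (intro ballI product_of_levels)
  show ?thesis
    unfolding A_def R_def P_def Q_def
    by (rule conjI[OF 1 conjI[OF 2 conjI[OF 3 steinberg_cuntz_pimsner]]])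
qed

end
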